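(* Let $\Lambda$ be a cyclic Nakayama algebra of infinite global dimension, and let $r$ be the number of monomial relations defining $\Lambda$. Then $\varphi\dim\Lambda\le 2r$, and this bound is sharp: for every $r$ there is a cyclic Nakayama algebra of infinite global dimension defined by $r$ relations whose $\varphi$-dimension equals $2r$.
   Context: Cyclic Nakayama algebras. Let $k$ be a field and let $Q$ be the cyclic quiver with vertices $1,\dots,N$ ($N\ge 3$) and arrows $\alpha_i:i\to i+1$ for $1\le i<N$ and $\alpha_N:N\to 1$; indices are read modulo $N$, and paths are written right to left. A cyclic Nakayama algebra is $\Lambda=kQ/\langle REL\rangle$, where $REL$ is an irredundant system of $r\ge 1$ monomial relations $\alpha_{k_{2i}}\cdots\alpha_{k_{2i-1}+1}\alpha_{k_{2i-1}}=0$ ($1\le i\le r$) with $k_f\in\{1,\dots,N\}$ and $1\le k_1<k_3<\dots<k_{2r-1}\le N$. Irredundant means no relation is a consequence of the others. Each relation is a path of length at least $2$ (possibly winding several times around the cycle). The number $r$ is the number of relations in the irredundant system. All modules are finitely generated. The $\varphi$-dimension. For an artin algebra $\Lambda$ let $K_0$ be the abelian group generated by symbols $[X]$, $X$ a finitely generated $\Lambda$-module, modulo $[C]=[A]+[B]$ if $C\cong A\oplus B$ and $[P]=0$ if $P$ is projective. Let $L:K_0\to K_0$ be the homomorphism with $L[M]=[\Omega M]$, where $\Omega M$ is the first syzygy of $M$ (kernel of a projective cover). For a module $M$ let $\langle \mathrm{add}\,M\rangle$ be the subgroup of $K_0$ generated by the classes of all indecomposable summands of $M$. Define $$\varphi(M)=\min\{t\ge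 0\mid \operatorname{rank}(L^t\langle \mathrm{add}\,M\rangle)=\operatorname{rank}(L^{t+j}\langle \mathrm{add}\,M\rangle)\text{ for all } j\ge 1\},$$ and $\varphi\dim(\Lambda)=\sup\{\varphi(M)\mid M \text{ a finitely generated } \Lambda\text{-module}\}$. *)

theory Defs
  imports
    "HOL-Algebra.QuotRing"
    "HOL-Algebra.Module"
    "HOL-Algebra.Free_Abelian_Groups"
    "HOL-Library.Extended_Nat"
begin

section \<open>Finitely generated left modules over a ring\<close>

text \<open>
  The locale \<open>module\<close> of \<open>HOL-Algebra\<close> requires a commutative ring, so it cannot be used here;
  its record type and the locale \<open>submodule\<close> can. The ring fields \<open>mult\<close> and \<open>one\<close> of a
  module record carry no meaning.
\<close>

locale left_module = R?: ring R + M?: abelian_group M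
  for R (structure) and M (structure) +
  assumes smult_closed:
      "\<lbrakk>a \<in> carrier R; x \<in> carrier M\<rbrakk> \<Longrightarrow> a \<odot>\<^bsub>M\<^esub> x \<in> carrier M"
    and smult_l_distr:
      "\<lbrakk>a \<in> carrier R; b \<in> carrier R; x \<in> carrier M\<rbrakk>
        \<Longrightarrow> (a \<oplus>\<^bsub>R\<^esub> b) \<odot>\<^bsub>M\<^esub> x = a \<odot>\<^bsub>M\<^esub> x \<oplus>\<^bsub>M\<^esub> b \<odot>\<^bsub>M\<^esub> x"
    and smult_r_distr:
      "\<lbrakk>a \<in> carrier R; x \<in> carrier M; y \<in> carrier M\<rbrakk>
        \<Longrightarrow> a \<odot>\<^bsub>M\<^esub> (x \<oplus>\<^bsub>M\<^esub> y) = a \<odot>\<^bsub>M\<^esub> x \<oplus>\<^bsub>M\<^esub> a \<odot>\<^bsub>M\<^esub> y"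
    and smult_assoc1:
      "\<lbrakk>a \<in> carrier R; b \<in> carrier R; x \<in> carrier M\<rbrakk>
        \<Longrightarrow> (a \<otimes>\<^bsub>R\<^esub> b) \<odot>\<^bsub>M\<^esub> x = a \<odot>\<^bsub>M\<^esub> (b \<odot>\<^bsub>M\<^esub> x)"
    and smult_one:
      "x \<in> carrier M \<Longrightarrow> \<one>\<^bsub>R\<^esub> \<odot>\<^bsub>M\<^esub> x = x"

text \<open>
  Every finitely generated module over a ring with elements in \<open>'a\<close> is isomorphic to a quotient
  of a free module \<open>R^n\<close>, whose elements are cosets, i.e. sets of functions \<open>nat \<Rightarrow> 'a\<close>. Modules with
  carrier inside this one type (and arbitrary operations) therefore represent all isomorphism
  classes of finitely generated modules, and they are closed under submodules.
\<close>

type_synonym 'a lmod = "('a, (nat \<Rightarrow> 'a) set) module"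

definition lmod_hom :: "('a, 'r) ring_scheme \<Rightarrow> ('a, 'm) module \<Rightarrow> ('a, 'n) module \<Rightarrow> ('m \<Rightarrow> 'n) set"
  where "lmod_hom R M N = {h \<in> carrier M \<rightarrow> carrier N.
    (\<forall>x\<in>carrier M. \<forall>y\<in>carrier M. h (x \<oplus>\<^bsub>M\<^esub> y) = h x \<oplus>\<^bsub>N\<^esub> h y) \<and>
    (\<forall>a\<in>carrier R. \<forall>x\<in>carrier M. h (a \<odot>\<^bsub>M\<^esub> x) = a \<odot>\<^bsub>N\<^esub> h x)}"

definition lmod_epi :: "('a, 'r) ring_scheme \<Rightarrow> ('a, 'm) module \<Rightarrow> ('a, 'n) module \<Rightarrow> ('m \<Rightarrow> 'n) set"
  where "lmod_epi R M N = {h \<in> lmod_hom R M N. h ` carrier M = carrier N}"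

definition lmod_iso :: "('a, 'r) ring_scheme \<Rightarrow> ('a, 'm) module \<Rightarrow> ('a, 'n) module \<Rightarrow> bool"
  where "lmod_iso R M N \<longleftrightarrow> (\<exists>h \<in> lmod_hom R M N. bij_betw h (carrier M) (carrier N))"

definition lmod_ker :: "('a, 'm) module \<Rightarrow> ('a, 'n) module \<Rightarrow> ('m \<Rightarrow> 'n) \<Rightarrow> ('a, 'm) module"
  where "lmod_ker M N h = M\<lparr>carrier := {x \<in> carrier M. h x = \<zero>\<^bsub>N\<^esub>}\<rparr>"

definition lmod_sum :: "('a, 'm) module \<Rightarrow> ('a, 'n) module \<Rightarrow> ('a, 'm \<times> 'n) module"
  where "lmod_sum A B = \<lparr>
    carrier = carrier A \<times> carrier B,
    monoid.mult = undefined,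
    one = undefined,
    ring.zero = (\<zero>\<^bsub>A\<^esub>, \<zero>\<^bsub>B\<^esub>),
    ring.add = (\<lambda>(a, b) (a', b'). (a \<oplus>\<^bsub>A\<^esub> a', b \<oplus>\<^bsub>B\<^esub> b')),
    module.smult = (\<lambda>r (a, b). (r \<odot>\<^bsub>A\<^esub> a, r \<odot>\<^bsub>B\<^esub> b))\<rparr>"

definition fin_gen :: "('a, 'r) ring_scheme \<Rightarrow> ('a, 'm) module \<Rightarrow> bool"
  where "fin_gen R M \<longleftrightarrow> (\<exists>S. finite S \<and> S \<subseteq> carrier M \<and>
    (\<forall>U. submodule U R M \<and> S \<subseteq> U \<longrightarrow> U = carrier M))"

definition fg_modules :: "('a, 'r) ring_scheme \<Rightarrow> 'a lmod set"
  where "fg_modules R = {M. left_module R M \<and> fin_gen R M}"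

definition projective :: "('a, 'r) ring_scheme \<Rightarrow> 'a lmod \<Rightarrow> bool"
  where "projective R P \<longleftrightarrow> left_module R P \<and>
    (\<forall>(X :: 'a lmod) (Y :: 'a lmod) g f.
      left_module R X \<and> left_module R Y \<and> g \<in> lmod_epi R X Y \<and> f \<in> lmod_hom R P Y
      \<longrightarrow> (\<exists>f' \<in> lmod_hom R P X. \<forall>p\<in>carrier P. g (f' p) = f p))"

definition indecomposable :: "('a, 'r) ring_scheme \<Rightarrow> 'a lmod \<Rightarrow> bool"
  where "indecomposable R M \<longleftrightarrow> left_module R M \<and> carrier M \<noteq> {\<zero>\<^bsub>M\<^esub>} \<and>
    (\<forall>(A :: 'a lmod) (B :: 'a lmod).
      left_module R A \<and> left_module R B \<and> lmod_iso R M (lmod_sum A B)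
      \<longrightarrow> carrier A = {\<zero>\<^bsub>A\<^esub>} \<or> carrier B = {\<zero>\<^bsub>B\<^esub>})"

definition superfluous :: "('a, 'r) ring_scheme \<Rightarrow> ('a, 'm) module \<Rightarrow> 'm set \<Rightarrow> bool"
  where "superfluous R M K \<longleftrightarrow>
    (\<forall>U. submodule U R M \<and> K <+>\<^bsub>M\<^esub> U = carrier M \<longrightarrow> U = carrier M)"

definition projective_cover :: "('a, 'r) ring_scheme \<Rightarrow> 'a lmod \<Rightarrow> 'a lmod
    \<Rightarrow> ((nat \<Rightarrow> 'a) set \<Rightarrow> (nat \<Rightarrow> 'a) set) \<Rightarrow> bool"
  where "projective_cover R M P p \<longleftrightarrow> P \<in> fg_modules R \<and> projective R P \<and>
    p \<in> lmod_epi R P M \<and> superfluous R P (carrier (lmod_ker P M p))"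

text \<open>Projective covers are unique up to isomorphism, hence so is the module chosen here.\<close>

definition syzygy :: "('a, 'r) ring_scheme \<Rightarrow> 'a lmod \<Rightarrow> 'a lmod"
  where "syzygy R M = (SOME K. \<exists>P p. projective_cover R M P p \<and> K = lmod_ker P M p)"

section \<open>Global dimension\<close>

text \<open>\<open>pd_le R n M\<close>: there is an exact sequence \<open>0 \<rightarrow> P\<^sub>n \<rightarrow> \<dots> \<rightarrow> P\<^sub>0 \<rightarrow> M \<rightarrow> 0\<close> with all \<open>P\<^sub>i\<close>
  finitely generated projective.\<close>

primrec pd_le :: "('a, 'r) ring_scheme \<Rightarrow> nat \<Rightarrow> 'a lmod \<Rightarrow> bool"
  where
    "pd_le R 0 M \<longleftrightarrow> M \<in> fg_modules R \<and> projective R M"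
  | "pd_le R (Suc n) M \<longleftrightarrow> (\<exists>P p. P \<in> fg_modules R \<and> projective R P \<and>
      p \<in> lmod_epi R P M \<and> pd_le R n (lmod_ker P M p))"

definition proj_dim :: "('a, 'r) ring_scheme \<Rightarrow> 'a lmod \<Rightarrow> enat"
  where "proj_dim R M = Inf {enat n | n. pd_le R n M}"

definition gl_dim :: "('a, 'r) ring_scheme \<Rightarrow> enat"
  where "gl_dim R = (SUP M \<in> fg_modules R. proj_dim R M)"

section \<open>The group \<open>K\<^sub>0\<close> and the \<open>\<phi>\<close>-dimension\<close>

definition K0_rel :: "('a, 'r) ring_scheme \<Rightarrow> ('a lmod \<Rightarrow>\<^sub>0 int) set"
  where "K0_rel R = generate (free_Abelian_group (fg_modules R))
    ({frag_of C - (frag_of A + frag_of B) | A B C.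
        A \<in> fg_modules R \<and> B \<in> fg_modules R \<and> C \<in> fg_modules R \<and> lmod_iso R C (lmod_sum A B)}
     \<union> {frag_of P | P. P \<in> fg_modules R \<and> projective R P})"

definition K0 :: "('a, 'r) ring_scheme \<Rightarrow> ('a lmod \<Rightarrow>\<^sub>0 int) set monoid"
  where "K0 R = free_Abelian_group (fg_modules R) Mod K0_rel R"

definition K0_class :: "('a, 'r) ring_scheme \<Rightarrow> 'a lmod \<Rightarrow> ('a lmod \<Rightarrow>\<^sub>0 int) set"
  where "K0_class R M = K0_rel R #>\<^bsub>free_Abelian_group (fg_modules R)\<^esub> frag_of M"

definition K0_L :: "('a, 'r) ring_scheme \<Rightarrow> ('a lmod \<Rightarrow>\<^sub>0 int) set \<Rightarrow> ('a lmod \<Rightarrow>\<^sub>0 int) set"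
  where "K0_L R = (THE L. L \<in> hom (K0 R) (K0 R) \<and> L \<in> extensional (carrier (K0 R)) \<and>
    (\<forall>M \<in> fg_modules R. L (K0_class R M) = K0_class R (syzygy R M)))"

text \<open>The subgroup generated by the classes of the indecomposable direct summands of \<open>M\<close>.\<close>

definition add_span :: "('a, 'r) ring_scheme \<Rightarrow> 'a lmod \<Rightarrow> ('a lmod \<Rightarrow>\<^sub>0 int) set set"
  where "add_span R M = generate (K0 R)
    {K0_class R X | X. X \<in> fg_modules R \<and> indecomposable R X \<and>
      (\<exists>Y \<in> fg_modules R. lmod_iso R M (lmod_sum X Y))}"

definition int_independent :: "('g, 'b) monoid_scheme \<Rightarrow> 'g set \<Rightarrow> bool"
  where "int_independent G B \<longleftrightarrow> finite B \<and> B \<subseteq> carrier G \<and>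
    (\<forall>c :: 'g \<Rightarrow> int. (\<Otimes>\<^bsub>G\<^esub>b\<in>B. b [^]\<^bsub>G\<^esub> c b) = \<one>\<^bsub>G\<^esub> \<longrightarrow> (\<forall>b\<in>B. c b = 0))"

definition ab_rank :: "('g, 'b) monoid_scheme \<Rightarrow> 'g set \<Rightarrow> enat"
  where "ab_rank G H = Sup {enat (card B) | B. B \<subseteq> H \<and> int_independent G B}"

definition phi :: "('a, 'r) ring_scheme \<Rightarrow> 'a lmod \<Rightarrow> nat"
  where "phi R M = (LEAST t. \<forall>j\<ge>1.
    ab_rank (K0 R) ((K0_L R ^^ t) ` add_span R M)
      = ab_rank (K0 R) ((K0_L R ^^ (t + j)) ` add_span R M))"

definition phi_dim :: "('a, 'r) ring_scheme \<Rightarrow> enat"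
  where "phi_dim R = (SUP M \<in> fg_modules R. enat (phi R M))"

section \<open>Cyclic Nakayama algebras\<close>

text \<open>
  A path of the cyclic quiver with vertices \<open>1, \<dots>, N\<close> is determined by its source \<open>s\<close> and its
  length \<open>l\<close>, and is encoded as the pair \<open>(s, l)\<close>: it is the trivial path at \<open>s\<close> if \<open>l = 0\<close>, and
  \<open>\<alpha>\<^bsub>s+l-1\<^esub> \<dots> \<alpha>\<^bsub>s+1\<^esub> \<alpha>\<^bsub>s\<^esub>\<close> (indices modulo \<open>N\<close>) otherwise. Elements of the path algebra are finite
  linear combinations of such pairs.
\<close>

definition path_target :: "nat \<Rightarrow> nat \<times> nat \<Rightarrow> nat"
  where "path_target N p = (fst p - 1 + snd p) mod N + 1"

text \<open>Paths are composed from right to left: in a product \<open>y x\<close>, the path in \<open>x\<close> comes first.\<close>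

definition cyclic_path_algebra :: "'k::field itself \<Rightarrow> nat \<Rightarrow> (nat \<times> nat \<Rightarrow>\<^sub>0 'k) ring"
  where "cyclic_path_algebra _ N = \<lparr>
    carrier = {x. Poly_Mapping.keys x \<subseteq> {1..N} \<times> UNIV},
    monoid.mult = (\<lambda>y x. \<Sum>q\<in>Poly_Mapping.keys y. \<Sum>p\<in>Poly_Mapping.keys x.
      if path_target N p = fst q
      then Poly_Mapping.single (fst p, snd p + snd q)
             (Poly_Mapping.lookup y q * Poly_Mapping.lookup x p)
      else 0),
    one = (\<Sum>i\<in>{1..N}. Poly_Mapping.single (i, 0) 1),
    ring.zero = 0,
    ring.add = (+)\<rparr>"

definition path_ideal :: "'k::field itself \<Rightarrow> nat \<Rightarrow> (nat \<times> nat) set \<Rightarrow> (nat \<times> nat \<Rightarrow>\<^sub>0 'k) set"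
  where "path_ideal K N S =
    Idl\<^bsub>cyclic_path_algebra K N\<^esub> ((\<lambda>p. Poly_Mapping.single p 1) ` S)"

text \<open>
  A system of relations is the list of its paths, ordered by source. The length of a relation has to
  be recorded, as its first and last arrows do not determine how often it winds around the cycle.
\<close>

definition nakayama_relations :: "'k::field itself \<Rightarrow> nat \<Rightarrow> (nat \<times> nat) list \<Rightarrow> bool"
  where "nakayama_relations K N rels \<longleftrightarrow>
    rels \<noteq> [] \<and>
    set rels \<subseteq> {1..N} \<times> {2..} \<and>
    sorted_wrt (<) (map fst rels) \<and>
    (\<forall>\<rho> \<in> set rels. Poly_Mapping.single \<rho> 1 \<notin> path_ideal K N (set rels - {\<rho>}))"

definition nakayama_algebra :: "'k::field itself \<Rightarrow> nat \<Rightarrow> (nat \<times> nat) list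
    \<Rightarrow> (nat \<times> nat \<Rightarrow>\<^sub>0 'k) set ring"
  where "nakayama_algebra K N rels = cyclic_path_algebra K N Quot path_ideal K N (set rels)"

end

theory Submission
  imports Defs
begin

text \<open>Every finitely generated module over a cyclic Nakayama algebra is a direct sum of uniserial
  modules. On the universal cover of the quiver such a module is an interval \<open>[i, j)\<close> of vertices, and
  its projective cover is \<open>[i, f i)\<close>, where \<open>f i - i\<close> is the length of the \<open>i\<close>-th indecomposable projective.
  Hence \<open>\<Omega> [i, j) = [j, f i)\<close> and \<open>\<Omega>\<^sup>2 [i, j) = [f i, f j)\<close>. The values of \<open>f\<close> are the ends of the
  relations, so there are at most \<open>r\<close> of them modulo \<open>N\<close>, and \<open>f\<close> permutes the image of its \<open>r\<close>-th iterate.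
  Therefore \<open>L\<^bsup>2r+2n\<^esup> = L\<^bsup>2r\<^esup>\<close> for some \<open>n > 0\<close>, so \<open>L\<close> is injective on \<open>L\<^bsup>2r\<^esup> K\<^sub>0\<close> and no rank drops
  after step \<open>2r\<close>. Conversely, if the \<open>r\<close>-th iterate of \<open>f\<close> is constant modulo \<open>N\<close> but the previous one is
  not, there is an indecomposable module of projective dimension exactly \<open>2r\<close>, while
  \<open>\<Omega>\<close> fixes another module as soon as the projectives are long enough.\<close>

text \<open>The group \<open>K0\<close> is presented by generators and relations, which dictates two
  styles of argument. Identities between its endomorphisms are checked on interval classes.
  Non-vanishing needs additive invariants that factor through \<open>K0\<close>; the multiplicity of
  an interval type as a summand is such an invariant, and it yields classes of infinite order. Since
  \<open>syzygy\<close> is a choice, Schanuel's lemma has to come before \<open>K0_L\<close> can be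
  handled at all. In the periodicity argument it is too weak to know that a power of
  \<open>f\<close> fixes residues: the length of an interval survives only if both ends advance by
  the same multiple of \<open>N\<close>, and this is where monotonicity of \<open>f\<close> enters.
  The homological part sees only the vertex idempotents, the scalars and the sum \<open>A\<close> of
  all arrows; left multiples of \<open>A\<close> are right multiples, which replaces computing with
  paths. In the extremal algebras every relation contains two full turns: residues move as if the
  lengths were 0 and 1, while the projective at the fixed vertex has length \<open>2 * N\<close>, so
  that the interval of length \<open>N\<close> inside it is its own syzygy.\<close>

section \<open>Left modules, submodules and homomorphisms\<close>

lemma left_moduleI:
  fixes R (structure) and M (structure)
  assumes R: "ring R"
    and add: "\<And>x y. \<lbrakk>x \<in> carrier M; y \<in> carrier M\<rbrakk> \<Longrightarrow> x \<oplus>\<^bsub>M\<^esub> y \<in> carrier M"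
    and zero: "\<zero>\<^bsub>M\<^esub> \<in> carrier M"
    and assoc: "\<And>x y z. \<lbrakk>x \<in> carrier M; y \<in> carrier M; z \<in> carrier M\<rbrakk>
      \<Longrightarrow> (x \<oplus>\<^bsub>M\<^esub> y) \<oplus>\<^bsub>M\<^esub> z = x \<oplus>\<^bsub>M\<^esub> (y \<oplus>\<^bsub>M\<^esub> z)"
    and comm: "\<And>x y. \<lbrakk>x \<in> carrier M; y \<in> carrier M\<rbrakk> \<Longrightarrow> x \<oplus>\<^bsub>M\<^esub> y = y \<oplus>\<^bsub>M\<^esub> x"
    and l_zero: "\<And>x. x \<in> carrier M \<Longrightarrow> \<zero>\<^bsub>M\<^esub> \<oplus>\<^bsub>M\<^esub> x = x"
    and smult: "\<And>a x. \<lbrakk>a \<in> carrier R; x \<in> carrier M\<rbrakk> \<Longrightarrow> a \<odot>\<^bsub>M\<^esub> x \<in> carrier M"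
    and dl: "\<And>a b x. \<lbrakk>a \<in> carrier R; b \<in> carrier R; x \<in> carrier M\<rbrakk>
      \<Longrightarrow> (a \<oplus>\<^bsub>R\<^esub> b) \<odot>\<^bsub>M\<^esub> x = a \<odot>\<^bsub>M\<^esub> x \<oplus>\<^bsub>M\<^esub> b \<odot>\<^bsub>M\<^esub> x"
    and r_distr: "\<And>a x y. \<lbrakk>a \<in> carrier R; x \<in> carrier M; y \<in> carrier M\<rbrakk>
      \<Longrightarrow> a \<odot>\<^bsub>M\<^esub> (x \<oplus>\<^bsub>M\<^esub> y) = a \<odot>\<^bsub>M\<^esub> x \<oplus>\<^bsub>M\<^esub> a \<odot>\<^bsub>M\<^esub> y"
    and assoc1: "\<And>a b x. \<lbrakk>a \<in> carrier R; b \<in> carrier R; x \<in> carrier M\<rbrakk>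
      \<Longrightarrow> (a \<otimes>\<^bsub>R\<^esub> b) \<odot>\<^bsub>M\<^esub> x = a \<odot>\<^bsub>M\<^esub> (b \<odot>\<^bsub>M\<^esub> x)"
    and smult1: "\<And>x. x \<in> carrier M \<Longrightarrow> \<one>\<^bsub>R\<^esub> \<odot>\<^bsub>M\<^esub> x = x"
    and zero_smult: "\<And>x. x \<in> carrier M \<Longrightarrow> \<zero>\<^bsub>R\<^esub> \<odot>\<^bsub>M\<^esub> x = \<zero>\<^bsub>M\<^esub>"
  shows "left_module R M"
proof -
  interpret ring R by fact
  have "abelian_group M"
  proof (rule abelian_groupI)
    \<comment> \<open>The inverse of \<open>x\<close> is \<open>-1\<close> times \<open>x\<close>.
      This is why the rule asks for \<open>0 x = 0\<close>, from which scalar multiplication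
      supplies all inverses.\<close>
    fix x assume x: "x \<in> carrier M"
    have "(\<ominus>\<^bsub>R\<^esub> \<one>\<^bsub>R\<^esub>) \<odot>\<^bsub>M\<^esub> x \<oplus>\<^bsub>M\<^esub> x = (\<ominus>\<^bsub>R\<^esub> \<one>\<^bsub>R\<^esub> \<oplus>\<^bsub>R\<^esub> \<one>\<^bsub>R\<^esub>) \<odot>\<^bsub>M\<^esub> x"
      using x by (simp add: dl smult1 del: l_neg)
    then show "\<exists>y\<in>carrier M. y \<oplus>\<^bsub>M\<^esub> x = \<zero>\<^bsub>M\<^esub>"
      using x by (intro bexI[of _ "(\<ominus>\<^bsub>R\<^esub> \<one>\<^bsub>R\<^esub>) \<odot>\<^bsub>M\<^esub> x"]) (auto simp: zero_smult smult l_neg)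
  qed (use assms in auto)
  then show ?thesis
    by (intro left_module.intro left_module_axioms.intro) (use assms in auto)
qed

context left_module
begin

lemma smult_zero [simp]:
  assumes "a \<in> carrier R" shows "a \<odot>\<^bsub>M\<^esub> \<zero>\<^bsub>M\<^esub> = \<zero>\<^bsub>M\<^esub>"
proof -
  have "a \<odot>\<^bsub>M\<^esub> \<zero>\<^bsub>M\<^esub> \<oplus>\<^bsub>M\<^esub> a \<odot>\<^bsub>M\<^esub> \<zero>\<^bsub>M\<^esub> = a \<odot>\<^bsub>M\<^esub> \<zero>\<^bsub>M\<^esub>"
    using assms smult_r_distr[of a "\<zero>\<^bsub>M\<^esub>" "\<zero>\<^bsub>M\<^esub>"] by simp
  then show ?thesis
    using assms smult_closed by (metis M.add.l_cancel_one M.zero_closed)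
qed

lemma zero_smult [simp]:
  assumes "x \<in> carrier M" shows "\<zero>\<^bsub>R\<^esub> \<odot>\<^bsub>M\<^esub> x = \<zero>\<^bsub>M\<^esub>"
proof -
  have "\<zero>\<^bsub>R\<^esub> \<odot>\<^bsub>M\<^esub> x \<oplus>\<^bsub>M\<^esub> \<zero>\<^bsub>R\<^esub> \<odot>\<^bsub>M\<^esub> x = \<zero>\<^bsub>R\<^esub> \<odot>\<^bsub>M\<^esub> x"
    using assms smult_l_distr[of "\<zero>\<^bsub>R\<^esub>" "\<zero>\<^bsub>R\<^esub>" x] by simp
  then show ?thesis
    using assms smult_closed by (metis M.add.l_cancel_one R.zero_closed)
qed

lemma minus_one_smult:
  assumes "x \<in> carrier M" shows "(\<ominus>\<^bsub>R\<^esub> \<one>\<^bsub>R\<^esub>) \<odot>\<^bsub>M\<^esub> x = \<ominus>\<^bsub>M\<^esub> x"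
proof -
  have "(\<ominus>\<^bsub>R\<^esub> \<one>\<^bsub>R\<^esub>) \<odot>\<^bsub>M\<^esub> x \<oplus>\<^bsub>M\<^esub> x = (\<ominus>\<^bsub>R\<^esub> \<one>\<^bsub>R\<^esub> \<oplus>\<^bsub>R\<^esub> \<one>\<^bsub>R\<^esub>) \<odot>\<^bsub>M\<^esub> x"
    using assms by (simp add: smult_l_distr smult_one del: R.l_neg)
  also have "\<dots> = \<zero>\<^bsub>M\<^esub>" using assms by (simp add: R.l_neg)
  finally show ?thesis
    using assms by (simp add: M.minus_equality smult_closed)
qed

lemma smult_minus:
  assumes "a \<in> carrier R" "x \<in> carrier M"
  shows "a \<odot>\<^bsub>M\<^esub> (\<ominus>\<^bsub>M\<^esub> x) = \<ominus>\<^bsub>M\<^esub> (a \<odot>\<^bsub>M\<^esub> x)"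
proof -
  have "a \<odot>\<^bsub>M\<^esub> (\<ominus>\<^bsub>M\<^esub> x) \<oplus>\<^bsub>M\<^esub> a \<odot>\<^bsub>M\<^esub> x = \<zero>\<^bsub>M\<^esub>"
    using assms by (simp flip: smult_r_distr add: M.l_neg)
  then show ?thesis using assms by (simp add: M.minus_equality smult_closed)
qed

lemma submodule_iff:
  "submodule U R M \<longleftrightarrow> U \<subseteq> carrier M \<and> \<zero>\<^bsub>M\<^esub> \<in> U \<and> (\<forall>x\<in>U. \<forall>y\<in>U. x \<oplus>\<^bsub>M\<^esub> y \<in> U)
    \<and> (\<forall>a\<in>carrier R. \<forall>x\<in>U. a \<odot>\<^bsub>M\<^esub> x \<in> U)" (is "?l \<longleftrightarrow> ?r")
proof
  assume ?l
  then interpret submodule U R M .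
  show ?r using subset one_closed m_closed by auto
next
  assume r: ?r
  have "\<ominus>\<^bsub>M\<^esub> x \<in> U" if "x \<in> U" for x
    using r that minus_one_smult[of x] by (metis R.add.inv_closed R.one_closed subsetD)
  then show ?l using r
    by (intro submodule.intro subgroup.intro submodule_axioms.intro) (auto simp: a_inv_def)
qed

lemma submoduleD:
  assumes "submodule U R M"
  shows "U \<subseteq> carrier M" "\<zero>\<^bsub>M\<^esub> \<in> U" "\<And>x y. \<lbrakk>x \<in> U; y \<in> U\<rbrakk> \<Longrightarrow> x \<oplus>\<^bsub>M\<^esub> y \<in> U"
    "\<And>a x. \<lbrakk>a \<in> carrier R; x \<in> U\<rbrakk> \<Longrightarrow> a \<odot>\<^bsub>M\<^esub> x \<in> U" "\<And>x. x \<in> U \<Longrightarrow> \<ominus>\<^bsub>M\<^esub> x \<in> U"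
    "\<And>x y. \<lbrakk>x \<in> U; y \<in> U\<rbrakk> \<Longrightarrow> x \<ominus>\<^bsub>M\<^esub> y \<in> U"
proof -
  show *: "U \<subseteq> carrier M" "\<zero>\<^bsub>M\<^esub> \<in> U" "\<And>x y. \<lbrakk>x \<in> U; y \<in> U\<rbrakk> \<Longrightarrow> x \<oplus>\<^bsub>M\<^esub> y \<in> U"
    "\<And>a x. \<lbrakk>a \<in> carrier R; x \<in> U\<rbrakk> \<Longrightarrow> a \<odot>\<^bsub>M\<^esub> x \<in> U"
    using assms by (auto simp: submodule_iff)
  show **: "\<ominus>\<^bsub>M\<^esub> x \<in> U" if "x \<in> U" for x
    using that *(1,4) minus_one_smult[of x] by (metis R.add.inv_closed R.one_closed subsetD)
  show "x \<ominus>\<^bsub>M\<^esub> y \<in> U" if "x \<in> U" "y \<in> U" for x y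
    using *(3)[OF that(1) **[OF that(2)]] by (simp add: a_minus_def)
qed

lemma submodule_left_module:
  assumes "submodule U R M" shows "left_module R (M\<lparr>carrier := U\<rparr>)"
  using submoduleD[OF assms] R.ring_axioms
  by (intro left_moduleI)
     (auto simp: subset_iff M.add.m_ac smult_l_distr smult_r_distr smult_assoc1 smult_one)

lemma submodule_carrier: "submodule (carrier M) R M"
  by (simp add: submodule_iff smult_closed)

lemma submodule_zero: "submodule {\<zero>\<^bsub>M\<^esub>} R M"
  by (simp add: submodule_iff)

lemma submodule_cyclic:
  assumes "x \<in> carrier M" shows "submodule {a \<odot>\<^bsub>M\<^esub> x | a. a \<in> carrier R} R M"
  unfolding submodule_iff
proof (intro conjI ballI)
  show "{a \<odot>\<^bsub>M\<^esub> x | a. a \<in> carrier R} \<subseteq> carrier M" using assms by (auto simp: smult_closed)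
  show "\<zero>\<^bsub>M\<^esub> \<in> {a \<odot>\<^bsub>M\<^esub> x | a. a \<in> carrier R}"
    using assms by (auto intro!: exI[of _ "\<zero>\<^bsub>R\<^esub>"])
next
  fix y z assume "y \<in> {a \<odot>\<^bsub>M\<^esub> x | a. a \<in> carrier R}" "z \<in> {a \<odot>\<^bsub>M\<^esub> x | a. a \<in> carrier R}"
  then obtain a b where "a \<in> carrier R" "b \<in> carrier R" "y = a \<odot>\<^bsub>M\<^esub> x" "z = b \<odot>\<^bsub>M\<^esub> x" by auto
  then show "y \<oplus>\<^bsub>M\<^esub> z \<in> {a \<odot>\<^bsub>M\<^esub> x | a. a \<in> carrier R}"
    using assms by (auto intro!: exI[of _ "a \<oplus>\<^bsub>R\<^esub> b"] simp: smult_l_distr)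
next
  fix b y assume "b \<in> carrier R" "y \<in> {a \<odot>\<^bsub>M\<^esub> x | a. a \<in> carrier R}"
  then obtain a where "a \<in> carrier R" "b \<in> carrier R" "y = a \<odot>\<^bsub>M\<^esub> x" by auto
  then show "b \<odot>\<^bsub>M\<^esub> y \<in> {a \<odot>\<^bsub>M\<^esub> x | a. a \<in> carrier R}"
    using assms by (auto intro!: exI[of _ "b \<otimes>\<^bsub>R\<^esub> a"] simp: smult_assoc1)
qed

lemma submodule_sum:
  assumes "submodule U R M" "submodule V R M"
  shows "submodule {u \<oplus>\<^bsub>M\<^esub> v | u v. u \<in> U \<and> v \<in> V} R M"
proof -
  note U = submoduleD[OF assms(1)] and V = submoduleD[OF assms(2)]
  show ?thesis
    unfolding submodule_iff
  proof (intro conjI ballI)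
    show "{u \<oplus>\<^bsub>M\<^esub> v | u v. u \<in> U \<and> v \<in> V} \<subseteq> carrier M" using U(1) V(1) by auto
    show "\<zero>\<^bsub>M\<^esub> \<in> {u \<oplus>\<^bsub>M\<^esub> v | u v. u \<in> U \<and> v \<in> V}"
      using U(2) V(2) by (auto intro!: exI[of _ "\<zero>\<^bsub>M\<^esub>"])
  next
    fix y z assume "y \<in> {u \<oplus>\<^bsub>M\<^esub> v | u v. u \<in> U \<and> v \<in> V}" "z \<in> {u \<oplus>\<^bsub>M\<^esub> v | u v. u \<in> U \<and> v \<in> V}"
    then obtain u v u' v' where "u \<in> U" "v \<in> V" "y = u \<oplus>\<^bsub>M\<^esub> v" "u' \<in> U" "v' \<in> V" "z = u' \<oplus>\<^bsub>M\<^esub> v'"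
      by auto
    moreover from this have "y \<oplus>\<^bsub>M\<^esub> z = (u \<oplus>\<^bsub>M\<^esub> u') \<oplus>\<^bsub>M\<^esub> (v \<oplus>\<^bsub>M\<^esub> v')"
      using U(1) V(1) by (simp add: subset_iff M.add.m_ac)
    ultimately show "y \<oplus>\<^bsub>M\<^esub> z \<in> {u \<oplus>\<^bsub>M\<^esub> v | u v. u \<in> U \<and> v \<in> V}"
      using U(3) V(3) by blast
  next
    fix a y assume "a \<in> carrier R" "y \<in> {u \<oplus>\<^bsub>M\<^esub> v | u v. u \<in> U \<and> v \<in> V}"
    then obtain u v where "a \<in> carrier R" "u \<in> U" "v \<in> V" "y = u \<oplus>\<^bsub>M\<^esub> v" by auto
    moreover from this have "a \<odot>\<^bsub>M\<^esub> y = a \<odot>\<^bsub>M\<^esub> u \<oplus>\<^bsub>M\<^esub> a \<odot>\<^bsub>M\<^esub> v"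
      using U(1) V(1) by (auto simp: subset_iff smult_r_distr)
    ultimately show "a \<odot>\<^bsub>M\<^esub> y \<in> {u \<oplus>\<^bsub>M\<^esub> v | u v. u \<in> U \<and> v \<in> V}"
      using U(4) V(4) by blast
  qed
qed

end

lemma submodule_trans:
  assumes "left_module R M" "submodule U R M" "submodule V R (M\<lparr>carrier := U\<rparr>)"
  shows "submodule V R M"
  using assms left_module.submodule_left_module[OF assms(1,2)]
  by (auto simp: left_module.submodule_iff)

lemma lmod_hom_closed: "\<lbrakk>h \<in> lmod_hom R M N; x \<in> carrier M\<rbrakk> \<Longrightarrow> h x \<in> carrier N"
  by (auto simp: lmod_hom_def)

lemma lmod_hom_add: "\<lbrakk>h \<in> lmod_hom R M N; x \<in> carrier M; y \<in> carrier M\<rbrakk>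
    \<Longrightarrow> h (x \<oplus>\<^bsub>M\<^esub> y) = h x \<oplus>\<^bsub>N\<^esub> h y"
  by (auto simp: lmod_hom_def)

lemma lmod_hom_smult: "\<lbrakk>h \<in> lmod_hom R M N; a \<in> carrier R; x \<in> carrier M\<rbrakk>
    \<Longrightarrow> h (a \<odot>\<^bsub>M\<^esub> x) = a \<odot>\<^bsub>N\<^esub> h x"
  by (auto simp: lmod_hom_def)

lemma lmod_hom_zero:
  assumes "left_module R M" "left_module R N" "h \<in> lmod_hom R M N"
  shows "h \<zero>\<^bsub>M\<^esub> = \<zero>\<^bsub>N\<^esub>"
proof -
  interpret M: left_module R M by fact
  interpret N: left_module R N by fact
  show ?thesis
    using lmod_hom_smult[OF assms(3) M.R.zero_closed M.M.zero_closed]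
      lmod_hom_closed[OF assms(3) M.M.zero_closed] by simp
qed

lemma lmod_hom_minus:
  assumes "left_module R M" "left_module R N" "h \<in> lmod_hom R M N" "x \<in> carrier M"
  shows "h (\<ominus>\<^bsub>M\<^esub> x) = \<ominus>\<^bsub>N\<^esub> h x"
proof -
  interpret M: left_module R M by fact
  interpret N: left_module R N by fact
  show ?thesis
    using lmod_hom_smult[OF assms(3) _ assms(4), of "\<ominus>\<^bsub>R\<^esub> \<one>\<^bsub>R\<^esub>"]
      lmod_hom_closed[OF assms(3,4)] assms(4)
    by (simp add: M.minus_one_smult N.minus_one_smult)
qed

lemma lmod_hom_comp:
  "\<lbrakk>f \<in> lmod_hom R M N; g \<in> lmod_hom R N Q\<rbrakk> \<Longrightarrow> g \<circ> f \<in> lmod_hom R M Q"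
  by (auto simp: lmod_hom_def Pi_iff)

lemma lmod_hom_id: "id \<in> lmod_hom R M M"
  by (auto simp: lmod_hom_def)

lemma lmod_hom_inj_iff:
  assumes "left_module R M" "left_module R N" "h \<in> lmod_hom R M N"
  shows "inj_on h (carrier M) \<longleftrightarrow> (\<forall>x\<in>carrier M. h x = \<zero>\<^bsub>N\<^esub> \<longrightarrow> x = \<zero>\<^bsub>M\<^esub>)"
proof -
  interpret M: left_module R M by fact
  interpret N: left_module R N by fact
  show ?thesis
  proof
    assume "inj_on h (carrier M)"
    then show "\<forall>x\<in>carrier M. h x = \<zero>\<^bsub>N\<^esub> \<longrightarrow> x = \<zero>\<^bsub>M\<^esub>"
      using lmod_hom_zero[OF assms] by (metis M.M.zero_closed inj_onD)
  next
    assume *: "\<forall>x\<in>carrier M. h x = \<zero>\<^bsub>N\<^esub> \<longrightarrow> x = \<zero>\<^bsub>M\<^esub>"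
    show "inj_on h (carrier M)"
    proof (rule inj_onI)
      fix x y assume xy: "x \<in> carrier M" "y \<in> carrier M" "h x = h y"
      then have "h (x \<oplus>\<^bsub>M\<^esub> \<ominus>\<^bsub>M\<^esub> y) = \<zero>\<^bsub>N\<^esub>"
        using assms lmod_hom_closed[OF assms(3)]
        by (simp add: lmod_hom_add lmod_hom_minus N.M.r_neg)
      then have "x \<oplus>\<^bsub>M\<^esub> \<ominus>\<^bsub>M\<^esub> y = \<zero>\<^bsub>M\<^esub>" using * xy by simp
      then show "x = y" using xy by (metis M.M.minus_equality M.M.minus_minus M.M.a_inv_closed)
    qed
  qed
qed

lemma lmod_hom_inv_into:
  assumes "left_module R M" "h \<in> lmod_hom R M N" "bij_betw h (carrier M) (carrier N)"
  shows "inv_into (carrier M) h \<in> lmod_hom R N M"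
proof -
  interpret M: left_module R M by fact
  let ?g = "inv_into (carrier M) h"
  have g: "?g y \<in> carrier M" "h (?g y) = y" if "y \<in> carrier N" for y
    using that assms(3) by (auto simp: bij_betw_def f_inv_into_f inv_into_into)
  have gh: "?g (h x) = x" if "x \<in> carrier M" for x
    using that assms(3) by (simp add: bij_betw_def)
  show ?thesis
    unfolding lmod_hom_def
  proof (intro CollectI conjI ballI)
    show "?g \<in> carrier N \<rightarrow> carrier M" using g by auto
    show "?g (x \<oplus>\<^bsub>N\<^esub> y) = ?g x \<oplus>\<^bsub>M\<^esub> ?g y" if "x \<in> carrier N" "y \<in> carrier N" for x y
      using gh[of "?g x \<oplus>\<^bsub>M\<^esub> ?g y"] that g by (simp add: lmod_hom_add[OF assms(2)])
    show "?g (a \<odot>\<^bsub>N\<^esub> y) = a \<odot>\<^bsub>M\<^esub> ?g y" if "a \<in> carrier R" "y \<in> carrier N" for a y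
      using gh[of "a \<odot>\<^bsub>M\<^esub> ?g y"] that g M.smult_closed by (simp add: lmod_hom_smult[OF assms(2)])
  qed
qed

lemma lmod_iso_sym:
  assumes "left_module R M" "lmod_iso R M N" shows "lmod_iso R N M"
  using assms lmod_hom_inv_into[OF assms(1)] bij_betw_inv_into unfolding lmod_iso_def by blast

lemma lmod_iso_trans:
  assumes "lmod_iso R M N" "lmod_iso R N Q" shows "lmod_iso R M Q"
  using assms lmod_hom_comp bij_betw_trans unfolding lmod_iso_def by blast

lemma lmod_ker_submodule:
  assumes "left_module R M" "left_module R N" "h \<in> lmod_hom R M N"
  shows "submodule (carrier (lmod_ker M N h)) R M"
proof -
  interpret M: left_module R M by fact
  interpret N: left_module R N by fact
  show ?thesis
    using assms by (auto simp: M.submodule_iff lmod_ker_def lmod_hom_add lmod_hom_smult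
        lmod_hom_zero M.smult_closed)
qed

lemma lmod_ker_left_module:
  assumes "left_module R M" "left_module R N" "h \<in> lmod_hom R M N"
  shows "left_module R (lmod_ker M N h)"
  using left_module.submodule_left_module[OF assms(1) lmod_ker_submodule[OF assms]]
  by (simp add: lmod_ker_def)

lemma lmod_vimage_submodule:
  assumes "left_module R M" "left_module R N" "h \<in> lmod_hom R M N" "submodule U R N"
  shows "submodule {x \<in> carrier M. h x \<in> U} R M"
proof -
  interpret M: left_module R M by fact
  interpret N: left_module R N by fact
  show ?thesis
    using N.submoduleD[OF assms(4)] assms(1-3)
    by (auto simp: M.submodule_iff lmod_hom_add lmod_hom_smult lmod_hom_zero M.smult_closed)
qed

text \<open>Generation says that no proper submodule contains the generators, so the argument runs
  backwards: the preimage of a submodule containing the images of the generators contains the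
  generators, hence is everything.\<close>

lemma fin_gen_epi:
  assumes "left_module R M" "left_module R N" "h \<in> lmod_epi R M N" "fin_gen R M"
  shows "fin_gen R N"
proof -
  have h: "h \<in> lmod_hom R M N" "h ` carrier M = carrier N" using assms(3) by (auto simp: lmod_epi_def)
  obtain S where S: "finite S" "S \<subseteq> carrier M" "\<And>U. submodule U R M \<Longrightarrow> S \<subseteq> U \<Longrightarrow> U = carrier M"
    using assms(4) by (auto simp: fin_gen_def)
  have "U = carrier N" if U: "submodule U R N" "h ` S \<subseteq> U" for U
  proof -
    have "{x \<in> carrier M. h x \<in> U} = carrier M"
      using S(2) U by (intro S(3) lmod_vimage_submodule[OF assms(1,2) h(1)]) auto
    then have "h x \<in> U" if "x \<in> carrier M" for x using that by blast
    then show ?thesis using left_module.submoduleD(1)[OF assms(2) U(1)] unfolding h(2)[symmetric] by blast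
  qed
  then show ?thesis unfolding fin_gen_def using S(1,2) h(2) by (intro exI[of _ "h ` S"]) auto
qed

lemma lmod_iso_imp_epi:
  "\<lbrakk>h \<in> lmod_hom R M N; bij_betw h (carrier M) (carrier N)\<rbrakk> \<Longrightarrow> h \<in> lmod_epi R M N"
  by (auto simp: lmod_epi_def bij_betw_def)

lemma fin_gen_iso:
  assumes "left_module R M" "left_module R N" "lmod_iso R M N" "fin_gen R M"
  shows "fin_gen R N"
  using assms fin_gen_epi lmod_iso_imp_epi unfolding lmod_iso_def by blast

subsection \<open>Direct sums\<close>

lemma lmod_sum_simps [simp]:
  "carrier (lmod_sum A B) = carrier A \<times> carrier B"
  "\<zero>\<^bsub>lmod_sum A B\<^esub> = (\<zero>\<^bsub>A\<^esub>, \<zero>\<^bsub>B\<^esub>)"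
  "(a, b) \<oplus>\<^bsub>lmod_sum A B\<^esub> (a', b') = (a \<oplus>\<^bsub>A\<^esub> a', b \<oplus>\<^bsub>B\<^esub> b')"
  "r \<odot>\<^bsub>lmod_sum A B\<^esub> (a, b) = (r \<odot>\<^bsub>A\<^esub> a, r \<odot>\<^bsub>B\<^esub> b)"
  by (simp_all add: lmod_sum_def)

lemma lmod_sum_left_module:
  assumes "left_module R A" "left_module R B" shows "left_module R (lmod_sum A B)"
proof -
  interpret A: left_module R A by fact
  interpret B: left_module R B by fact
  show ?thesis
    by (intro left_moduleI A.R.ring_axioms)
       (auto simp: A.M.add.m_ac B.M.add.m_ac A.smult_closed B.smult_closed
         A.smult_l_distr B.smult_l_distr A.smult_r_distr B.smult_r_distr A.smult_assoc1
         B.smult_assoc1 A.smult_one B.smult_one)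
qed

lemma lmod_sum_hom:
  assumes "f \<in> lmod_hom R A A'" "g \<in> lmod_hom R B B'"
  shows "map_prod f g \<in> lmod_hom R (lmod_sum A B) (lmod_sum A' B')"
  using assms by (auto simp: lmod_hom_def Pi_iff)

lemma lmod_fst_epi: "left_module R B \<Longrightarrow> fst \<in> lmod_epi R (lmod_sum A B) A"
  using left_module.submodule_carrier[of R B] left_module.submoduleD(2)[of R B]
  by (force simp: lmod_epi_def lmod_hom_def)

lemma lmod_snd_epi: "left_module R A \<Longrightarrow> snd \<in> lmod_epi R (lmod_sum A B) B"
  using left_module.submodule_carrier[of R A] left_module.submoduleD(2)[of R A]
  by (force simp: lmod_epi_def lmod_hom_def)

lemma lmod_inl_hom: "left_module R A \<Longrightarrow> left_module R B \<Longrightarrow> (\<lambda>a. (a, \<zero>\<^bsub>B\<^esub>)) \<in> lmod_hom R A (lmod_sum A B)"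
proof -
  assume "left_module R A" "left_module R B"
  then interpret A: left_module R A + B: left_module R B by auto
  show ?thesis by (auto simp: lmod_hom_def)
qed

lemma lmod_inr_hom: "left_module R A \<Longrightarrow> left_module R B \<Longrightarrow> (\<lambda>b. (\<zero>\<^bsub>A\<^esub>, b)) \<in> lmod_hom R B (lmod_sum A B)"
proof -
  assume "left_module R A" "left_module R B"
  then interpret A: left_module R A + B: left_module R B by auto
  show ?thesis by (auto simp: lmod_hom_def)
qed

lemma lmod_sum_decomp:
  assumes "left_module R A" "left_module R B" "a \<in> carrier A" "b \<in> carrier B"
  shows "(a, b) = (a, \<zero>\<^bsub>B\<^esub>) \<oplus>\<^bsub>lmod_sum A B\<^esub> (\<zero>\<^bsub>A\<^esub>, b)"
proof -
  interpret A: left_module R A by fact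
  interpret B: left_module R B by fact
  show ?thesis using assms by simp
qed

lemma fin_gen_sum:
  assumes "left_module R A" "left_module R B" "fin_gen R A" "fin_gen R B"
  shows "fin_gen R (lmod_sum A B)"
proof -
  interpret A: left_module R A by fact
  interpret B: left_module R B by fact
  interpret AB: left_module R "lmod_sum A B" using assms by (intro lmod_sum_left_module)
  let ?l = "\<lambda>a. (a, \<zero>\<^bsub>B\<^esub>)" and ?r = "\<lambda>b. (\<zero>\<^bsub>A\<^esub>, b)"
  obtain S where S: "finite S" "S \<subseteq> carrier A" "\<And>U. submodule U R A \<Longrightarrow> S \<subseteq> U \<Longrightarrow> U = carrier A"
    using assms(3) by (auto simp: fin_gen_def)
  obtain T where T: "finite T" "T \<subseteq> carrier B" "\<And>U. submodule U R B \<Longrightarrow> T \<subseteq> U \<Longrightarrow> U = carrier B"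
    using assms(4) by (auto simp: fin_gen_def)
  have "U = carrier (lmod_sum A B)" if U: "submodule U R (lmod_sum A B)" "?l ` S \<union> ?r ` T \<subseteq> U" for U
  proof -
    have "{x \<in> carrier A. ?l x \<in> U} = carrier A"
      using U S by (intro S(3) lmod_vimage_submodule[OF assms(1) AB.left_module_axioms lmod_inl_hom]) (auto intro: assms)
    moreover have "{x \<in> carrier B. ?r x \<in> U} = carrier B"
      using U T by (intro T(3) lmod_vimage_submodule[OF assms(2) AB.left_module_axioms lmod_inr_hom]) (auto intro: assms)
    ultimately have "x \<in> U" if "x \<in> carrier (lmod_sum A B)" for x
      using that AB.submoduleD(3)[OF U(1)] lmod_sum_decomp[OF assms(1,2)] by (cases x) fastforce
    then show ?thesis using AB.submoduleD(1)[OF U(1)] by auto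
  qed
  then show ?thesis unfolding fin_gen_def using S(1,2) T(1,2)
    by (intro exI[of _ "?l ` S \<union> ?r ` T"]) auto
qed

subsection \<open>Transport of structure\<close>

text \<open>The map may identify elements: the operations go through arbitrary preimages and are
  well defined as soon as the fibres form a congruence. Injective maps give copies on another type,
  coset maps give quotients.\<close>

definition img_mod :: "('a, 'm) module \<Rightarrow> ('m \<Rightarrow> 'n) \<Rightarrow> ('a, 'n) module"
  where "img_mod M \<phi> = \<lparr>
    carrier = \<phi> ` carrier M,
    monoid.mult = undefined,
    one = undefined,
    ring.zero = \<phi> \<zero>\<^bsub>M\<^esub>,
    ring.add = (\<lambda>x y. \<phi> (inv_into (carrier M) \<phi> x \<oplus>\<^bsub>M\<^esub> inv_into (carrier M) \<phi> y)),
    module.smult = (\<lambda>r x. \<phi> (r \<odot>\<^bsub>M\<^esub> inv_into (carrier M) \<phi> x))\<rparr>"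

lemma img_mod:
  assumes M: "left_module R M"
    and add: "\<And>x x' y y'. \<lbrakk>x \<in> carrier M; x' \<in> carrier M; y \<in> carrier M; y' \<in> carrier M; \<phi> x = \<phi> x'; \<phi> y = \<phi> y'\<rbrakk>
       \<Longrightarrow> \<phi> (x \<oplus>\<^bsub>M\<^esub> y) = \<phi> (x' \<oplus>\<^bsub>M\<^esub> y')"
    and smult: "\<And>r x x'. \<lbrakk>r \<in> carrier R; x \<in> carrier M; x' \<in> carrier M; \<phi> x = \<phi> x'\<rbrakk>
       \<Longrightarrow> \<phi> (r \<odot>\<^bsub>M\<^esub> x) = \<phi> (r \<odot>\<^bsub>M\<^esub> x')"
  shows "left_module R (img_mod M \<phi>)" "\<phi> \<in> lmod_epi R M (img_mod M \<phi>)"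
proof -
  interpret M: left_module R M by fact
  let ?N = "img_mod M \<phi>"
  have inv: "inv_into (carrier M) \<phi> (\<phi> x) \<in> carrier M" "\<phi> (inv_into (carrier M) \<phi> (\<phi> x)) = \<phi> x"
    if "x \<in> carrier M" for x
    using that by (auto intro: inv_into_into f_inv_into_f)
  have add': "\<phi> x \<oplus>\<^bsub>?N\<^esub> \<phi> y = \<phi> (x \<oplus>\<^bsub>M\<^esub> y)" if "x \<in> carrier M" "y \<in> carrier M" for x y
    using add[OF inv(1)[OF that(1)] that(1) inv(1)[OF that(2)] that(2)] that inv by (simp add: img_mod_def)
  have smult': "r \<odot>\<^bsub>?N\<^esub> \<phi> x = \<phi> (r \<odot>\<^bsub>M\<^esub> x)" if "r \<in> carrier R" "x \<in> carrier M" for r x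
    using smult[OF that(1) inv(1)[OF that(2)] that(2)] that inv by (simp add: img_mod_def)
  have carr: "carrier ?N = \<phi> ` carrier M" and zero: "\<zero>\<^bsub>?N\<^esub> = \<phi> \<zero>\<^bsub>M\<^esub>" by (simp_all add: img_mod_def)
  show "left_module R ?N"
    by (intro left_moduleI M.R.ring_axioms)
       (auto simp: carr zero add' smult' M.M.add.m_ac M.smult_closed
         M.smult_l_distr M.smult_r_distr M.smult_assoc1 M.smult_one)
  show "\<phi> \<in> lmod_epi R M ?N"
    by (auto simp: lmod_epi_def lmod_hom_def carr add' smult')
qed

lemma img_mod_inj:
  assumes "left_module R M" "inj_on \<phi> (carrier M)"
  shows "left_module R (img_mod M \<phi>)" "\<phi> \<in> lmod_hom R M (img_mod M \<phi>)"
    "bij_betw \<phi> (carrier M) (carrier (img_mod M \<phi>))"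
proof -
  have *: "x = x'" if "\<phi> x = \<phi> x'" "x \<in> carrier M" "x' \<in> carrier M" for x x'
    using assms(2) that by (auto dest: inj_onD)
  have "left_module R (img_mod M \<phi>)" "\<phi> \<in> lmod_epi R M (img_mod M \<phi>)"
    by (rule img_mod[OF assms(1)]; blast dest: *)+
  then show "left_module R (img_mod M \<phi>)" "\<phi> \<in> lmod_hom R M (img_mod M \<phi>)"
    by (simp_all add: lmod_epi_def)
  show "bij_betw \<phi> (carrier M) (carrier (img_mod M \<phi>))"
    using assms(2) by (simp add: bij_betw_def img_mod_def)
qed

text \<open>Tagging the \<open>0\<close>-th entry encodes a pair of elements of the carrier type of \<open>'a lmod\<close> as one
  such element; the two tags have to be different, so the ring must not be zero.\<close>

definition pair_code :: "'a \<Rightarrow> 'a \<Rightarrow> (nat \<Rightarrow> 'a) set \<times> (nat \<Rightarrow> 'a) set \<Rightarrow> (nat \<Rightarrow> 'a) set"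
  where "pair_code u v = (\<lambda>(X, Y). case_nat u ` X \<union> case_nat v ` Y)"

lemma inj_pair_code:
  assumes "u \<noteq> v" shows "inj (pair_code u v)"
proof (rule injI)
  have 0: "case_nat a f \<noteq> case_nat b g" if "a \<noteq> b" for a b :: 'a and f g
    using that by (metis old.nat.simps(4))
  have 1: "f = g" if "case_nat a f = case_nat a g" for a :: 'a and f g
    using that by (metis ext old.nat.simps(5))
  have fst: "fst p = {f. case_nat u f \<in> pair_code u v p}" for p
    using 0[OF assms] by (cases p) (auto simp: pair_code_def dest: 1)
  have snd: "snd p = {f. case_nat v f \<in> pair_code u v p}" for p
    using 0[OF assms] by (cases p) (auto simp: pair_code_def dest: 1 sym)
  show "p = q" if "pair_code u v p = pair_code u v q" for p q
    using fst snd that by (metis prod.expand)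
qed

text \<open>\<open>lmod_sum\<close> lives on pairs, whereas the generators of \<open>K0\<close>,
  projectivity and covers refer to \<open>'a lmod\<close>. This is the copy of the sum inside that
  type.\<close>

definition dsum :: "('a, 'r) ring_scheme \<Rightarrow> 'a lmod \<Rightarrow> 'a lmod \<Rightarrow> 'a lmod"
  where "dsum R A B = img_mod (lmod_sum A B) (pair_code \<zero>\<^bsub>R\<^esub> \<one>\<^bsub>R\<^esub>)"

lemma dsum:
  assumes "left_module R A" "left_module R B" "\<zero>\<^bsub>R\<^esub> \<noteq> \<one>\<^bsub>R\<^esub>"
  shows "left_module R (dsum R A B)" "lmod_iso R (dsum R A B) (lmod_sum A B)"
proof -
  have *: "inj_on (pair_code \<zero>\<^bsub>R\<^esub> \<one>\<^bsub>R\<^esub>) (carrier (lmod_sum A B))"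
    using inj_pair_code[OF assms(3)] inj_on_subset by blast
  note i = img_mod_inj[OF lmod_sum_left_module[OF assms(1,2)] *]
  show "left_module R (dsum R A B)" using i(1) by (simp add: dsum_def)
  show "lmod_iso R (dsum R A B) (lmod_sum A B)"
    using i lmod_iso_sym[OF lmod_sum_left_module[OF assms(1,2)]] unfolding dsum_def lmod_iso_def by blast
qed

lemma dsum_fg:
  assumes "A \<in> fg_modules R" "B \<in> fg_modules R" "\<zero>\<^bsub>R\<^esub> \<noteq> \<one>\<^bsub>R\<^esub>"
  shows "dsum R A B \<in> fg_modules R"
  using assms dsum[of R A B] lmod_sum_left_module[of R A B] fin_gen_sum[of R A B]
    fin_gen_iso[of R "lmod_sum A B" "dsum R A B"] lmod_iso_sym[of R "dsum R A B" "lmod_sum A B"]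
  unfolding fg_modules_def by blast

subsection \<open>Projective modules\<close>

lemma projectiveD:
  fixes X Y :: "'a lmod"
  assumes "projective R P" "left_module R X" "left_module R Y" "g \<in> lmod_epi R X Y" "f \<in> lmod_hom R P Y"
  obtains f' where "f' \<in> lmod_hom R P X" "\<And>p. p \<in> carrier P \<Longrightarrow> g (f' p) = f p"
proof -
  have "\<exists>f' \<in> lmod_hom R P X. \<forall>p\<in>carrier P. g (f' p) = f p"
    using assms unfolding projective_def by blast
  then show ?thesis using that by blast
qed

lemma projective_left_module: "projective R P \<Longrightarrow> left_module R P"
  by (simp add: projective_def)

lemma projective_dsum:
  assumes "projective R A" "projective R B" "left_module R P" "lmod_iso R P (lmod_sum A B)"
  shows "projective R P"
  unfolding projective_def
proof (intro conjI allI impI assms(3), elim conjE)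
  have A: "left_module R A" and B: "left_module R B" using assms projective_left_module by auto
  then interpret A: left_module R A + B: left_module R B by auto
  note AB = lmod_sum_left_module[OF A B]
  fix X Y :: "'a lmod" and g f
  assume XY: "left_module R X" "left_module R Y" "g \<in> lmod_epi R X Y" "f \<in> lmod_hom R P Y"
  then interpret X: left_module R X + Y: left_module R Y by auto
  obtain h where h: "h \<in> lmod_hom R P (lmod_sum A B)" "bij_betw h (carrier P) (carrier (lmod_sum A B))"
    using assms(4) by (auto simp: lmod_iso_def)
  let ?k = "inv_into (carrier P) h"
  have k: "?k \<in> lmod_hom R (lmod_sum A B) P"
    by (rule lmod_hom_inv_into[OF assms(3) h])
  have fk: "f \<circ> ?k \<in> lmod_hom R (lmod_sum A B) Y" using lmod_hom_comp[OF k XY(4)] .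
  have g: "g \<in> lmod_hom R X Y" using XY(3) by (simp add: lmod_epi_def)
  obtain a where a: "a \<in> lmod_hom R A X" "\<And>p. p \<in> carrier A \<Longrightarrow> g (a p) = (f \<circ> ?k) (p, \<zero>\<^bsub>B\<^esub>)"
    using projectiveD[OF assms(1) XY(1-3) lmod_hom_comp[OF lmod_inl_hom[OF A B] fk]] by auto
  obtain b where b: "b \<in> lmod_hom R B X" "\<And>p. p \<in> carrier B \<Longrightarrow> g (b p) = (f \<circ> ?k) (\<zero>\<^bsub>A\<^esub>, p)"
    using projectiveD[OF assms(2) XY(1-3) lmod_hom_comp[OF lmod_inr_hom[OF A B] fk]] by auto
  define F where "F = (\<lambda>(x, y). a x \<oplus>\<^bsub>X\<^esub> b y)"
  have F: "F \<in> lmod_hom R (lmod_sum A B) X"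
    using lmod_hom_closed[OF a(1)] lmod_hom_closed[OF b(1)]
    by (auto simp: lmod_hom_def F_def lmod_hom_add[OF a(1)] lmod_hom_add[OF b(1)]
       lmod_hom_smult[OF a(1)] lmod_hom_smult[OF b(1)] X.smult_r_distr X.M.add.m_ac)
  have gF: "g (F z) = (f \<circ> ?k) z" if z: "z \<in> carrier (lmod_sum A B)" for z
  proof -
    obtain x y where xy: "z = (x, y)" "x \<in> carrier A" "y \<in> carrier B" using z by auto
    have "(f \<circ> ?k) z = (f \<circ> ?k) (x, \<zero>\<^bsub>B\<^esub>) \<oplus>\<^bsub>Y\<^esub> (f \<circ> ?k) (\<zero>\<^bsub>A\<^esub>, y)"
      using lmod_hom_add[OF fk, of "(x, \<zero>\<^bsub>B\<^esub>)" "(\<zero>\<^bsub>A\<^esub>, y)"] xy by simp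
    moreover have "g (F z) = g (a x) \<oplus>\<^bsub>Y\<^esub> g (b y)"
      using xy lmod_hom_closed[OF a(1)] lmod_hom_closed[OF b(1)]
      by (simp add: F_def lmod_hom_add[OF g])
    ultimately show ?thesis using a(2)[OF xy(2)] b(2)[OF xy(3)] by simp
  qed
  have "F \<circ> h \<in> lmod_hom R P X" using lmod_hom_comp[OF h(1) F] .
  moreover have "g ((F \<circ> h) p) = f p" if "p \<in> carrier P" for p
    using gF[OF lmod_hom_closed[OF h(1) that]] that h(2) by (simp add: bij_betw_inv_into_left)
  ultimately show "\<exists>f'\<in>lmod_hom R P X. \<forall>p\<in>carrier P. g (f' p) = f p" by blast
qed

lemma projective_zero:
  assumes "left_module R P" "carrier P = {\<zero>\<^bsub>P\<^esub>}"
  shows "projective R P"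
  unfolding projective_def
proof (intro conjI allI impI assms(1), elim conjE)
  fix X Y :: "'a lmod" and g f
  assume XY: "left_module R X" "left_module R Y" "g \<in> lmod_epi R X Y" "f \<in> lmod_hom R P Y"
  interpret P: left_module R P by fact
  interpret X: left_module R X by fact
  have "(\<lambda>_. \<zero>\<^bsub>X\<^esub>) \<in> lmod_hom R P X" by (auto simp: lmod_hom_def)
  moreover have "g \<zero>\<^bsub>X\<^esub> = f p" if "p \<in> carrier P" for p
    using that assms XY by (auto simp: lmod_hom_zero lmod_epi_def)
  ultimately show "\<exists>f'\<in>lmod_hom R P X. \<forall>p\<in>carrier P. g (f' p) = f p"
    by (intro bexI[of _ "\<lambda>_. \<zero>\<^bsub>X\<^esub>"]) auto
qed

text \<open>With lifts \<open>g\<close> and \<open>h\<close> between the two projectives,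
  \<open>(k, y)\<close> goes to \<open>(y - g w, w)\<close> where \<open>w = k + h y\<close>; the
  same formula with \<open>g\<close> and \<open>h\<close> exchanged undoes this. The lemma makes the
  class of a kernel in \<open>K0\<close> independent of the presentation.\<close>

lemma schanuel:
  fixes P P' M :: "'a lmod"
  assumes P: "projective R P" and P': "projective R P'" and M: "left_module R M"
    and p: "p \<in> lmod_epi R P M" and p': "p' \<in> lmod_epi R P' M"
  shows "lmod_iso R (lmod_sum (lmod_ker P M p) P') (lmod_sum (lmod_ker P' M p') P)"
proof -
  have P1: "left_module R P" "left_module R P'" using P P' projective_left_module by auto
  interpret P: left_module R P by fact
  interpret P': left_module R P' by fact
  interpret M: left_module R M by fact
  have p1: "p \<in> lmod_hom R P M" "p' \<in> lmod_hom R P' M" using p p' by (auto simp: lmod_epi_def)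
  obtain g where g: "g \<in> lmod_hom R P P'" "\<And>x. x \<in> carrier P \<Longrightarrow> p' (g x) = p x"
    by (rule projectiveD[OF P P1(2) M p' p1(1)]) blast
  obtain h where h: "h \<in> lmod_hom R P' P" "\<And>x. x \<in> carrier P' \<Longrightarrow> p (h x) = p' x"
    by (rule projectiveD[OF P' P1(1) M p p1(2)]) blast
  note [simp] = lmod_hom_closed[OF g(1)] lmod_hom_closed[OF h(1)] lmod_hom_closed[OF p1(1)]
    lmod_hom_closed[OF p1(2)] g(2) h(2)
  have [simp]: "carrier (lmod_ker P M p) = {x \<in> carrier P. p x = \<zero>\<^bsub>M\<^esub>}"
    "x \<oplus>\<^bsub>lmod_ker P M p\<^esub> y = x \<oplus>\<^bsub>P\<^esub> y" "a \<odot>\<^bsub>lmod_ker P M p\<^esub> x = a \<odot>\<^bsub>P\<^esub> x" for x y a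
    by (auto simp: lmod_ker_def)
  have [simp]: "carrier (lmod_ker P' M p') = {x \<in> carrier P'. p' x = \<zero>\<^bsub>M\<^esub>}"
    "x \<oplus>\<^bsub>lmod_ker P' M p'\<^esub> y = x \<oplus>\<^bsub>P'\<^esub> y" "a \<odot>\<^bsub>lmod_ker P' M p'\<^esub> x = a \<odot>\<^bsub>P'\<^esub> x" for x y a
    by (auto simp: lmod_ker_def)
  define F where "F = (\<lambda>(k, y). (y \<oplus>\<^bsub>P'\<^esub> \<ominus>\<^bsub>P'\<^esub> g (k \<oplus>\<^bsub>P\<^esub> h y), k \<oplus>\<^bsub>P\<^esub> h y))"
  define G where "G = (\<lambda>(k, x). (x \<oplus>\<^bsub>P\<^esub> \<ominus>\<^bsub>P\<^esub> h (k \<oplus>\<^bsub>P'\<^esub> g x), k \<oplus>\<^bsub>P'\<^esub> g x))"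
  let ?A = "lmod_sum (lmod_ker P M p) P'" and ?B = "lmod_sum (lmod_ker P' M p') P"
  \<comment> \<open>\<open>s\<close> is the second coordinate of \<open>F\<close> and
    \<open>t\<close> the correction in the first. Additivity of \<open>t\<close> is inherited from
    the composite of \<open>g\<close> and \<open>s\<close>, so linearity of \<open>F\<close> needs
    no computation with pairs.\<close>
  define s where "s = (\<lambda>(k, y). k \<oplus>\<^bsub>P\<^esub> h y)"
  have s: "s \<in> lmod_hom R ?A P"
    by (auto simp: lmod_hom_def s_def lmod_hom_add[OF h(1)] lmod_hom_smult[OF h(1)]
      P.smult_r_distr P.M.add.m_ac)
  define t where "t = (\<lambda>z. \<ominus>\<^bsub>P'\<^esub> g (s z))"
  have gs: "g \<circ> s \<in> lmod_hom R ?A P'" using lmod_hom_comp[OF s g(1)] .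
  have t: "t z \<in> carrier P'" "p' (t z) = \<ominus>\<^bsub>M\<^esub> p (s z)" if "z \<in> carrier ?A" for z
    using lmod_hom_closed[OF s that] by (simp_all add: t_def lmod_hom_minus[OF P1(2) M p1(2)])
  have t_add: "t (z \<oplus>\<^bsub>?A\<^esub> w) = t z \<oplus>\<^bsub>P'\<^esub> t w" if "z \<in> carrier ?A" "w \<in> carrier ?A" for z w
    using lmod_hom_add[OF gs that] lmod_hom_closed[OF gs] that by (simp add: t_def P'.M.minus_add)
  have t_smult: "t (a \<odot>\<^bsub>?A\<^esub> z) = a \<odot>\<^bsub>P'\<^esub> t z" if "a \<in> carrier R" "z \<in> carrier ?A" for a z
    using lmod_hom_smult[OF gs that] lmod_hom_closed[OF gs] that by (simp add: t_def P'.smult_minus)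
  have F_eq: "F z = (snd z \<oplus>\<^bsub>P'\<^esub> t z, s z)" for z
    by (cases z) (simp add: F_def t_def s_def)
  have F: "F \<in> lmod_hom R ?A ?B"
    unfolding lmod_hom_def
  proof (intro CollectI conjI ballI)
    show "F \<in> carrier ?A \<rightarrow> carrier ?B"
    proof
      fix z assume z: "z \<in> carrier ?A"
      obtain k y where ky: "z = (k, y)" "k \<in> carrier P" "p k = \<zero>\<^bsub>M\<^esub>" "y \<in> carrier P'" using z by auto
      have "p (s z) = p' y" using ky by (simp add: s_def lmod_hom_add[OF p1(1)])
      then show "F z \<in> carrier ?B"
        using t[OF z] lmod_hom_closed[OF s z] ky by (simp add: F_eq lmod_hom_add[OF p1(2)] M.M.r_neg)
    qed
  next
    fix z w assume zw: "z \<in> carrier ?A" "w \<in> carrier ?A"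
    then have "snd (z \<oplus>\<^bsub>?A\<^esub> w) = snd z \<oplus>\<^bsub>P'\<^esub> snd w" by (cases z; cases w) simp
    then show "F (z \<oplus>\<^bsub>?A\<^esub> w) = F z \<oplus>\<^bsub>?B\<^esub> F w"
      using zw t(1)[OF zw(1)] t(1)[OF zw(2)]
      by (simp add: F_eq t_add[OF zw] lmod_hom_add[OF s zw] P'.M.add.m_ac mem_Times_iff)
  next
    fix a z assume az: "a \<in> carrier R" "z \<in> carrier ?A"
    then have "snd (a \<odot>\<^bsub>?A\<^esub> z) = a \<odot>\<^bsub>P'\<^esub> snd z" by (cases z) simp
    then show "F (a \<odot>\<^bsub>?A\<^esub> z) = a \<odot>\<^bsub>?B\<^esub> F z"
      using az t(1)[OF az(2)]
      by (simp add: F_eq t_smult[OF az] lmod_hom_smult[OF s az] P'.smult_r_distr mem_Times_iff)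
  qed
  have "bij_betw F (carrier ?A) (carrier ?B)"
  proof (rule bij_betw_byWitness[where f' = G])
    show "F ` carrier ?A \<subseteq> carrier ?B" by (rule image_subsetI) (rule lmod_hom_closed[OF F])
    show "G ` carrier ?B \<subseteq> carrier ?A"
    proof (rule image_subsetI)
      fix z assume "z \<in> carrier ?B"
      then obtain k x where kx: "z = (k, x)" "k \<in> carrier P'" "p' k = \<zero>\<^bsub>M\<^esub>" "x \<in> carrier P" by auto
      define w where "w = k \<oplus>\<^bsub>P'\<^esub> g x"
      have w: "w \<in> carrier P'" "p' w = p x" using kx by (simp_all add: w_def lmod_hom_add[OF p1(2)])
      have "p (x \<oplus>\<^bsub>P\<^esub> \<ominus>\<^bsub>P\<^esub> h w) = \<zero>\<^bsub>M\<^esub>"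
        using kx w by (simp add: lmod_hom_add[OF p1(1)] lmod_hom_minus[OF P1(1) M p1(1)] M.M.r_neg)
      moreover have "x \<oplus>\<^bsub>P\<^esub> \<ominus>\<^bsub>P\<^esub> h w \<in> carrier P" using kx w by simp
      moreover have "G z = (x \<oplus>\<^bsub>P\<^esub> \<ominus>\<^bsub>P\<^esub> h w, w)" using kx by (simp add: G_def w_def)
      ultimately show "G z \<in> carrier ?A" using w by simp
    qed
    show "\<forall>a\<in>carrier ?A. G (F a) = a"
    proof
      fix z assume "z \<in> carrier ?A"
      then obtain k y where ky: "z = (k, y)" "k \<in> carrier P" "y \<in> carrier P'" by auto
      define w where "w = k \<oplus>\<^bsub>P\<^esub> h y"
      have w: "w \<in> carrier P" using ky by (simp add: w_def)
      have "(y \<oplus>\<^bsub>P'\<^esub> \<ominus>\<^bsub>P'\<^esub> g w) \<oplus>\<^bsub>P'\<^esub> g w = y" using ky w by (simp add: P'.M.a_assoc P'.M.l_neg)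
      moreover have "w \<oplus>\<^bsub>P\<^esub> \<ominus>\<^bsub>P\<^esub> h y = k" using ky by (simp add: w_def P.M.a_assoc P.M.r_neg)
      moreover have "F z = (y \<oplus>\<^bsub>P'\<^esub> \<ominus>\<^bsub>P'\<^esub> g w, w)" using ky by (simp add: F_def w_def)
      ultimately show "G (F z) = z" using ky by (simp add: G_def)
    qed
    show "\<forall>b\<in>carrier ?B. F (G b) = b"
    proof
      fix z assume "z \<in> carrier ?B"
      then obtain k x where kx: "z = (k, x)" "k \<in> carrier P'" "x \<in> carrier P" by auto
      define w where "w = k \<oplus>\<^bsub>P'\<^esub> g x"
      have w: "w \<in> carrier P'" using kx by (simp add: w_def)
      have "(x \<oplus>\<^bsub>P\<^esub> \<ominus>\<^bsub>P\<^esub> h w) \<oplus>\<^bsub>P\<^esub> h w = x" using kx w by (simp add: P.M.a_assoc P.M.l_neg)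
      moreover have "w \<oplus>\<^bsub>P'\<^esub> \<ominus>\<^bsub>P'\<^esub> g x = k" using kx by (simp add: w_def P'.M.a_assoc P'.M.r_neg)
      moreover have "G z = (x \<oplus>\<^bsub>P\<^esub> \<ominus>\<^bsub>P\<^esub> h w, w)" using kx by (simp add: G_def w_def)
      ultimately show "F (G z) = z" using kx by (simp add: F_def)
    qed
  qed
  with F show ?thesis by (auto simp: lmod_iso_def)
qed

text \<open>A coset is a set of elements of \<open>Q\<close>. Embedding these elements into
  functions on the naturals makes the coset an element of the carrier type of
  \<open>'a lmod\<close>, so the quotient lies in the required type although \<open>Q\<close> may
  live on another one.\<close>

lemma quotient_module_exists:
  fixes \<iota> :: "'m \<Rightarrow> nat \<Rightarrow> 'a" and Q :: "('a, 'm) module"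
  assumes Q: "left_module R Q" and J: "submodule J R Q" and \<iota>: "inj \<iota>"
  obtains M :: "'a lmod" and \<phi> where "left_module R M" "\<phi> \<in> lmod_epi R Q M"
    "\<And>x. x \<in> carrier Q \<Longrightarrow> \<phi> x = \<zero>\<^bsub>M\<^esub> \<longleftrightarrow> x \<in> J"
proof -
  interpret Q: left_module R Q by fact
  note J = Q.submoduleD[OF J]
  have Jc: "j \<in> carrier Q" if "j \<in> J" for j using that J(1) by blast
  define \<phi> where "\<phi> = (\<lambda>x. \<iota> ` {x \<oplus>\<^bsub>Q\<^esub> j | j. j \<in> J})"
  \<comment> \<open>One inclusion between cosets; the other is the same statement with
    \<open>-j\<close> in place of \<open>j\<close>.\<close>
  have sub: "{x \<oplus>\<^bsub>Q\<^esub> j | j. j \<in> J} \<subseteq> {y \<oplus>\<^bsub>Q\<^esub> j | j. j \<in> J}"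
    if xy: "x \<in> carrier Q" "y \<in> carrier Q" and j: "j \<in> J" "x = y \<oplus>\<^bsub>Q\<^esub> j" for x y j
  proof
    fix z assume "z \<in> {x \<oplus>\<^bsub>Q\<^esub> j | j. j \<in> J}"
    then obtain k where k: "k \<in> J" "z = x \<oplus>\<^bsub>Q\<^esub> k" by blast
    then have "z = y \<oplus>\<^bsub>Q\<^esub> (j \<oplus>\<^bsub>Q\<^esub> k)" using j xy Jc by (simp add: Q.M.a_assoc)
    then show "z \<in> {y \<oplus>\<^bsub>Q\<^esub> j | j. j \<in> J}" using J(3)[OF j(1) k(1)] by blast
  qed
  have eq: "\<phi> x = \<phi> y \<longleftrightarrow> (\<exists>j\<in>J. x = y \<oplus>\<^bsub>Q\<^esub> j)" if xy: "x \<in> carrier Q" "y \<in> carrier Q" for x y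
  proof
    assume "\<phi> x = \<phi> y"
    then have "{x \<oplus>\<^bsub>Q\<^esub> j | j. j \<in> J} = {y \<oplus>\<^bsub>Q\<^esub> j | j. j \<in> J}"
      using \<iota> by (simp add: \<phi>_def inj_image_eq_iff)
    moreover have "x \<oplus>\<^bsub>Q\<^esub> \<zero>\<^bsub>Q\<^esub> \<in> {x \<oplus>\<^bsub>Q\<^esub> j | j. j \<in> J}" using J(2) by blast
    ultimately show "\<exists>j\<in>J. x = y \<oplus>\<^bsub>Q\<^esub> j" using xy by auto
  next
    assume "\<exists>j\<in>J. x = y \<oplus>\<^bsub>Q\<^esub> j"
    then obtain j where j: "j \<in> J" "x = y \<oplus>\<^bsub>Q\<^esub> j" by blast
    have yx: "y = x \<oplus>\<^bsub>Q\<^esub> \<ominus>\<^bsub>Q\<^esub> j" using xy j Jc by (simp add: Q.M.a_assoc Q.M.r_neg)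
    have "{x \<oplus>\<^bsub>Q\<^esub> j | j. j \<in> J} = {y \<oplus>\<^bsub>Q\<^esub> j | j. j \<in> J}"
      using sub[OF xy j] sub[OF xy(2,1) J(5)[OF j(1)] yx] by (rule equalityI)
    then show "\<phi> x = \<phi> y" by (simp add: \<phi>_def)
  qed
  have cong_add: "\<phi> (x \<oplus>\<^bsub>Q\<^esub> y) = \<phi> (x' \<oplus>\<^bsub>Q\<^esub> y')"
    if *: "x \<in> carrier Q" "x' \<in> carrier Q" "y \<in> carrier Q" "y' \<in> carrier Q" "\<phi> x = \<phi> x'" "\<phi> y = \<phi> y'" for x x' y y'
  proof -
    obtain j k where "j \<in> J" "x = x' \<oplus>\<^bsub>Q\<^esub> j" "k \<in> J" "y = y' \<oplus>\<^bsub>Q\<^esub> k" using * eq by meson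
    then have "j \<oplus>\<^bsub>Q\<^esub> k \<in> J" "x \<oplus>\<^bsub>Q\<^esub> y = (x' \<oplus>\<^bsub>Q\<^esub> y') \<oplus>\<^bsub>Q\<^esub> (j \<oplus>\<^bsub>Q\<^esub> k)"
      using * Jc J(3) by (simp_all add: Q.M.add.m_ac)
    then show ?thesis unfolding eq[OF Q.M.add.m_closed[OF *(1,3)] Q.M.add.m_closed[OF *(2,4)]] by blast
  qed
  have cong_smult: "\<phi> (r \<odot>\<^bsub>Q\<^esub> x) = \<phi> (r \<odot>\<^bsub>Q\<^esub> x')"
    if *: "r \<in> carrier R" "x \<in> carrier Q" "x' \<in> carrier Q" "\<phi> x = \<phi> x'" for r x x'
  proof -
    obtain j where "j \<in> J" "x = x' \<oplus>\<^bsub>Q\<^esub> j" using * eq by meson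
    then have "r \<odot>\<^bsub>Q\<^esub> j \<in> J" "r \<odot>\<^bsub>Q\<^esub> x = r \<odot>\<^bsub>Q\<^esub> x' \<oplus>\<^bsub>Q\<^esub> r \<odot>\<^bsub>Q\<^esub> j"
      using * Jc J(4) by (simp_all add: Q.smult_r_distr)
    then show ?thesis unfolding eq[OF Q.smult_closed[OF *(1,2)] Q.smult_closed[OF *(1,3)]] by blast
  qed
  note img = img_mod[OF Q cong_add cong_smult]
  have "\<phi> x = \<zero>\<^bsub>img_mod Q \<phi>\<^esub> \<longleftrightarrow> x \<in> J" if "x \<in> carrier Q" for x
  proof -
    have "\<zero>\<^bsub>img_mod Q \<phi>\<^esub> = \<phi> \<zero>\<^bsub>Q\<^esub>" by (simp add: img_mod_def)
    then show ?thesis using eq[OF that Q.M.zero_closed] Jc by simp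
  qed
  then show ?thesis using that img by blast
qed

subsection \<open>The group \<open>K\<^sub>0\<close>\<close>

lemma K0_rel_subgroup: "subgroup (K0_rel R) (free_Abelian_group (fg_modules R))"
proof -
  interpret F: comm_group "free_Abelian_group (fg_modules R)" by (rule abelian_free_Abelian_group)
  show ?thesis
    unfolding K0_rel_def
    by (rule F.generate_is_subgroup) (auto dest!: subsetD[OF keys_diff] subsetD[OF keys_add])
qed

lemma K0_rel_normal: "K0_rel R \<lhd> free_Abelian_group (fg_modules R)"
  using comm_group.normal_iff_subgroup[OF abelian_free_Abelian_group] K0_rel_subgroup by blast

lemma comm_group_K0: "comm_group (K0 R)"
  unfolding K0_def by (rule comm_group.abelian_FactGroup[OF abelian_free_Abelian_group K0_rel_subgroup])

lemma K0_proj_hom: "(\<lambda>x. K0_rel R #>\<^bsub>free_Abelian_group (fg_modules R)\<^esub> x)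
    \<in> hom (free_Abelian_group (fg_modules R)) (K0 R)"
  unfolding K0_def by (rule normal.r_coset_hom_Mod[OF K0_rel_normal])

lemma K0_class_closed: "M \<in> fg_modules R \<Longrightarrow> K0_class R M \<in> carrier (K0 R)"
  unfolding K0_class_def by (rule hom_in_carrier[OF K0_proj_hom]) simp

lemma K0_rel_coset:
  assumes "x \<in> K0_rel R"
  shows "K0_rel R #>\<^bsub>free_Abelian_group (fg_modules R)\<^esub> x = \<one>\<^bsub>K0 R\<^esub>"
proof -
  interpret F: comm_group "free_Abelian_group (fg_modules R)" by (rule abelian_free_Abelian_group)
  show ?thesis
    using F.coset_join2[OF subgroup.mem_carrier[OF K0_rel_subgroup assms] K0_rel_subgroup assms]
    by (simp add: K0_def FactGroup_def)
qed

lemma K0_class_sum: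
  assumes "A \<in> fg_modules R" "B \<in> fg_modules R" "C \<in> fg_modules R" "lmod_iso R C (lmod_sum A B)"
  shows "K0_class R C = K0_class R A \<otimes>\<^bsub>K0 R\<^esub> K0_class R B"
proof -
  interpret F: comm_group "free_Abelian_group (fg_modules R)" by (rule abelian_free_Abelian_group)
  interpret K: comm_group "K0 R" by (rule comm_group_K0)
  let ?p = "\<lambda>x. K0_rel R #>\<^bsub>free_Abelian_group (fg_modules R)\<^esub> x"
  have rel: "frag_of C - (frag_of A + frag_of B) \<in> K0_rel R"
    unfolding K0_rel_def by (rule generate.incl) (use assms in blast)
  have keys: "Poly_Mapping.keys (frag_of A + frag_of B) \<subseteq> fg_modules R"
    using assms by (auto dest!: subsetD[OF keys_add])
  have "?p ((frag_of C - (frag_of A + frag_of B)) + (frag_of A + frag_of B))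
      = ?p (frag_of A + frag_of B)"
    using hom_mult[OF K0_proj_hom, of "frag_of C - (frag_of A + frag_of B)" R "frag_of A + frag_of B"]
      keys subgroup.mem_carrier[OF K0_rel_subgroup rel] hom_in_carrier[OF K0_proj_hom, of "frag_of A + frag_of B" R]
    by (simp add: K0_rel_coset[OF rel])
  moreover have "?p (frag_of A + frag_of B) = ?p (frag_of A) \<otimes>\<^bsub>K0 R\<^esub> ?p (frag_of B)"
    using hom_mult[OF K0_proj_hom, of "frag_of A" R "frag_of B"] assms by simp
  ultimately show ?thesis by (simp add: K0_class_def)
qed

lemma K0_class_projective:
  assumes "P \<in> fg_modules R" "projective R P" shows "K0_class R P = \<one>\<^bsub>K0 R\<^esub>"
  unfolding K0_class_def by (rule K0_rel_coset) (use assms in \<open>auto simp: K0_rel_def intro!: generate.incl\<close>)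

lemma zero_submodule_fg:
  assumes "left_module R M" "N = M\<lparr>carrier := {\<zero>\<^bsub>M\<^esub>}\<rparr>"
  shows "left_module R N" "fin_gen R N" "carrier N = {\<zero>\<^bsub>N\<^esub>}"
proof -
  interpret left_module R M by fact
  show N: "left_module R N" unfolding assms(2) by (rule submodule_left_module[OF submodule_zero])
  show c: "carrier N = {\<zero>\<^bsub>N\<^esub>}" by (simp add: assms(2))
  have "U = carrier N" if "submodule U R N" for U
    using left_module.submoduleD(1,2)[OF N that] c by auto
  then show "fin_gen R N" unfolding fin_gen_def by (intro exI[of _ "{}"]) auto
qed

lemma lmod_iso_sum_zero:
  assumes "left_module R M" "left_module R Z" "carrier Z = {\<zero>\<^bsub>Z\<^esub>}"
  shows "lmod_iso R (lmod_sum M Z) M"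
proof -
  have "fst \<in> lmod_hom R (lmod_sum M Z) M" using lmod_fst_epi[OF assms(2)] by (auto simp: lmod_epi_def)
  moreover have "bij_betw fst (carrier (lmod_sum M Z)) (carrier M)"
    by (rule bij_betw_byWitness[where f' = "\<lambda>m. (m, \<zero>\<^bsub>Z\<^esub>)"]) (auto simp: assms(3))
  ultimately show ?thesis by (auto simp: lmod_iso_def)
qed

text \<open>Isomorphism is not itself a defining relation. It is recovered from
  \<open>[M] = [N] + [Z]\<close>, where \<open>Z\<close> is the zero module and therefore
  projective.\<close>

lemma K0_class_iso:
  assumes M: "M \<in> fg_modules R" and N: "N \<in> fg_modules R" and iso: "lmod_iso R M N"
  shows "K0_class R M = K0_class R N"
proof -
  interpret K: comm_group "K0 R" by (rule comm_group_K0)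
  have N': "left_module R N" using N by (auto simp: fg_modules_def)
  define Z where "Z = N\<lparr>carrier := {\<zero>\<^bsub>N\<^esub>}\<rparr>"
  note Z = zero_submodule_fg[OF N' Z_def]
  have "lmod_iso R M (lmod_sum N Z)"
    using lmod_iso_trans[OF iso lmod_iso_sym[OF lmod_sum_left_module[OF N' Z(1)] lmod_iso_sum_zero[OF N' Z(1,3)]]] .
  moreover have "Z \<in> fg_modules R" using Z by (auto simp: fg_modules_def)
  moreover have "projective R Z" using projective_zero Z by blast
  ultimately show ?thesis
    using K0_class_sum[OF N _ M] K0_class_projective[of Z R] K0_class_closed[OF N] by simp
qed

lemma K0_hom_ext:
  assumes H: "group H" and f: "f \<in> hom (K0 R) H" and g: "g \<in> hom (K0 R) H"
    and eq: "\<And>M. M \<in> fg_modules R \<Longrightarrow> f (K0_class R M) = g (K0_class R M)"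
    and x: "x \<in> carrier (K0 R)"
  shows "f x = g x"
proof -
  let ?F = "free_Abelian_group (fg_modules R)"
  let ?p = "\<lambda>x. K0_rel R #>\<^bsub>?F\<^esub> x"
  interpret F: comm_group ?F by (rule abelian_free_Abelian_group)
  interpret K: comm_group "K0 R" by (rule comm_group_K0)
  interpret f: group_hom "K0 R" H f using H f K.group_axioms by (simp add: group_hom_def group_hom_axioms_def)
  interpret g: group_hom "K0 R" H g using H g K.group_axioms by (simp add: group_hom_def group_hom_axioms_def)
  interpret p: group_hom ?F "K0 R" ?p using K0_proj_hom K.group_axioms F.group_axioms
    by (simp add: group_hom_def group_hom_axioms_def)
  obtain z where z: "Poly_Mapping.keys z \<subseteq> fg_modules R" "x = ?p z"
    using x by (auto simp: K0_def FactGroup_def RCOSETS_def)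
  from z(1) have "f (?p z) = g (?p z)"
  proof (rule free_Abelian_group_induct, goal_cases)
    case 1
    show ?case using p.hom_one by simp
  next
    case (2 a b)
    have *: "?p (a - b) = ?p a \<otimes>\<^bsub>K0 R\<^esub> inv\<^bsub>K0 R\<^esub> ?p b"
      using p.hom_mult[of a "inv\<^bsub>?F\<^esub> b"] p.hom_inv[of b] 2(1,2) by simp
    have "?p a \<in> carrier (K0 R)" "?p b \<in> carrier (K0 R)"
      using 2(1,2) by (auto intro: p.hom_closed)
    with * 2(3,4) show ?case by simp
  next
    case (3 a)
    then show ?case using eq[OF 3] by (simp add: K0_class_def)
  qed
  then show ?thesis using z(2) by simp
qed

text \<open>Additive functions that vanish on projectives factor through \<open>K0\<close>. This
  serves twice: for the syzygy operator and for the multiplicity of an interval.\<close>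

lemma K0_universal:
  assumes H: "comm_group H" and f: "\<And>M. M \<in> fg_modules R \<Longrightarrow> f M \<in> carrier H"
    and sum: "\<And>A B C. \<lbrakk>A \<in> fg_modules R; B \<in> fg_modules R; C \<in> fg_modules R; lmod_iso R C (lmod_sum A B)\<rbrakk>
      \<Longrightarrow> f C = f A \<otimes>\<^bsub>H\<^esub> f B"
    and proj: "\<And>P. \<lbrakk>P \<in> fg_modules R; projective R P\<rbrakk> \<Longrightarrow> f P = \<one>\<^bsub>H\<^esub>"
  obtains g where "g \<in> hom (K0 R) H" "\<And>M. M \<in> fg_modules R \<Longrightarrow> g (K0_class R M) = f M"
proof -
  let ?F = "free_Abelian_group (fg_modules R)"
  interpret F: comm_group ?F by (rule abelian_free_Abelian_group)
  interpret H: comm_group H by fact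
  obtain h where h: "h \<in> hom ?F H" "\<And>x. x \<in> fg_modules R \<Longrightarrow> h (frag_of x) = f x"
    using H.free_Abelian_group_universal[of f "fg_modules R"] f by blast
  interpret h: group_hom ?F H h using h(1) H.group_axioms F.group_axioms
    by (simp add: group_hom_def group_hom_axioms_def)
  have "K0_rel R \<subseteq> kernel ?F H h"
    unfolding K0_rel_def
  proof (rule F.generate_subgroup_incl[OF _ h.subgroup_kernel], safe)
    fix A B C assume *: "A \<in> fg_modules R" "B \<in> fg_modules R" "C \<in> fg_modules R" "lmod_iso R C (lmod_sum A B)"
    have AB: "Poly_Mapping.keys (frag_of A + frag_of B) \<subseteq> fg_modules R"
      using * by (auto dest!: subsetD[OF keys_add])
    then have k: "Poly_Mapping.keys (frag_of C - (frag_of A + frag_of B)) \<subseteq> fg_modules R"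
      using * by (auto dest!: subsetD[OF keys_diff])
    have "h (frag_of A + frag_of B) = f A \<otimes>\<^bsub>H\<^esub> f B"
      using h.hom_mult[of "frag_of A" "frag_of B"] * h(2) by simp
    moreover define s where "s = frag_of A + frag_of B"
    ultimately have hs: "h s = f A \<otimes>\<^bsub>H\<^esub> f B" and sk: "Poly_Mapping.keys s \<subseteq> fg_modules R" using AB by simp_all
    have "h (frag_of C + - s) = f C \<otimes>\<^bsub>H\<^esub> inv\<^bsub>H\<^esub> (f A \<otimes>\<^bsub>H\<^esub> f B)"
      using h.hom_mult[of "frag_of C" "inv\<^bsub>?F\<^esub> s"] h.hom_inv[of s] hs sk * h(2) by simp
    then have "h (frag_of C - (frag_of A + frag_of B)) = f C \<otimes>\<^bsub>H\<^esub> inv\<^bsub>H\<^esub> (f A \<otimes>\<^bsub>H\<^esub> f B)"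
      by (simp only: s_def diff_conv_add_uminus)
    also have "\<dots> = \<one>\<^bsub>H\<^esub>" using sum[OF *] f * by simp
    finally show "frag_of C - (frag_of A + frag_of B) \<in> kernel ?F H h"
      using k by (simp add: kernel_def)
  next
    fix P assume "P \<in> fg_modules R" "projective R P"
    then show "frag_of P \<in> kernel ?F H h" using proj h(2) by (simp add: kernel_def)
  qed
  then obtain g where g: "g \<in> hom (?F Mod K0_rel R) H" "\<And>x. x \<in> carrier ?F \<Longrightarrow> g (K0_rel R #>\<^bsub>?F\<^esub> x) = h x"
    using h.FactGroup_universal_kernel[OF K0_rel_normal] by blast
  show ?thesis
  proof (rule that)
    show "g \<in> hom (K0 R) H" using g(1) by (simp add: K0_def)
    show "g (K0_class R M) = f M" if "M \<in> fg_modules R" for M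
      using g(2)[of "frag_of M"] h(2)[OF that] that by (simp add: K0_class_def)
  qed
qed

subsection \<open>Ranks\<close>

lemma hom_finprod_int_pow:
  assumes "comm_group G" "comm_group H" "h \<in> hom G H" "finite B" "B \<subseteq> carrier G"
  shows "h (\<Otimes>\<^bsub>G\<^esub>b\<in>B. b [^]\<^bsub>G\<^esub> (c b :: int)) = (\<Otimes>\<^bsub>H\<^esub>b\<in>B. h b [^]\<^bsub>H\<^esub> c b)"
  using assms(4,5)
proof (induction B)
  interpret G: comm_group G by fact
  interpret H: comm_group H by fact
  interpret h: group_hom G H h using assms by (simp add: group_hom_def group_hom_axioms_def G.group_axioms H.group_axioms)
  case (insert b B)
  then have "(\<lambda>b. b [^]\<^bsub>G\<^esub> c b) \<in> B \<rightarrow> carrier G" "b [^]\<^bsub>G\<^esub> c b \<in> carrier G"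
     "(\<lambda>b. h b [^]\<^bsub>H\<^esub> c b) \<in> B \<rightarrow> carrier H" "h b [^]\<^bsub>H\<^esub> c b \<in> carrier H"
    by auto
  with insert show ?case by (simp add: h.hom_int_pow)
next
  interpret G: comm_group G by fact
  interpret H: comm_group H by fact
  interpret h: group_hom G H h using assms by (simp add: group_hom_def group_hom_axioms_def G.group_axioms H.group_axioms)
  case empty
  then show ?case by simp
qed

text \<open>Only injectivity on the subgroup \<open>S\<close> is available. It suffices because
  every integral combination of elements of \<open>B\<close> stays in \<open>S\<close>, so
  \<open>h\<close> sends it to the neutral element only if it is neutral.\<close>

lemma int_independent_inj_hom_image:
  assumes G: "comm_group G" and h: "h \<in> hom G G" and S: "subgroup S G" "inj_on h S" and BS: "B \<subseteq> S"
  shows "int_independent G (h ` B) \<longleftrightarrow> int_independent G B"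
proof -
  interpret G: comm_group G by fact
  interpret h: group_hom G G h using h by (simp add: group_hom_def group_hom_axioms_def G.group_axioms)
  have inj: "inj_on h B" using S(2) BS inj_on_subset by blast
  have Bc: "B \<subseteq> carrier G" using BS subgroup.subset[OF S(1)] by blast
  have fin: "finite (h ` B) \<longleftrightarrow> finite B" using inj finite_image_iff by blast
  have prod: "(\<Otimes>\<^bsub>G\<^esub>b\<in>h ` B. b [^]\<^bsub>G\<^esub> c b) = \<one>\<^bsub>G\<^esub> \<longleftrightarrow> (\<Otimes>\<^bsub>G\<^esub>b\<in>B. b [^]\<^bsub>G\<^esub> c (h b)) = \<one>\<^bsub>G\<^esub>"
    if "finite B" for c :: "_ \<Rightarrow> int"
  proof -
    have "(\<Otimes>\<^bsub>G\<^esub>b\<in>h ` B. b [^]\<^bsub>G\<^esub> c b) = (\<Otimes>\<^bsub>G\<^esub>b\<in>B. h b [^]\<^bsub>G\<^esub> c (h b))"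
      using Bc inj by (subst G.finprod_reindex) auto
    also have "\<dots> = h (\<Otimes>\<^bsub>G\<^esub>b\<in>B. b [^]\<^bsub>G\<^esub> c (h b))"
      using hom_finprod_int_pow[OF G G h that Bc, of "\<lambda>b. c (h b)"] by simp
    finally have eq: "(\<Otimes>\<^bsub>G\<^esub>b\<in>h ` B. b [^]\<^bsub>G\<^esub> c b) = h (\<Otimes>\<^bsub>G\<^esub>b\<in>B. b [^]\<^bsub>G\<^esub> c (h b))" .
    have "(\<Otimes>\<^bsub>G\<^esub>b\<in>B. b [^]\<^bsub>G\<^esub> c (h b)) \<in> S"
      using that BS
    proof (induction B)
      case empty
      then show ?case using subgroup.one_closed[OF S(1)] by simp
    next
      case (insert b B)
      then have *: "b [^]\<^bsub>G\<^esub> c (h b) \<in> S" using G.subgroup_int_pow_closed[OF S(1)] by auto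
      moreover have "(\<lambda>b. b [^]\<^bsub>G\<^esub> c (h b)) \<in> B \<rightarrow> carrier G" "b [^]\<^bsub>G\<^esub> c (h b) \<in> carrier G"
        using insert subgroup.subset[OF S(1)] by auto
      ultimately show ?case using insert subgroup.m_closed[OF S(1)] by simp
    qed
    then show ?thesis
      unfolding eq using inj_onD[OF S(2), of _ "\<one>\<^bsub>G\<^esub>"] subgroup.one_closed[OF S(1)] h.hom_one by metis
  qed
  show ?thesis
  proof
    assume l: "int_independent G (h ` B)"
    then have fB: "finite B" using fin by (simp add: int_independent_def)
    show "int_independent G B"
      unfolding int_independent_def
    proof (intro conjI allI impI ballI fB Bc)
      fix c :: "_ \<Rightarrow> int" and b
      assume c: "(\<Otimes>\<^bsub>G\<^esub>b\<in>B. b [^]\<^bsub>G\<^esub> c b) = \<one>\<^bsub>G\<^esub>" and b: "b \<in> B"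
      \<comment> \<open>Coefficients on \<open>B\<close> become coefficients on the image by going
        back along the inverse of \<open>h\<close> on \<open>B\<close>.\<close>
      let ?c = "\<lambda>y. c (inv_into B h y)"
      have "(\<Otimes>\<^bsub>G\<^esub>b\<in>B. b [^]\<^bsub>G\<^esub> ?c (h b)) = (\<Otimes>\<^bsub>G\<^esub>b\<in>B. b [^]\<^bsub>G\<^esub> c b)"
        using Bc inj by (intro G.finprod_cong') auto
      then have "(\<Otimes>\<^bsub>G\<^esub>b\<in>h ` B. b [^]\<^bsub>G\<^esub> ?c b) = \<one>\<^bsub>G\<^esub>" using prod[OF fB, of ?c] c by simp
      then have "?c (h b) = 0" using l b by (auto simp: int_independent_def)
      then show "c b = 0" using inj b by simp
    qed
  next
    assume r: "int_independent G B"
    then have fB: "finite B" by (simp add: int_independent_def)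
    show "int_independent G (h ` B)"
      unfolding int_independent_def
    proof (intro conjI allI impI ballI)
      show "finite (h ` B)" using fB by simp
      show "h ` B \<subseteq> carrier G" using Bc h.hom_closed by auto
      fix c :: "_ \<Rightarrow> int" and y
      assume c: "(\<Otimes>\<^bsub>G\<^esub>b\<in>h ` B. b [^]\<^bsub>G\<^esub> c b) = \<one>\<^bsub>G\<^esub>" and y: "y \<in> h ` B"
      then have "\<forall>b\<in>B. c (h b) = 0"
        using r prod[OF fB] unfolding int_independent_def by meson
      then show "c y = 0" using y by auto
    qed
  qed
qed

text \<open>Independent subsets of \<open>H\<close> and of its image correspond under
  \<open>h\<close> with equal cardinality, so both suprema range over the same set. In this form
  injectivity of the syzygy operator keeps ranks from dropping.\<close>

lemma ab_rank_inj_hom_image: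
  assumes "comm_group G" "h \<in> hom G G" "subgroup S G" "inj_on h S" "H \<subseteq> S"
  shows "ab_rank G (h ` H) = ab_rank G H"
proof -
  have "{enat (card B) | B. B \<subseteq> h ` H \<and> int_independent G B}
      = {enat (card B) | B. B \<subseteq> H \<and> int_independent G B}" (is "?l = ?r")
  proof (intro equalityI subsetI)
    fix x assume "x \<in> ?l"
    then obtain B where B: "x = enat (card B)" "B \<subseteq> h ` H" "int_independent G B" by blast
    then obtain B' where B': "B' \<subseteq> H" "B = h ` B'" by (meson subset_imageE)
    have "inj_on h B'" "B' \<subseteq> S" using assms(4,5) B'(1) inj_on_subset by blast+
    then show "x \<in> ?r"
      using B B' int_independent_inj_hom_image[OF assms(1-4), of B'] by (auto simp: card_image)
  next
    fix x assume "x \<in> ?r"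
    then obtain B where B: "x = enat (card B)" "B \<subseteq> H" "int_independent G B" by blast
    have "inj_on h B" "B \<subseteq> S" using assms(4,5) B(2) inj_on_subset by blast+
    then have "x = enat (card (h ` B))" "h ` B \<subseteq> h ` H" "int_independent G (h ` B)"
      using B int_independent_inj_hom_image[OF assms(1-4), of B] by (auto simp: card_image)
    then show "x \<in> ?l" by blast
  qed
  then show ?thesis by (simp add: ab_rank_def)
qed

lemma ab_rank_one:
  assumes "comm_group G" shows "ab_rank G {\<one>\<^bsub>G\<^esub>} = 0"
proof -
  interpret G: comm_group G by fact
  have "card B = 0" if B: "B \<subseteq> {\<one>\<^bsub>G\<^esub>}" "int_independent G B" for B
  proof (cases "B = {}")
    case False
    \<comment> \<open>The neutral element with coefficient 1 is a nontrivial relation, so this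
      singleton is dependent.\<close>
    then have "B = {\<one>\<^bsub>G\<^esub>}" using B(1) by auto
    then show ?thesis using B(2) by (auto simp: int_independent_def dest: spec[of _ "\<lambda>_. 1"])
  qed auto
  then have "x \<le> 0" if "x \<in> {enat (card B) | B. B \<subseteq> {\<one>\<^bsub>G\<^esub>} \<and> int_independent G B}" for x
    using that unfolding zero_enat_def by fastforce
  then have "ab_rank G {\<one>\<^bsub>G\<^esub>} \<le> 0" unfolding ab_rank_def by (rule Sup_least)
  then show ?thesis by simp
qed

lemma ab_rank_pos:
  assumes "comm_group G" "x \<in> H" "x \<in> carrier G" "\<And>n::int. x [^]\<^bsub>G\<^esub> n = \<one>\<^bsub>G\<^esub> \<Longrightarrow> n = 0"
  shows "ab_rank G H > 0"
proof -
  interpret G: comm_group G by fact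
  have "int_independent G {x}"
    using assms(3,4) by (auto simp: int_independent_def)
  then have "enat 1 \<in> {enat (card B) | B. B \<subseteq> H \<and> int_independent G B}"
    using assms(2) by (auto intro!: exI[of _ "{x}"])
  then have "enat 1 \<le> ab_rank G H" unfolding ab_rank_def by (rule Sup_upper)
  then show ?thesis by (metis enat_0_iff(1) not_gr_zero le_zero_eq zero_neq_one)
qed

subsection \<open>Syzygies\<close>

text \<open>The coordinates \<open>h\<close> and the elementwise description of the kernel are
  exported next to the isomorphism of kernels: additivity of syzygies uses only the latter, but the
  construction of covers has to trace individual kernel elements back to the summands.\<close>

lemma presentation_sum:
  fixes A B C P Q :: "'a lmod"
  assumes lm: "left_module R A" "left_module R B" "left_module R C"
    and iso: "lmod_iso R C (lmod_sum A B)"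
    and P: "P \<in> fg_modules R" "projective R P" "p \<in> lmod_epi R P A"
    and Q: "Q \<in> fg_modules R" "projective R Q" "q \<in> lmod_epi R Q B"
    and zero_neq_one: "\<zero>\<^bsub>R\<^esub> \<noteq> \<one>\<^bsub>R\<^esub>"
  obtains D f h where "D \<in> fg_modules R" "projective R D" "f \<in> lmod_epi R D C"
    "h \<in> lmod_hom R D (lmod_sum P Q)" "bij_betw h (carrier D) (carrier (lmod_sum P Q))"
    "\<And>x. x \<in> carrier D \<Longrightarrow> f x = \<zero>\<^bsub>C\<^esub> \<longleftrightarrow> p (fst (h x)) = \<zero>\<^bsub>A\<^esub> \<and> q (snd (h x)) = \<zero>\<^bsub>B\<^esub>"
    "lmod_iso R (lmod_ker D C f) (lmod_sum (lmod_ker P A p) (lmod_ker Q B q))"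
proof -
  have lm': "left_module R P" "left_module R Q" using P Q by (auto simp: fg_modules_def)
  have lmS: "left_module R (lmod_sum P Q)" "left_module R (lmod_sum A B)"
    using lm lm' by (auto intro: lmod_sum_left_module)
  define D where "D = dsum R P Q"
  have D: "D \<in> fg_modules R" "lmod_iso R D (lmod_sum P Q)" "left_module R D"
    unfolding D_def by (rule dsum_fg[OF P(1) Q(1) zero_neq_one], rule dsum(2)[OF lm' zero_neq_one],
      rule dsum(1)[OF lm' zero_neq_one])
  have Dproj: "projective R D" by (rule projective_dsum[OF P(2) Q(2) D(3,2)])
  obtain h where h: "h \<in> lmod_hom R D (lmod_sum P Q)" "bij_betw h (carrier D) (carrier (lmod_sum P Q))"
    using D(2) by (auto simp: lmod_iso_def)
  obtain k where k: "k \<in> lmod_hom R (lmod_sum A B) C" "bij_betw k (carrier (lmod_sum A B)) (carrier C)"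
    using lmod_iso_sym[OF lm(3) iso] by (auto simp: lmod_iso_def)
  have pq1: "p \<in> lmod_hom R P A" "q \<in> lmod_hom R Q B" "p ` carrier P = carrier A" "q ` carrier Q = carrier B"
    using P(3) Q(3) by (auto simp: lmod_epi_def)
  have pq: "map_prod p q \<in> lmod_hom R (lmod_sum P Q) (lmod_sum A B)"
    by (rule lmod_sum_hom[OF pq1(1,2)])
  define f where "f = k \<circ> (map_prod p q \<circ> h)"
  have f: "f \<in> lmod_hom R D C" unfolding f_def by (intro lmod_hom_comp[OF _ k(1)] lmod_hom_comp[OF h(1) pq])
  have "f ` carrier D = k ` (map_prod p q ` (carrier P \<times> carrier Q))"
    using h(2) by (simp only: f_def bij_betw_def image_comp[symmetric] lmod_sum_simps)
  also have "\<dots> = carrier C" using pq1 k(2) by (simp add: map_prod_surj_on[OF pq1(3,4)] bij_betw_def)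
  finally have epi: "f \<in> lmod_epi R D C" using f by (simp add: lmod_epi_def)
  have f0: "f x = \<zero>\<^bsub>C\<^esub> \<longleftrightarrow> p (fst (h x)) = \<zero>\<^bsub>A\<^esub> \<and> q (snd (h x)) = \<zero>\<^bsub>B\<^esub>" if x: "x \<in> carrier D" for x
  proof -
    have hx: "map_prod p q (h x) \<in> carrier (lmod_sum A B)" using lmod_hom_closed[OF pq lmod_hom_closed[OF h(1) x]] .
    have "f x = \<zero>\<^bsub>C\<^esub> \<longleftrightarrow> map_prod p q (h x) = \<zero>\<^bsub>lmod_sum A B\<^esub>"
    proof -
      have "inj_on k (carrier (lmod_sum A B))" using k(2) by (simp add: bij_betw_def)
      then show ?thesis
        using hx lmod_hom_zero[OF lmS(2) lm(3) k(1)] lmod_hom_inj_iff[OF lmS(2) lm(3) k(1)]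
        by (auto simp: f_def simp del: lmod_sum_simps)
    qed
    then show ?thesis by (cases "h x") simp
  qed
  have isoK: "lmod_iso R (lmod_ker D C f) (lmod_sum (lmod_ker P A p) (lmod_ker Q B q))"
    unfolding lmod_iso_def
  proof (rule bexI[of _ h])
    have sum_ker: "x \<oplus>\<^bsub>lmod_sum (lmod_ker P A p) (lmod_ker Q B q)\<^esub> y = x \<oplus>\<^bsub>lmod_sum P Q\<^esub> y"
      "a \<odot>\<^bsub>lmod_sum (lmod_ker P A p) (lmod_ker Q B q)\<^esub> x = a \<odot>\<^bsub>lmod_sum P Q\<^esub> x" for x y a
      by (cases x; cases y; simp add: lmod_ker_def)+
    have hc: "h x \<in> carrier P \<times> carrier Q" if "x \<in> carrier D" for x
      using lmod_hom_closed[OF h(1) that] by simp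
    show "h \<in> lmod_hom R (lmod_ker D C f) (lmod_sum (lmod_ker P A p) (lmod_ker Q B q))"
      unfolding lmod_hom_def
    proof (intro CollectI conjI ballI)
      show "h \<in> carrier (lmod_ker D C f) \<rightarrow> carrier (lmod_sum (lmod_ker P A p) (lmod_ker Q B q))"
        using hc f0 by (auto simp: lmod_ker_def mem_Times_iff)
      show "h (x \<oplus>\<^bsub>lmod_ker D C f\<^esub> y) = h x \<oplus>\<^bsub>lmod_sum (lmod_ker P A p) (lmod_ker Q B q)\<^esub> h y"
        if "x \<in> carrier (lmod_ker D C f)" "y \<in> carrier (lmod_ker D C f)" for x y
        using that lmod_hom_add[OF h(1)] unfolding sum_ker by (simp add: lmod_ker_def)
      show "h (a \<odot>\<^bsub>lmod_ker D C f\<^esub> x) = a \<odot>\<^bsub>lmod_sum (lmod_ker P A p) (lmod_ker Q B q)\<^esub> h x"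
        if "a \<in> carrier R" "x \<in> carrier (lmod_ker D C f)" for a x
        using that lmod_hom_smult[OF h(1)] unfolding sum_ker by (simp add: lmod_ker_def)
    qed
    show "bij_betw h (carrier (lmod_ker D C f)) (carrier (lmod_sum (lmod_ker P A p) (lmod_ker Q B q)))"
      unfolding bij_betw_def
    proof
      show "inj_on h (carrier (lmod_ker D C f))"
        using h(2) by (auto simp: bij_betw_def lmod_ker_def intro: inj_on_subset)
      show "h ` carrier (lmod_ker D C f) = carrier (lmod_sum (lmod_ker P A p) (lmod_ker Q B q))"
      proof (intro equalityI subsetI)
        fix y assume "y \<in> h ` carrier (lmod_ker D C f)"
        then show "y \<in> carrier (lmod_sum (lmod_ker P A p) (lmod_ker Q B q))"
          using hc f0 by (auto simp: lmod_ker_def mem_Times_iff)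
      next
        fix y assume y: "y \<in> carrier (lmod_sum (lmod_ker P A p) (lmod_ker Q B q))"
        then have "y \<in> h ` carrier D" using h(2) by (auto simp: bij_betw_def lmod_ker_def)
        then obtain x where "x \<in> carrier D" "y = h x" by blast
        then show "y \<in> h ` carrier (lmod_ker D C f)" using y f0 by (auto simp: lmod_ker_def mem_Times_iff)
      qed
    qed
  qed
  show ?thesis by (rule that[OF D(1) Dproj epi h f0 isoK])
qed

text \<open>What the syzygy operator asks of a ring. Existence of covers gives the choice in
  \<open>syzygy\<close> a meaning, one finitely generated kernel per module propagates to all
  presentations by Schanuel, and \<open>0 \<noteq> 1\<close> provides the two tags of
  \<open>dsum\<close>.\<close>

locale ring_with_covers = ring R for R (structure) +
  assumes zero_neq_one: "\<zero> \<noteq> \<one>"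
    and covers: "M \<in> fg_modules R \<Longrightarrow> \<exists>P p. projective_cover R M P p \<and> fin_gen R (lmod_ker P M p)"
begin

text \<open>By Schanuel a single module \<open>C\<close> is isomorphic both to the sum of one kernel
  with \<open>P\<close> and to the sum of the other with \<open>P'\<close>. The projective classes
  vanish, so the kernels have equal classes; and the first kernel is finitely generated as a
  quotient of such a sum.\<close>

lemma presentation_ker:
  assumes M: "M \<in> fg_modules R" and P: "P \<in> fg_modules R" "projective R P" "p \<in> lmod_epi R P M"
    and P': "P' \<in> fg_modules R" "projective R P'" "p' \<in> lmod_epi R P' M"
    and K': "fin_gen R (lmod_ker P' M p')"
  shows "lmod_ker P M p \<in> fg_modules R"
    "K0_class R (lmod_ker P M p) = K0_class R (lmod_ker P' M p')"
proof -
  interpret K: comm_group "K0 R" by (rule comm_group_K0)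
  let ?K = "lmod_ker P M p" and ?K' = "lmod_ker P' M p'"
  have lm: "left_module R M" "left_module R P" "left_module R P'"
    using M P P' by (auto simp: fg_modules_def)
  have K: "left_module R ?K" "left_module R ?K'"
    using lm P(3) P'(3) by (auto intro!: lmod_ker_left_module simp: lmod_epi_def)
  have K'fg: "?K' \<in> fg_modules R" using K K' by (simp add: fg_modules_def)
  have iso: "lmod_iso R (lmod_sum ?K P') (lmod_sum ?K' P)"
    by (rule schanuel[OF P(2) P'(2) lm(1) P(3) P'(3)])
  define C where "C = dsum R ?K' P"
  have C: "C \<in> fg_modules R" "lmod_iso R C (lmod_sum ?K' P)"
    unfolding C_def by (rule dsum_fg[OF K'fg P(1) zero_neq_one], rule dsum(2)[OF K(2) lm(2) zero_neq_one])
  have C2: "lmod_iso R C (lmod_sum ?K P')"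
    using lmod_iso_trans[OF C(2) lmod_iso_sym[OF lmod_sum_left_module[OF K(1) lm(3)] iso]] .
  have "fin_gen R (lmod_sum ?K P')"
    using fin_gen_iso[OF _ lmod_sum_left_module[OF K(1) lm(3)] C2] C(1) by (simp add: fg_modules_def)
  then have "fin_gen R ?K"
    using fin_gen_epi[OF lmod_sum_left_module[OF K(1) lm(3)] K(1) lmod_fst_epi[OF lm(3)]] by blast
  then show Kfg: "?K \<in> fg_modules R" using K by (simp add: fg_modules_def)
  show "K0_class R ?K = K0_class R ?K'"
    using K0_class_sum[OF K'fg P(1) C] K0_class_sum[OF Kfg P'(1) C(1) C2]
      K0_class_projective[OF P(1,2)] K0_class_projective[OF P'(1,2)]
      K0_class_closed[OF Kfg] K0_class_closed[OF K'fg] by simp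
qed

lemma presentation_syzygy:
  assumes M: "M \<in> fg_modules R" and P: "P \<in> fg_modules R" "projective R P" "p \<in> lmod_epi R P M"
  shows "lmod_ker P M p \<in> fg_modules R"
    "K0_class R (lmod_ker P M p) = K0_class R (syzygy R M)"
proof -
  \<comment> \<open>\<open>Q\<close> is a common reference: its kernel is known to be finitely
    generated, while \<open>P\<close> and the cover chosen by \<open>syzygy\<close> are both
    compared with it.\<close>
  obtain Q q where Q: "projective_cover R M Q q" "fin_gen R (lmod_ker Q M q)" using covers[OF M] by blast
  then have Q': "Q \<in> fg_modules R" "projective R Q" "q \<in> lmod_epi R Q M" by (auto simp: projective_cover_def)
  have "\<exists>S s. projective_cover R M S s \<and> syzygy R M = lmod_ker S M s"
    unfolding syzygy_def by (rule someI_ex) (use Q in blast)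
  then obtain S s where S: "projective_cover R M S s" "syzygy R M = lmod_ker S M s" by blast
  then have S': "S \<in> fg_modules R" "projective R S" "s \<in> lmod_epi R S M" by (auto simp: projective_cover_def)
  show "lmod_ker P M p \<in> fg_modules R" using presentation_ker(1)[OF M P Q' Q(2)] .
  show "K0_class R (lmod_ker P M p) = K0_class R (syzygy R M)"
    using presentation_ker(2)[OF M P Q' Q(2)] presentation_ker(2)[OF M S' Q' Q(2)] S(2) by simp
qed

lemma syzygy_presentation:
  assumes M: "M \<in> fg_modules R"
  obtains P p where "P \<in> fg_modules R" "projective R P" "p \<in> lmod_epi R P M" "syzygy R M = lmod_ker P M p"
proof -
  have "\<exists>S s. projective_cover R M S s \<and> syzygy R M = lmod_ker S M s"
    unfolding syzygy_def by (rule someI_ex) (use covers[OF M] in blast)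
  then show ?thesis using that by (auto simp: projective_cover_def)
qed

lemma syzygy_fg: "M \<in> fg_modules R \<Longrightarrow> syzygy R M \<in> fg_modules R"
  using syzygy_presentation presentation_syzygy(1) by metis

lemma syzygy_sum:
  assumes A: "A \<in> fg_modules R" and B: "B \<in> fg_modules R" and C: "C \<in> fg_modules R"
    and iso: "lmod_iso R C (lmod_sum A B)"
  shows "K0_class R (syzygy R C) = K0_class R (syzygy R A) \<otimes>\<^bsub>K0 R\<^esub> K0_class R (syzygy R B)"
proof -
  have lm: "left_module R A" "left_module R B" "left_module R C" using A B C by (auto simp: fg_modules_def)
  obtain P p where P: "P \<in> fg_modules R" "projective R P" "p \<in> lmod_epi R P A" "syzygy R A = lmod_ker P A p"
    using syzygy_presentation[OF A] by blast
  obtain Q q where Q: "Q \<in> fg_modules R" "projective R Q" "q \<in> lmod_epi R Q B" "syzygy R B = lmod_ker Q B q"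
    using syzygy_presentation[OF B] by blast
  obtain D f h where D: "D \<in> fg_modules R" "projective R D" "f \<in> lmod_epi R D C"
    and isoK: "lmod_iso R (lmod_ker D C f) (lmod_sum (lmod_ker P A p) (lmod_ker Q B q))"
    using presentation_sum[OF lm iso P(1-3) Q(1-3) zero_neq_one] by metis
  have fg: "lmod_ker P A p \<in> fg_modules R" "lmod_ker Q B q \<in> fg_modules R" "lmod_ker D C f \<in> fg_modules R"
    using presentation_syzygy(1)[OF A P(1-3)] presentation_syzygy(1)[OF B Q(1-3)]
      presentation_syzygy(1)[OF C D] by auto
  show ?thesis
    using presentation_syzygy(2)[OF C D] K0_class_sum[OF fg isoK] P(4) Q(4) by simp
qed

lemma syzygy_projective:
  assumes P: "P \<in> fg_modules R" "projective R P"
  shows "K0_class R (syzygy R P) = \<one>\<^bsub>K0 R\<^esub>"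
proof -
  have lm: "left_module R P" using P by (simp add: fg_modules_def)
  have epi: "id \<in> lmod_epi R P P" using lmod_hom_id by (auto simp: lmod_epi_def)
  note K = presentation_syzygy[OF P(1) P epi]
  have "left_module R (lmod_ker P P id)" using K(1) by (simp add: fg_modules_def)
  moreover have "carrier (lmod_ker P P id) = {\<zero>\<^bsub>lmod_ker P P id\<^esub>}"
    using left_module.submoduleD(2)[OF lm left_module.submodule_carrier[OF lm]] by (auto simp: lmod_ker_def)
  ultimately have "projective R (lmod_ker P P id)" by (rule projective_zero)
  then show ?thesis using K K0_class_projective by metis
qed

lemma K0_L_ex1: "\<exists>!L. L \<in> hom (K0 R) (K0 R) \<and> L \<in> extensional (carrier (K0 R)) \<and>
    (\<forall>M \<in> fg_modules R. L (K0_class R M) = K0_class R (syzygy R M))"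
proof -
  interpret K: comm_group "K0 R" by (rule comm_group_K0)
  obtain g where g: "g \<in> hom (K0 R) (K0 R)" "\<And>M. M \<in> fg_modules R \<Longrightarrow> g (K0_class R M) = K0_class R (syzygy R M)"
    using K0_universal[OF comm_group_K0[of R], where R = R and f = "\<lambda>M. K0_class R (syzygy R M)",
        OF K0_class_closed[OF syzygy_fg] syzygy_sum syzygy_projective] by blast
  show ?thesis
  \<comment> \<open>Restriction to the carrier fixes the value elsewhere; without extensionality the
    description \<open>THE\<close> in \<open>K0_L\<close> could not be unique.\<close>
  proof (rule ex1I[of _ "restrict g (carrier (K0 R))"], intro conjI ballI)
    show "restrict g (carrier (K0 R)) \<in> hom (K0 R) (K0 R)" using g(1) by (auto simp: hom_def)
    show "restrict g (carrier (K0 R)) \<in> extensional (carrier (K0 R))" by simp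
    show "restrict g (carrier (K0 R)) (K0_class R M) = K0_class R (syzygy R M)" if "M \<in> fg_modules R" for M
      using g(2)[OF that] K0_class_closed[OF that] by simp
  next
    fix L assume L: "L \<in> hom (K0 R) (K0 R) \<and> L \<in> extensional (carrier (K0 R)) \<and>
      (\<forall>M \<in> fg_modules R. L (K0_class R M) = K0_class R (syzygy R M))"
    show "L = restrict g (carrier (K0 R))"
    proof (rule extensionalityI[of _ "carrier (K0 R)"])
      fix x assume "x \<in> carrier (K0 R)"
      then show "L x = restrict g (carrier (K0 R)) x"
        using K0_hom_ext[OF K.group_axioms _ g(1), of L x] L g(2) by simp
    qed (use L in auto)
  qed
qed

lemma K0_L_hom: "K0_L R \<in> hom (K0 R) (K0 R)"
  and K0_L_syzygy: "M \<in> fg_modules R \<Longrightarrow> K0_L R (K0_class R M) = K0_class R (syzygy R M)"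
  using theI'[OF K0_L_ex1] unfolding K0_L_def[symmetric] by auto

lemma K0_L_class:
  assumes "M \<in> fg_modules R" "P \<in> fg_modules R" "projective R P" "p \<in> lmod_epi R P M"
  shows "lmod_ker P M p \<in> fg_modules R" "K0_L R (K0_class R M) = K0_class R (lmod_ker P M p)"
  using presentation_syzygy[OF assms] K0_L_syzygy[OF assms(1)] by auto

lemma K0_L_pow_hom: "K0_L R ^^ n \<in> hom (K0 R) (K0 R)"
proof (induction n)
  case 0
  show ?case by (auto simp: hom_def)
next
  case (Suc n)
  show ?case unfolding funpow.simps by (rule hom_compose[OF Suc K0_L_hom])
qed

text \<open>From step \<open>t\<close> on, every image of \<open>add_span R M\<close> lies in the
  subgroup on which \<open>K0_L\<close> is injective, so each further application preserves the
  rank. The bound does not depend on \<open>M\<close> and hence bounds \<open>phi_dim\<close> as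
  well.\<close>

lemma phi_le:
  assumes inj: "inj_on (K0_L R) ((K0_L R ^^ t) ` carrier (K0 R))"
    and M: "M \<in> fg_modules R"
  shows "phi R M \<le> t"
proof -
  interpret K: comm_group "K0 R" by (rule comm_group_K0)
  let ?L = "K0_L R"
  have sub: "subgroup ((?L ^^ n) ` carrier (K0 R)) (K0 R)" for n
  proof -
    interpret h: group_hom "K0 R" "K0 R" "?L ^^ n"
      using K0_L_pow_hom by (simp add: group_hom_def group_hom_axioms_def K.group_axioms)
    show ?thesis by (rule h.img_is_subgroup)
  qed
  have S: "add_span R M \<subseteq> carrier (K0 R)"
    unfolding add_span_def by (rule K.generate_incl) (auto simp: K0_class_closed)
  have "ab_rank (K0 R) ((?L ^^ (t + j)) ` add_span R M) = ab_rank (K0 R) ((?L ^^ t) ` add_span R M)" for j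
  proof (induction j)
    case (Suc j)
    have "(?L ^^ (t + j)) x \<in> (?L ^^ t) ` carrier (K0 R)" if "x \<in> carrier (K0 R)" for x
      using hom_in_carrier[OF K0_L_pow_hom that, of j] by (auto simp: funpow_add)
    then have "(?L ^^ (t + j)) ` add_span R M \<subseteq> (?L ^^ t) ` carrier (K0 R)" using S by blast
    from ab_rank_inj_hom_image[OF comm_group_K0 K0_L_hom sub inj this]
    show ?case using Suc by (simp add: image_comp)
  qed simp
  then show ?thesis unfolding phi_def by (intro Least_le) simp
qed

text \<open>Used in the contrapositive: a class that no power of the syzygy operator kills belongs
  to a module of infinite projective dimension.\<close>

lemma pd_le_class:
  assumes "pd_le R n M" "M \<in> fg_modules R"
  shows "(K0_L R ^^ n) (K0_class R M) = \<one>\<^bsub>K0 R\<^esub>"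
  using assms
proof (induction n arbitrary: M)
  case 0
  then show ?case using K0_class_projective by simp
next
  case (Suc n)
  then obtain P p where P: "P \<in> fg_modules R" "projective R P" "p \<in> lmod_epi R P M" "pd_le R n (lmod_ker P M p)"
    by auto
  show ?case
    using Suc.IH[OF P(4) K0_L_class(1)[OF Suc.prems(2) P(1-3)]] K0_L_class(2)[OF Suc.prems(2) P(1-3)]
    by (simp only: funpow_Suc_right comp_apply)
qed

end

subsection \<open>Rings with a cyclic shift\<close>

text \<open>The features of a cyclic Nakayama algebra which the homological arguments use: \<open>e i\<close> are the
  vertex idempotents, \<open>A\<close> is the sum of all arrows, \<open>T\<close> consists of the scalars and \<open>c i\<close> is the
  length of the projective cover of the simple module at the vertex \<open>i\<close>.\<close>

locale cyclic_shift_ring = ring R for R (structure) +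
  fixes T :: "'a set" and e :: "nat \<Rightarrow> 'a" and A :: 'a and N :: nat and c :: "nat \<Rightarrow> nat"
  assumes zero_neq_one: "\<zero> \<noteq> \<one>"
    and T_closed: "t \<in> T \<Longrightarrow> t \<in> carrier R"
    and T_comm: "\<lbrakk>t \<in> T; a \<in> carrier R\<rbrakk> \<Longrightarrow> t \<otimes> a = a \<otimes> t"
    and T_inv: "\<lbrakk>t \<in> T; t \<noteq> \<zero>\<rbrakk> \<Longrightarrow> \<exists>t'\<in>T. t' \<otimes> t = \<one>"
    and T_minus_one: "\<ominus> \<one> \<in> T"
    and N_pos: "0 < N"
    and e_closed [simp]: "e i \<in> carrier R"
    and e_idem: "e i \<otimes> e i = e i"
    and e_orth: "i mod N \<noteq> j mod N \<Longrightarrow> e i \<otimes> e j = \<zero>"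
    and e_mod: "i mod N = j mod N \<Longrightarrow> e i = e j"
    and e_sum: "(\<Oplus>i\<in>{..<N}. e i) = \<one>"
    and A_closed [simp]: "A \<in> carrier R"
    and A_e: "A \<otimes> e i = e (Suc i) \<otimes> A"
    and A_left: "a \<in> carrier R \<Longrightarrow> \<exists>b\<in>carrier R. A \<otimes> a = b \<otimes> A"
    and A_right: "a \<in> carrier R \<Longrightarrow> \<exists>b\<in>carrier R. a \<otimes> A = A \<otimes> b"
    and e_split: "a \<in> carrier R \<Longrightarrow> \<exists>t\<in>T. \<exists>b\<in>carrier R. a \<otimes> e i = t \<otimes> e i \<oplus> A \<otimes> b \<otimes> e i"
    and A_pow_e: "A [^] (m::nat) \<otimes> e i = \<zero> \<longleftrightarrow> c i \<le> m"
begin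

lemma A_pow_Suc: "A [^] Suc m = A \<otimes> A [^] m"
  using nat_pow_Suc2[OF A_closed] .

text \<open>Moving a power of \<open>A\<close> to the right past a scalar. As a consequence the
  elements of a module killed by that power form a submodule.\<close>

lemma A_pow_left: "a \<in> carrier R \<Longrightarrow> \<exists>b\<in>carrier R. A [^] (m::nat) \<otimes> a = b \<otimes> A [^] m"
proof (induction m)
  case (Suc m)
  then obtain b where b: "b \<in> carrier R" "A [^] m \<otimes> a = b \<otimes> A [^] m" by blast
  obtain d where d: "d \<in> carrier R" "A \<otimes> b = d \<otimes> A" using A_left[OF b(1)] by blast
  have "A [^] Suc m \<otimes> a = A \<otimes> (b \<otimes> A [^] m)" using b Suc.prems unfolding A_pow_Suc by (simp add: m_assoc)
  also have "\<dots> = A \<otimes> b \<otimes> A [^] m" using b by (simp add: m_assoc)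
  also have "\<dots> = d \<otimes> A [^] Suc m" using d unfolding A_pow_Suc by (simp add: m_assoc)
  finally show ?case using d(1) by blast
qed auto

lemma A_pow_e_comm: "A [^] (m::nat) \<otimes> e i = e (i + m) \<otimes> A [^] m"
proof (induction m arbitrary: i)
  case (Suc m)
  have "A [^] Suc m \<otimes> e i = A [^] m \<otimes> e (Suc i) \<otimes> A" by (simp add: m_assoc A_e)
  also have "\<dots> = e (i + Suc m) \<otimes> A [^] Suc m" by (simp add: Suc m_assoc)
  finally show ?case .
qed simp

lemma c_mod: "i mod N = j mod N \<Longrightarrow> c i = c j"
  using A_pow_e e_mod by (metis le_antisym order_refl)

text \<open>The Kupisch inequality: after its first arrow, a path starting at \<open>i\<close>
  continues from \<open>Suc i\<close> and vanishes within \<open>c (Suc i)\<close> further arrows.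
  It is exactly what makes \<open>u + c u\<close> monotone in \<open>u\<close>.\<close>

lemma c_Suc: "c i \<le> Suc (c (Suc i))"
proof -
  have "A [^] Suc (c (Suc i)) \<otimes> e i = A [^] c (Suc i) \<otimes> e (Suc i) \<otimes> A"
    by (simp add: m_assoc A_e)
  also have "\<dots> = \<zero>" using A_pow_e[of "c (Suc i)" "Suc i"] by simp
  finally show ?thesis using A_pow_e by blast
qed

lemma A_nilpotent: "\<exists>C::nat. A [^] C = \<zero>"
proof -
  define C where "C = Max (c ` {..<N})"
  have "A [^] C = A [^] C \<otimes> (\<Oplus>i\<in>{..<N}. e i)" by (simp add: e_sum)
  also have "\<dots> = (\<Oplus>i\<in>{..<N}. A [^] C \<otimes> e i)" by (rule finsum_rdistr) auto
  also have "\<dots> = (\<Oplus>i\<in>{..<N}. \<zero>)"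
    by (intro finsum_cong' refl) (auto simp: A_pow_e C_def)
  finally show ?thesis by (intro exI[of _ C]) simp
qed

lemma A_pow_add: "A [^] (m + n :: nat) = A [^] m \<otimes> A [^] n"
  by (simp add: nat_pow_mult)

subsection \<open>Interval modules\<close>

text \<open>A cyclic module generated at the vertex \<open>u\<close>, with \<open>l\<close> the
  exact exponent of \<open>A\<close> that kills the generator; it is the uniserial module
  \<open>[u, u + l)\<close>. Only the residue of \<open>u\<close> matters. Length 0 is allowed and
  gives the zero module, so that kernels of isomorphisms need no separate treatment.\<close>

definition interval_gen :: "('a, 'm) module \<Rightarrow> nat \<Rightarrow> nat \<Rightarrow> 'm \<Rightarrow> bool"
  where "interval_gen M u l x \<longleftrightarrow> x \<in> carrier M \<and> e u \<odot>\<^bsub>M\<^esub> x = x \<and>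
    carrier M = {a \<odot>\<^bsub>M\<^esub> x | a. a \<in> carrier R} \<and> (\<forall>m::nat. A [^] m \<odot>\<^bsub>M\<^esub> x = \<zero>\<^bsub>M\<^esub> \<longleftrightarrow> l \<le> m)"

definition interval :: "('a, 'm) module \<Rightarrow> nat \<Rightarrow> nat \<Rightarrow> bool"
  where "interval M u l \<longleftrightarrow> left_module R M \<and> (\<exists>x. interval_gen M u l x)"

lemma pow_smult_zero:
  assumes M: "left_module R M" and x: "x \<in> carrier M" "A [^] (m::nat) \<odot>\<^bsub>M\<^esub> x = \<zero>\<^bsub>M\<^esub>" and b: "b \<in> carrier R"
  shows "A [^] m \<odot>\<^bsub>M\<^esub> (b \<odot>\<^bsub>M\<^esub> x) = \<zero>\<^bsub>M\<^esub>"
proof -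
  interpret M: left_module R M by fact
  obtain d where d: "d \<in> carrier R" "A [^] m \<otimes> b = d \<otimes> A [^] m" using A_pow_left[OF b] by blast
  have "A [^] m \<odot>\<^bsub>M\<^esub> (b \<odot>\<^bsub>M\<^esub> x) = (A [^] m \<otimes> b) \<odot>\<^bsub>M\<^esub> x" using x b by (simp add: M.smult_assoc1)
  also have "\<dots> = d \<odot>\<^bsub>M\<^esub> (A [^] m \<odot>\<^bsub>M\<^esub> x)" using x d by (simp add: M.smult_assoc1)
  finally show ?thesis using d x by simp
qed

lemma pow_smult_mono:
  assumes M: "left_module R M" and x: "x \<in> carrier M" "A [^] (m::nat) \<odot>\<^bsub>M\<^esub> x = \<zero>\<^bsub>M\<^esub>" and "m \<le> n"
  shows "A [^] n \<odot>\<^bsub>M\<^esub> x = \<zero>\<^bsub>M\<^esub>"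
proof -
  interpret M: left_module R M by fact
  have "A [^] n = A [^] (n - m) \<otimes> A [^] m" using A_pow_add[of "n - m" m] assms(4) by simp
  then show ?thesis using x by (simp add: M.smult_assoc1)
qed

lemma T_smult_eq_zero:
  assumes M: "left_module R M" and t: "t \<in> T" "t \<noteq> \<zero>" and w: "w \<in> carrier M" "t \<odot>\<^bsub>M\<^esub> w = \<zero>\<^bsub>M\<^esub>"
  shows "w = \<zero>\<^bsub>M\<^esub>"
proof -
  interpret M: left_module R M by fact
  obtain t' where t': "t' \<in> T" "t' \<otimes> t = \<one>" using T_inv[OF t] by blast
  have "w = (t' \<otimes> t) \<odot>\<^bsub>M\<^esub> w" using t' w by (simp add: M.smult_one)
  also have "\<dots> = t' \<odot>\<^bsub>M\<^esub> (t \<odot>\<^bsub>M\<^esub> w)" using T_closed[OF t(1)] T_closed[OF t'(1)] w by (simp add: M.smult_assoc1)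
  finally show ?thesis using w T_closed[OF t'(1)] by simp
qed

lemma e_split_smult:
  assumes M: "left_module R M" and x: "x \<in> carrier M" "e u \<odot>\<^bsub>M\<^esub> x = x" and a: "a \<in> carrier R"
  obtains t d where "t \<in> T" "d \<in> carrier R" "a \<odot>\<^bsub>M\<^esub> x = t \<odot>\<^bsub>M\<^esub> x \<oplus>\<^bsub>M\<^esub> A \<odot>\<^bsub>M\<^esub> (d \<odot>\<^bsub>M\<^esub> x)"
proof -
  interpret M: left_module R M by fact
  obtain t d where t: "t \<in> T" and d: "d \<in> carrier R" "a \<otimes> e u = t \<otimes> e u \<oplus> A \<otimes> d \<otimes> e u"
    using e_split[OF a] by blast
  have "(a \<otimes> e u) \<odot>\<^bsub>M\<^esub> x = t \<odot>\<^bsub>M\<^esub> (e u \<odot>\<^bsub>M\<^esub> x) \<oplus>\<^bsub>M\<^esub> A \<odot>\<^bsub>M\<^esub> (d \<odot>\<^bsub>M\<^esub> (e u \<odot>\<^bsub>M\<^esub> x))"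
    unfolding d(2) using d(1) x(1) T_closed[OF t] by (simp add: M.smult_l_distr M.smult_assoc1 M.smult_closed)
  then show ?thesis using that[OF t d(1)] a x by (simp add: M.smult_assoc1)
qed

text \<open>Factors of \<open>A\<close> are peeled off one at a time. If \<open>a\<close> already
  has \<open>j < l\<close> of them, split the remaining factor into a scalar \<open>t\<close> and a
  multiple of \<open>A\<close>; were \<open>t\<close> nonzero, a suitable power of \<open>A\<close>
  would turn \<open>a x = 0\<close> into \<open>A [^] (l - 1) x = 0\<close>.\<close>

lemma annihilator_factor:
  fixes l :: nat
  assumes M: "left_module R M" and x: "x \<in> carrier M" "e u \<odot>\<^bsub>M\<^esub> x = x"
    and l: "\<And>m. A [^] m \<odot>\<^bsub>M\<^esub> x = \<zero>\<^bsub>M\<^esub> \<longleftrightarrow> l \<le> m"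
    and a: "a \<in> carrier R" "a \<odot>\<^bsub>M\<^esub> x = \<zero>\<^bsub>M\<^esub>"
  shows "j \<le> l \<Longrightarrow> \<exists>b\<in>carrier R. a \<otimes> e u = A [^] j \<otimes> b \<otimes> e u"
proof (induction j)
  case 0
  then show ?case using a by auto
next
  case (Suc j)
  interpret M: left_module R M by fact
  obtain b where b: "b \<in> carrier R" "a \<otimes> e u = A [^] j \<otimes> b \<otimes> e u" using Suc by auto
  obtain t d where t: "t \<in> T" and d: "d \<in> carrier R" "b \<otimes> e u = t \<otimes> e u \<oplus> A \<otimes> d \<otimes> e u"
    using e_split[OF b(1)] by blast
  note [simp] = T_closed[OF t]
  \<comment> \<open>The exponent \<open>l - 1 - j\<close> brings the scalar term to
    \<open>A [^] (l - 1)\<close>, the last power not killing \<open>x\<close>, and the other term to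
    \<open>A [^] l\<close>, which does kill it.\<close>
  have "A [^] (l - 1 - j) \<otimes> (a \<otimes> e u) = A [^] (l - 1) \<otimes> (b \<otimes> e u)"
    using b Suc.prems A_pow_add[of "l - 1 - j" j] by (simp add: m_assoc)
  also have "\<dots> = A [^] (l - 1) \<otimes> (t \<otimes> e u) \<oplus> A [^] (l - 1) \<otimes> A \<otimes> (d \<otimes> e u)"
    using d by (simp add: r_distr m_assoc)
  also have "A [^] (l - 1) \<otimes> A = A [^] l" using Suc.prems nat_pow_Suc[of A "l - 1"] by simp
  also have "A [^] (l - 1) \<otimes> (t \<otimes> e u) = t \<otimes> (A [^] (l - 1) \<otimes> e u)"
    using T_comm[OF t, of "A [^] (l - 1)"] by (simp add: m_assoc[symmetric])
  finally have eq: "A [^] (l - 1 - j) \<otimes> (a \<otimes> e u) = t \<otimes> (A [^] (l - 1) \<otimes> e u) \<oplus> A [^] l \<otimes> (d \<otimes> e u)" .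
  have "A [^] (l - 1 - j) \<odot>\<^bsub>M\<^esub> (a \<odot>\<^bsub>M\<^esub> (e u \<odot>\<^bsub>M\<^esub> x)) = t \<odot>\<^bsub>M\<^esub> (A [^] (l - 1) \<odot>\<^bsub>M\<^esub> (e u \<odot>\<^bsub>M\<^esub> x))
      \<oplus>\<^bsub>M\<^esub> A [^] l \<odot>\<^bsub>M\<^esub> (d \<odot>\<^bsub>M\<^esub> (e u \<odot>\<^bsub>M\<^esub> x))"
    using arg_cong[OF eq, of "\<lambda>r. r \<odot>\<^bsub>M\<^esub> x"] x(1) a(1) d(1)
    by (simp add: M.smult_l_distr M.smult_assoc1 M.smult_closed)
  moreover have "A [^] l \<odot>\<^bsub>M\<^esub> (d \<odot>\<^bsub>M\<^esub> x) = \<zero>\<^bsub>M\<^esub>" using pow_smult_zero[OF M x(1) _ d(1)] l by simp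
  ultimately have z: "t \<odot>\<^bsub>M\<^esub> (A [^] (l - 1) \<odot>\<^bsub>M\<^esub> x) = \<zero>\<^bsub>M\<^esub>"
    using x a M.smult_closed by simp
  have "t = \<zero>"
  proof (rule ccontr)
    assume "t \<noteq> \<zero>"
    then have "A [^] (l - 1) \<odot>\<^bsub>M\<^esub> x = \<zero>\<^bsub>M\<^esub>"
      using T_smult_eq_zero[OF M t _ _ z] x(1) M.smult_closed by simp
    then show False using l[of "l - 1"] Suc.prems by simp
  qed
  then have "b \<otimes> e u = A \<otimes> d \<otimes> e u" using d by simp
  then have "a \<otimes> e u = A [^] Suc j \<otimes> d \<otimes> e u" using b d by (simp add: m_assoc)
  then show ?case using d(1) by blast
qed

text \<open>The annihilator of a generator is determined by vertex and length alone. This makes the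
  assignment of \<open>a x'\<close> to \<open>a x\<close> well defined, which is how homomorphisms
  out of intervals are built.\<close>

lemma annihilator_transfer:
  fixes l :: nat
  assumes M: "left_module R M" and x: "x \<in> carrier M" "e u \<odot>\<^bsub>M\<^esub> x = x"
    and l: "\<And>m. A [^] m \<odot>\<^bsub>M\<^esub> x = \<zero>\<^bsub>M\<^esub> \<longleftrightarrow> l \<le> m"
    and M': "left_module R M'" and x': "x' \<in> carrier M'" "e u \<odot>\<^bsub>M'\<^esub> x' = x'" "A [^] l \<odot>\<^bsub>M'\<^esub> x' = \<zero>\<^bsub>M'\<^esub>"
    and a: "a \<in> carrier R" "a \<odot>\<^bsub>M\<^esub> x = \<zero>\<^bsub>M\<^esub>"
  shows "a \<odot>\<^bsub>M'\<^esub> x' = \<zero>\<^bsub>M'\<^esub>"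
proof -
  interpret M': left_module R M' by fact
  obtain b where b: "b \<in> carrier R" "a \<otimes> e u = A [^] l \<otimes> b \<otimes> e u"
    using annihilator_factor[OF M x l a order_refl] by blast
  have "a \<odot>\<^bsub>M'\<^esub> (e u \<odot>\<^bsub>M'\<^esub> x') = A [^] l \<odot>\<^bsub>M'\<^esub> (b \<odot>\<^bsub>M'\<^esub> (e u \<odot>\<^bsub>M'\<^esub> x'))"
    using arg_cong[OF b(2), of "\<lambda>r. r \<odot>\<^bsub>M'\<^esub> x'"] b(1) a(1) x'(1)
    by (simp add: M'.smult_assoc1 M'.smult_closed)
  then show ?thesis using pow_smult_zero[OF M' x'(1,3) b(1)] x'(2) by simp
qed

lemma interval_hom:
  assumes M: "left_module R M" and x: "interval_gen M u l x"
    and M': "left_module R M'" and x': "x' \<in> carrier M'" "e u \<odot>\<^bsub>M'\<^esub> x' = x'" "A [^] l \<odot>\<^bsub>M'\<^esub> x' = \<zero>\<^bsub>M'\<^esub>"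
  obtains h where "h \<in> lmod_hom R M M'" "\<And>a. a \<in> carrier R \<Longrightarrow> h (a \<odot>\<^bsub>M\<^esub> x) = a \<odot>\<^bsub>M'\<^esub> x'"
proof -
  interpret M: left_module R M by fact
  interpret M': left_module R M' by fact
  have x1: "x \<in> carrier M" "e u \<odot>\<^bsub>M\<^esub> x = x" "carrier M = {a \<odot>\<^bsub>M\<^esub> x | a. a \<in> carrier R}"
    "\<And>m. A [^] m \<odot>\<^bsub>M\<^esub> x = \<zero>\<^bsub>M\<^esub> \<longleftrightarrow> l \<le> m"
    using x unfolding interval_gen_def by blast+
  define h where "h = (\<lambda>y. (SOME a. a \<in> carrier R \<and> y = a \<odot>\<^bsub>M\<^esub> x) \<odot>\<^bsub>M'\<^esub> x')"
  have h: "h (a \<odot>\<^bsub>M\<^esub> x) = a \<odot>\<^bsub>M'\<^esub> x'" if a: "a \<in> carrier R" for a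
  proof -
    define b where "b = (SOME b. b \<in> carrier R \<and> a \<odot>\<^bsub>M\<^esub> x = b \<odot>\<^bsub>M\<^esub> x)"
    have b: "b \<in> carrier R \<and> a \<odot>\<^bsub>M\<^esub> x = b \<odot>\<^bsub>M\<^esub> x" unfolding b_def by (rule someI[of _ a]) (use a in simp)
    have "(\<ominus> b \<oplus> a) \<odot>\<^bsub>M\<^esub> x = (\<ominus> b) \<odot>\<^bsub>M\<^esub> x \<oplus>\<^bsub>M\<^esub> a \<odot>\<^bsub>M\<^esub> x"
      using a b x1(1) by (simp add: M.smult_l_distr)
    also have "\<dots> = (\<ominus> b) \<odot>\<^bsub>M\<^esub> x \<oplus>\<^bsub>M\<^esub> b \<odot>\<^bsub>M\<^esub> x" using b by simp
    also have "\<dots> = (\<ominus> b \<oplus> b) \<odot>\<^bsub>M\<^esub> x" using b x1(1) by (simp add: M.smult_l_distr del: l_neg)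
    finally have "(\<ominus> b \<oplus> a) \<odot>\<^bsub>M\<^esub> x = \<zero>\<^bsub>M\<^esub>" using b x1(1) by (simp add: l_neg)
    then have "(\<ominus> b \<oplus> a) \<odot>\<^bsub>M'\<^esub> x' = \<zero>\<^bsub>M'\<^esub>"
      using annihilator_transfer[OF M x1(1,2,4) M' x', of "\<ominus> b \<oplus> a"] a b by simp
    then have "b \<odot>\<^bsub>M'\<^esub> x' \<oplus>\<^bsub>M'\<^esub> (\<ominus> b \<oplus> a) \<odot>\<^bsub>M'\<^esub> x' = b \<odot>\<^bsub>M'\<^esub> x'"
      using b x'(1) M'.smult_closed by simp
    moreover have "b \<odot>\<^bsub>M'\<^esub> x' \<oplus>\<^bsub>M'\<^esub> (\<ominus> b \<oplus> a) \<odot>\<^bsub>M'\<^esub> x' = (b \<oplus> (\<ominus> b \<oplus> a)) \<odot>\<^bsub>M'\<^esub> x'"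
      using a b x'(1) by (simp add: M'.smult_l_distr)
    moreover have "b \<oplus> (\<ominus> b \<oplus> a) = a" using a b by (simp add: r_neg2)
    ultimately show ?thesis by (simp add: h_def b_def)
  qed
  have "h \<in> lmod_hom R M M'"
    unfolding lmod_hom_def
  proof (intro CollectI conjI ballI)
    show "h \<in> carrier M \<rightarrow> carrier M'" using x1(3) h x'(1) M'.smult_closed by auto
  next
    fix y z assume "y \<in> carrier M" "z \<in> carrier M"
    then obtain a b where ab: "a \<in> carrier R" "y = a \<odot>\<^bsub>M\<^esub> x" "b \<in> carrier R" "z = b \<odot>\<^bsub>M\<^esub> x"
      using x1(3) by auto
    then have "y \<oplus>\<^bsub>M\<^esub> z = (a \<oplus> b) \<odot>\<^bsub>M\<^esub> x" using x1(1) by (simp add: M.smult_l_distr)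
    then show "h (y \<oplus>\<^bsub>M\<^esub> z) = h y \<oplus>\<^bsub>M'\<^esub> h z"
      using ab h[of "a \<oplus> b"] h[of a] h[of b] x'(1) by (simp add: M'.smult_l_distr)
  next
    fix b y assume b: "b \<in> carrier R" and "y \<in> carrier M"
    then obtain a where ab: "a \<in> carrier R" "y = a \<odot>\<^bsub>M\<^esub> x" using x1(3) by auto
    then have "b \<odot>\<^bsub>M\<^esub> y = (b \<otimes> a) \<odot>\<^bsub>M\<^esub> x" using b x1(1) by (simp add: M.smult_assoc1)
    then show "h (b \<odot>\<^bsub>M\<^esub> y) = b \<odot>\<^bsub>M'\<^esub> h y"
      using ab b h[of "b \<otimes> a"] h[of a] x'(1) by (simp add: M'.smult_assoc1)
  qed
  then show ?thesis using that h by blast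
qed

lemma interval_iso:
  assumes M: "interval M u l" and M': "interval M' u' l" and u: "u mod N = u' mod N"
  shows "lmod_iso R M M'"
proof -
  have eu: "e u' = e u" using e_mod u by metis
  have lm: "left_module R M" "left_module R M'" using M M' by (auto simp: interval_def)
  interpret M: left_module R M by fact
  interpret M': left_module R M' by fact
  obtain x x' where x: "interval_gen M u l x" and x': "interval_gen M' u l x'"
    using M M' eu by (auto simp: interval_def interval_gen_def)
  have x1: "x \<in> carrier M" "e u \<odot>\<^bsub>M\<^esub> x = x" "carrier M = {a \<odot>\<^bsub>M\<^esub> x | a. a \<in> carrier R}"
    "\<And>m. A [^] m \<odot>\<^bsub>M\<^esub> x = \<zero>\<^bsub>M\<^esub> \<longleftrightarrow> l \<le> m"
    using x unfolding interval_gen_def by blast+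
  have x1': "x' \<in> carrier M'" "e u \<odot>\<^bsub>M'\<^esub> x' = x'" "carrier M' = {a \<odot>\<^bsub>M'\<^esub> x' | a. a \<in> carrier R}"
    "\<And>m. A [^] m \<odot>\<^bsub>M'\<^esub> x' = \<zero>\<^bsub>M'\<^esub> \<longleftrightarrow> l \<le> m"
    using x' unfolding interval_gen_def by blast+
  obtain h where h: "h \<in> lmod_hom R M M'" "\<And>a. a \<in> carrier R \<Longrightarrow> h (a \<odot>\<^bsub>M\<^esub> x) = a \<odot>\<^bsub>M'\<^esub> x'"
    using interval_hom[OF lm(1) x lm(2) x1'(1,2)] x1'(4) by blast
  have "h ` carrier M = carrier M'"
    using h(2) unfolding x1(3) x1'(3) by (force simp: image_iff)
  moreover have "inj_on h (carrier M)"
    unfolding lmod_hom_inj_iff[OF lm h(1)]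
  proof (intro ballI impI)
    fix y assume y: "y \<in> carrier M" "h y = \<zero>\<^bsub>M'\<^esub>"
    then obtain a where a: "a \<in> carrier R" "y = a \<odot>\<^bsub>M\<^esub> x" using x1(3) by auto
    then show "y = \<zero>\<^bsub>M\<^esub>"
      using annihilator_transfer[OF lm(2) x1'(1,2,4) lm(1) x1(1,2), of a] x1(4) y h(2) by simp
  qed
  ultimately show ?thesis using h(1) by (auto simp: lmod_iso_def bij_betw_def)
qed

lemma interval_fg: "interval M u l \<Longrightarrow> fin_gen R M"
proof -
  assume M: "interval M u l"
  then interpret M: left_module R M by (simp add: interval_def)
  obtain x where x: "x \<in> carrier M" "carrier M = {a \<odot>\<^bsub>M\<^esub> x | a. a \<in> carrier R}"
    using M unfolding interval_def interval_gen_def by blast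
  have "U = carrier M" if "submodule U R M" "x \<in> U" for U
    using M.submoduleD(1,4)[OF that(1)] that(2) x(2) by auto
  then show ?thesis unfolding fin_gen_def using x(1) by (intro exI[of _ "{x}"]) auto
qed

lemma interval_length_le:
  assumes "interval M u l" shows "l \<le> c u"
proof -
  interpret M: left_module R M using assms by (simp add: interval_def)
  obtain x where x: "x \<in> carrier M" "e u \<odot>\<^bsub>M\<^esub> x = x" "\<And>m. A [^] m \<odot>\<^bsub>M\<^esub> x = \<zero>\<^bsub>M\<^esub> \<longleftrightarrow> l \<le> m"
    using assms unfolding interval_def interval_gen_def by blast
  have "A [^] c u \<odot>\<^bsub>M\<^esub> (e u \<odot>\<^bsub>M\<^esub> x) = (A [^] c u \<otimes> e u) \<odot>\<^bsub>M\<^esub> x" using x(1) by (simp add: M.smult_assoc1)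
  also have "A [^] c u \<otimes> e u = \<zero>" using A_pow_e by blast
  also have "\<zero> \<odot>\<^bsub>M\<^esub> x = \<zero>\<^bsub>M\<^esub>" using x(1) by simp
  finally show ?thesis using x by simp
qed

text \<open>At full length the relation imposed on the image of the generator holds for free:
  \<open>A [^] c u\<close> kills everything at the vertex \<open>u\<close>. So any preimage
  \<open>z\<close> of the image of the generator works after being replaced by its component
  \<open>e u z\<close>.\<close>

lemma interval_projective:
  fixes P :: "'a lmod"
  assumes "interval P u (c u)"
  shows "projective R P"
  unfolding projective_def
proof (intro conjI allI impI; (elim conjE)?)
  show P: "left_module R P" using assms by (simp add: interval_def)
  fix X Y :: "'a lmod" and g f
  assume XY: "left_module R X" "left_module R Y" "g \<in> lmod_epi R X Y" "f \<in> lmod_hom R P Y"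
  interpret P: left_module R P by fact
  interpret X: left_module R X by fact
  interpret Y: left_module R Y by fact
  obtain x where xg: "interval_gen P u (c u) x" using assms by (auto simp: interval_def)
  then have x: "x \<in> carrier P" "e u \<odot>\<^bsub>P\<^esub> x = x" "carrier P = {a \<odot>\<^bsub>P\<^esub> x | a. a \<in> carrier R}"
    unfolding interval_gen_def by blast+
  have g: "g \<in> lmod_hom R X Y" "g ` carrier X = carrier Y" using XY(3) by (auto simp: lmod_epi_def)
  obtain z where z: "z \<in> carrier X" "g z = f x"
    using lmod_hom_closed[OF XY(4) x(1)] g(2) by (metis imageE)
  let ?z = "e u \<odot>\<^bsub>X\<^esub> z"
  have z': "?z \<in> carrier X" "e u \<odot>\<^bsub>X\<^esub> ?z = ?z" "A [^] c u \<odot>\<^bsub>X\<^esub> ?z = \<zero>\<^bsub>X\<^esub>"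
    using z(1) e_idem A_pow_e[of "c u" u] by (simp_all add: X.smult_closed X.smult_assoc1[symmetric])
  obtain h where h: "h \<in> lmod_hom R P X" "\<And>a. a \<in> carrier R \<Longrightarrow> h (a \<odot>\<^bsub>P\<^esub> x) = a \<odot>\<^bsub>X\<^esub> ?z"
    using interval_hom[OF P xg XY(1) z'] by blast
  have gz: "g ?z = f x"
    using lmod_hom_smult[OF g(1) e_closed z(1)] lmod_hom_smult[OF XY(4) e_closed x(1), of u] z(2) x(2) by simp
  have "g (h p) = f p" if p: "p \<in> carrier P" for p
  proof -
    obtain a where a: "a \<in> carrier R" "p = a \<odot>\<^bsub>P\<^esub> x" using p x(3) by auto
    then show ?thesis
      using h(2) lmod_hom_smult[OF g(1) a(1) z'(1)] lmod_hom_smult[OF XY(4) a(1) x(1)] gz by simp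
  qed
  then show "\<exists>f'\<in>lmod_hom R P X. \<forall>p\<in>carrier P. g (f' p) = f p" using h(1) by blast
qed


lemma A_pow_in_image:
  assumes d: "d \<in> carrier R" and eq: "A [^] m \<otimes> e u = d \<otimes> (A [^] l \<otimes> e u)" and l: "l \<le> c u"
  shows "l \<le> (m :: nat)"
proof (rule ccontr)
  assume "\<not> l \<le> m"
  then have ml: "m < l" by simp
  \<comment> \<open>The factor \<open>A [^] k\<close> lifts the left side to the exponent
    \<open>c u - 1\<close>, still nonzero, while \<open>l > m\<close> pushes the right side to at
    least \<open>c u\<close>, where it vanishes.\<close>
  define k where "k = c u - 1 - m"
  obtain b where b: "b \<in> carrier R" "A [^] k \<otimes> d = b \<otimes> A [^] k" using A_pow_left[OF d] by blast
  have "A [^] (k + m) \<otimes> e u = A [^] k \<otimes> (A [^] m \<otimes> e u)" unfolding A_pow_add by (simp add: m_assoc)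
  also have "\<dots> = A [^] k \<otimes> d \<otimes> (A [^] l \<otimes> e u)" unfolding eq using d by (simp add: m_assoc)
  also have "\<dots> = b \<otimes> (A [^] (k + l) \<otimes> e u)" unfolding b A_pow_add using b(1) by (simp add: m_assoc)
  also have "A [^] (k + l) \<otimes> e u = \<zero>" unfolding A_pow_e using ml l by (simp add: k_def)
  finally have "A [^] (k + m) \<otimes> e u = \<zero>" using b(1) by simp
  then have "c u \<le> k + m" unfolding A_pow_e .
  then show False using ml l by (simp add: k_def)
qed

text \<open>The interval is the quotient of the left ideal \<open>R e u\<close> by the multiples of
  \<open>A [^] l e u\<close>. The bound \<open>l \<le> c u\<close> ensures that no smaller power of
  \<open>A\<close> becomes zero in it.\<close>

lemma interval_exists:
  assumes l: "l \<le> c u"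
  obtains M :: "'a lmod" where "interval M u l"
proof -
  define RM :: "('a, 'a) module" where "RM = \<lparr>carrier = carrier R, monoid.mult = undefined, one = undefined,
    ring.zero = \<zero>, ring.add = (\<lambda>x y. x \<oplus> y), module.smult = (\<lambda>x y. x \<otimes> y)\<rparr>"
  have RM: "carrier RM = carrier R" "\<zero>\<^bsub>RM\<^esub> = \<zero>" "x \<oplus>\<^bsub>RM\<^esub> y = x \<oplus> y" "a \<odot>\<^bsub>RM\<^esub> x = a \<otimes> x" for x y a
    by (simp_all add: RM_def)
  have lmR: "left_module R RM"
    by (rule left_moduleI) (auto simp: RM ring_axioms add.m_ac l_distr r_distr m_assoc)
  interpret RM: left_module R RM by fact
  let ?U = "{a \<odot>\<^bsub>RM\<^esub> e u | a. a \<in> carrier R}"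
  define Q where "Q = RM\<lparr>carrier := ?U\<rparr>"
  have Q: "left_module R Q" unfolding Q_def
    by (rule RM.submodule_left_module[OF RM.submodule_cyclic]) (simp add: RM)
  interpret Q: left_module R Q by fact
  have Qs: "carrier Q = {a \<otimes> e u | a. a \<in> carrier R}" "\<zero>\<^bsub>Q\<^esub> = \<zero>" "x \<oplus>\<^bsub>Q\<^esub> y = x \<oplus> y" "a \<odot>\<^bsub>Q\<^esub> x = a \<otimes> x" for x y a
    by (simp_all add: RM Q_def)
  have Q_in: "a \<otimes> e u \<in> carrier Q" if "a \<in> carrier R" for a using that by (auto simp: Qs)
  have eQ: "e u \<in> carrier Q" using Q_in[OF e_closed, of u] by (simp add: e_idem)
  let ?J = "{a \<odot>\<^bsub>Q\<^esub> (A [^] l \<otimes> e u) | a. a \<in> carrier R}"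
  have J: "submodule ?J R Q" by (rule Q.submodule_cyclic) (simp add: Q_in)
  \<comment> \<open>Constant functions embed ring elements into the functions whose sets form the
    carrier type of \<open>'a lmod\<close>.\<close>
  have inj: "inj (\<lambda>a::'a. \<lambda>_::nat. a)" by (auto simp: inj_def fun_eq_iff)
  obtain M :: "'a lmod" and \<phi> where M: "left_module R M" "\<phi> \<in> lmod_epi R Q M"
    "\<And>x. x \<in> carrier Q \<Longrightarrow> \<phi> x = \<zero>\<^bsub>M\<^esub> \<longleftrightarrow> x \<in> ?J"
    by (rule quotient_module_exists[OF Q J inj], rule that; assumption)
  interpret M: left_module R M by fact
  have h: "\<phi> \<in> lmod_hom R Q M" "\<phi> ` carrier Q = carrier M" using M(2) by (auto simp: lmod_epi_def)
  have sm: "a \<odot>\<^bsub>M\<^esub> \<phi> (e u) = \<phi> (a \<otimes> e u)" if "a \<in> carrier R" for a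
    using lmod_hom_smult[OF h(1) that eQ] by (simp add: Qs)
  have "interval_gen M u l (\<phi> (e u))"
    unfolding interval_gen_def
  proof (intro conjI allI)
    show "\<phi> (e u) \<in> carrier M" by (rule lmod_hom_closed[OF h(1) eQ])
    show "e u \<odot>\<^bsub>M\<^esub> \<phi> (e u) = \<phi> (e u)" by (simp add: sm e_idem)
    show "carrier M = {a \<odot>\<^bsub>M\<^esub> \<phi> (e u) | a. a \<in> carrier R}"
      unfolding h(2)[symmetric]
    proof (intro equalityI subsetI)
      fix y assume "y \<in> \<phi> ` carrier Q"
      then obtain a where "a \<in> carrier R" "y = \<phi> (a \<otimes> e u)" by (auto simp: Qs)
      then show "y \<in> {a \<odot>\<^bsub>M\<^esub> \<phi> (e u) | a. a \<in> carrier R}" using sm by blast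
    next
      fix y assume "y \<in> {a \<odot>\<^bsub>M\<^esub> \<phi> (e u) | a. a \<in> carrier R}"
      then obtain a where "a \<in> carrier R" "y = \<phi> (a \<otimes> e u)" using sm by blast
      then show "y \<in> \<phi> ` carrier Q" using Q_in by blast
    qed
  next
    fix m :: nat
    have "A [^] m \<odot>\<^bsub>M\<^esub> \<phi> (e u) = \<zero>\<^bsub>M\<^esub> \<longleftrightarrow> A [^] m \<otimes> e u \<in> ?J"
      using sm[of "A [^] m"] M(3)[OF Q_in, of "A [^] m"] by simp
    also have "\<dots> \<longleftrightarrow> l \<le> m"
    proof
      assume "A [^] m \<otimes> e u \<in> ?J"
      then show "l \<le> m" using A_pow_in_image[OF _ _ l] by (auto simp: Qs)
    next
      assume "l \<le> m"
      then have "A [^] m \<otimes> e u = A [^] (m - l) \<odot>\<^bsub>Q\<^esub> (A [^] l \<otimes> e u)"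
        using A_pow_add[of "m - l" l] by (simp add: Qs m_assoc)
      then show "A [^] m \<otimes> e u \<in> ?J" using nat_pow_closed[OF A_closed] by blast
    qed
    finally show "A [^] m \<odot>\<^bsub>M\<^esub> \<phi> (e u) = \<zero>\<^bsub>M\<^esub> \<longleftrightarrow> l \<le> m" .
  qed
  then show ?thesis using that M(1) by (auto simp: interval_def)
qed

lemma interval_in_fg: "interval M u l \<Longrightarrow> M \<in> fg_modules R"
  using interval_fg by (auto simp: fg_modules_def interval_def)

text \<open>Generators go to generators, and \<open>annihilator_factor\<close> shows that the kernel
  is generated by \<open>A [^] l x\<close>, which sits at the vertex \<open>u + l\<close> and dies
  after \<open>c u - l\<close> steps. The last conclusion prepares superfluity; for
  \<open>l = 0\<close> the kernel is all of \<open>P\<close>.\<close>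

lemma interval_presentation:
  assumes M: "interval M u l" and P: "interval P u (c u)"
  obtains p where "p \<in> lmod_epi R P M" "interval (lmod_ker P M p) (u + l) (c u - l)"
    "0 < l \<Longrightarrow> carrier (lmod_ker P M p) \<subseteq> {A \<odot>\<^bsub>P\<^esub> y | y. y \<in> carrier P}"
proof -
  have lm: "left_module R M" "left_module R P" using M P by (auto simp: interval_def)
  interpret M: left_module R M by fact
  interpret P: left_module R P by fact
  have lc: "l \<le> c u" by (rule interval_length_le[OF M])
  obtain x x' where x: "interval_gen P u (c u) x" and x': "interval_gen M u l x'"
    using M P by (auto simp: interval_def)
  have x1: "x \<in> carrier P" "e u \<odot>\<^bsub>P\<^esub> x = x" "carrier P = {a \<odot>\<^bsub>P\<^esub> x | a. a \<in> carrier R}"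
    "\<And>m. A [^] m \<odot>\<^bsub>P\<^esub> x = \<zero>\<^bsub>P\<^esub> \<longleftrightarrow> c u \<le> m"
    using x unfolding interval_gen_def by blast+
  have x1': "x' \<in> carrier M" "e u \<odot>\<^bsub>M\<^esub> x' = x'" "carrier M = {a \<odot>\<^bsub>M\<^esub> x' | a. a \<in> carrier R}"
    "\<And>m. A [^] m \<odot>\<^bsub>M\<^esub> x' = \<zero>\<^bsub>M\<^esub> \<longleftrightarrow> l \<le> m"
    using x' unfolding interval_gen_def by blast+
  obtain p where p: "p \<in> lmod_hom R P M" "\<And>a. a \<in> carrier R \<Longrightarrow> p (a \<odot>\<^bsub>P\<^esub> x) = a \<odot>\<^bsub>M\<^esub> x'"
    using interval_hom[OF lm(2) x lm(1) x1'(1,2)] x1'(4) lc by blast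
  have "p ` carrier P = carrier M"
    using p(2) unfolding x1(3) x1'(3) by (force simp: image_iff)
  then have epi: "p \<in> lmod_epi R P M" using p(1) by (simp add: lmod_epi_def)
  define w where "w = A [^] l \<odot>\<^bsub>P\<^esub> x"
  have w: "w \<in> carrier P" using x1(1) P.smult_closed by (simp add: w_def)
  have ker: "carrier (lmod_ker P M p) = {a \<odot>\<^bsub>P\<^esub> w | a. a \<in> carrier R}" (is "?K = ?W")
  proof (intro equalityI subsetI)
    fix y assume "y \<in> ?K"
    then have y: "y \<in> carrier P" "p y = \<zero>\<^bsub>M\<^esub>" by (auto simp: lmod_ker_def)
    then obtain a where a: "a \<in> carrier R" "y = a \<odot>\<^bsub>P\<^esub> x" using x1(3) by auto
    then have "a \<odot>\<^bsub>M\<^esub> x' = \<zero>\<^bsub>M\<^esub>" using p(2) y(2) by simp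
    then obtain b where b: "b \<in> carrier R" "a \<otimes> e u = A [^] l \<otimes> b \<otimes> e u"
      using annihilator_factor[OF lm(1) x1'(1,2,4) a(1) _ order_refl] by blast
    obtain d where d: "d \<in> carrier R" "A [^] l \<otimes> b = d \<otimes> A [^] l" using A_pow_left[OF b(1)] by blast
    have "y = a \<odot>\<^bsub>P\<^esub> (e u \<odot>\<^bsub>P\<^esub> x)" using a x1(2) by simp
    also have "\<dots> = (a \<otimes> e u) \<odot>\<^bsub>P\<^esub> x" using a x1(1) by (simp add: P.smult_assoc1)
    also have "\<dots> = d \<odot>\<^bsub>P\<^esub> (A [^] l \<odot>\<^bsub>P\<^esub> (e u \<odot>\<^bsub>P\<^esub> x))"
      unfolding b(2) d(2) using d(1) x1(1) by (simp add: P.smult_assoc1 P.smult_closed)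
    finally have "y = d \<odot>\<^bsub>P\<^esub> w" using x1(2) by (simp add: w_def)
    then show "y \<in> ?W" using d(1) by blast
  next
    fix y assume "y \<in> ?W"
    then obtain a where a: "a \<in> carrier R" "y = a \<odot>\<^bsub>P\<^esub> w" by blast
    then have "p y = a \<odot>\<^bsub>M\<^esub> (A [^] l \<odot>\<^bsub>M\<^esub> x')"
      using lmod_hom_smult[OF p(1) a(1) w] p(2)[of "A [^] l"] by (simp add: w_def)
    moreover have "A [^] l \<odot>\<^bsub>M\<^esub> x' = \<zero>\<^bsub>M\<^esub>" using x1'(4) by blast
    ultimately show "y \<in> ?K" using a w P.smult_closed by (simp add: lmod_ker_def)
  qed
  have K: "left_module R (lmod_ker P M p)" by (rule lmod_ker_left_module[OF lm(2,1) p(1)])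
  have ops: "a \<odot>\<^bsub>lmod_ker P M p\<^esub> y = a \<odot>\<^bsub>P\<^esub> y" "\<zero>\<^bsub>lmod_ker P M p\<^esub> = \<zero>\<^bsub>P\<^esub>" for a y by (simp_all add: lmod_ker_def)
  have "interval_gen (lmod_ker P M p) (u + l) (c u - l) w"
    unfolding interval_gen_def ker ops
  proof (intro conjI allI refl)
    show "w \<in> ?W" using w P.smult_one[OF w] by (auto intro!: exI[of _ "\<one>"])
    have "e (u + l) \<odot>\<^bsub>P\<^esub> w = (e (u + l) \<otimes> A [^] l) \<odot>\<^bsub>P\<^esub> x" using x1(1) by (simp add: w_def P.smult_assoc1)
    also have "\<dots> = A [^] l \<odot>\<^bsub>P\<^esub> (e u \<odot>\<^bsub>P\<^esub> x)" unfolding A_pow_e_comm[symmetric] using x1(1) by (simp add: P.smult_assoc1)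
    finally show "e (u + l) \<odot>\<^bsub>P\<^esub> w = w" using x1(2) by (simp add: w_def)
    fix m :: nat
    have "A [^] m \<odot>\<^bsub>P\<^esub> w = A [^] (m + l) \<odot>\<^bsub>P\<^esub> x" unfolding A_pow_add using x1(1) by (simp add: w_def P.smult_assoc1)
    then show "A [^] m \<odot>\<^bsub>P\<^esub> w = \<zero>\<^bsub>P\<^esub> \<longleftrightarrow> c u - l \<le> m" using x1(4)[of "m + l"] by (simp add: le_diff_conv)
  qed
  then have "interval (lmod_ker P M p) (u + l) (c u - l)" using K unfolding interval_def by blast
  moreover have "carrier (lmod_ker P M p) \<subseteq> {A \<odot>\<^bsub>P\<^esub> y | y. y \<in> carrier P}" if l0: "0 < l"
  proof
    fix y assume "y \<in> carrier (lmod_ker P M p)"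
    then obtain a where a: "a \<in> carrier R" "y = a \<odot>\<^bsub>P\<^esub> w" unfolding ker by blast
    \<comment> \<open>The coefficient stands to the left of \<open>A\<close>; exchanging them
      exhibits the element as \<open>A\<close> times something.\<close>
    obtain b where b: "b \<in> carrier R" "a \<otimes> A = A \<otimes> b" using A_right[OF a(1)] by blast
    obtain k where k: "l = Suc k" using gr0_implies_Suc[OF l0] by blast
    have "w = A \<odot>\<^bsub>P\<^esub> (A [^] k \<odot>\<^bsub>P\<^esub> x)" unfolding w_def k A_pow_Suc using x1(1) by (simp add: P.smult_assoc1)
    then have "y = (a \<otimes> A) \<odot>\<^bsub>P\<^esub> (A [^] k \<odot>\<^bsub>P\<^esub> x)" using a x1(1) by (simp add: P.smult_assoc1 P.smult_closed)
    also have "\<dots> = A \<odot>\<^bsub>P\<^esub> (b \<odot>\<^bsub>P\<^esub> (A [^] k \<odot>\<^bsub>P\<^esub> x))" unfolding b(2) using b x1(1) by (simp add: P.smult_assoc1 P.smult_closed)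
    finally have "y = A \<odot>\<^bsub>P\<^esub> (b \<odot>\<^bsub>P\<^esub> (A [^] k \<odot>\<^bsub>P\<^esub> x))" .
    moreover have "b \<odot>\<^bsub>P\<^esub> (A [^] k \<odot>\<^bsub>P\<^esub> x) \<in> carrier P" using b(1) x1(1) P.smult_closed by simp
    ultimately show "y \<in> {A \<odot>\<^bsub>P\<^esub> y | y. y \<in> carrier P}" by blast
  qed
  ultimately show ?thesis using that epi by blast
qed

text \<open>Nakayama's lemma for the nilpotent \<open>A\<close>: from \<open>P = A P + U\<close> one
  gets \<open>P = A [^] n P + U\<close> for every \<open>n\<close>, hence
  \<open>P = U\<close>.\<close>

lemma superfluous_image_A:
  assumes P: "left_module R P" and K: "K \<subseteq> {A \<odot>\<^bsub>P\<^esub> y | y. y \<in> carrier P}"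
  shows "superfluous R P K"
  unfolding superfluous_def
proof (intro allI impI, elim conjE)
  interpret P: left_module R P by fact
  fix U assume U: "submodule U R P" and sum: "K <+>\<^bsub>P\<^esub> U = carrier P"
  note U' = P.submoduleD[OF U]
  have dec: "\<exists>y\<in>carrier P. \<exists>u\<in>U. z = A [^] (n::nat) \<odot>\<^bsub>P\<^esub> y \<oplus>\<^bsub>P\<^esub> u" if "z \<in> carrier P" for z n
  proof (induction n)
    case 0
    show ?case using that U'(2) by (intro bexI[of _ z] bexI[of _ "\<zero>\<^bsub>P\<^esub>"]) (auto simp: P.smult_one)
  next
    case (Suc n)
    then obtain y u where y: "y \<in> carrier P" "u \<in> U" "z = A [^] n \<odot>\<^bsub>P\<^esub> y \<oplus>\<^bsub>P\<^esub> u" by blast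
    then have "y \<in> K <+>\<^bsub>P\<^esub> U" using sum by simp
    then obtain k v where "k \<in> K" "v \<in> U" "y = k \<oplus>\<^bsub>P\<^esub> v" by (auto simp: set_add_def')
    then obtain y' where y': "y' \<in> carrier P" "v \<in> U" "y = A \<odot>\<^bsub>P\<^esub> y' \<oplus>\<^bsub>P\<^esub> v" using K by blast
    have c: "u \<in> carrier P" "v \<in> carrier P" using U'(1) y y' by auto
    have "z = A [^] Suc n \<odot>\<^bsub>P\<^esub> y' \<oplus>\<^bsub>P\<^esub> (A [^] n \<odot>\<^bsub>P\<^esub> v \<oplus>\<^bsub>P\<^esub> u)"
      using y(3) y'(1,3) c by (simp add: P.smult_r_distr P.smult_closed P.smult_assoc1 P.M.a_assoc)
    moreover have "A [^] n \<odot>\<^bsub>P\<^esub> v \<oplus>\<^bsub>P\<^esub> u \<in> U" using y y' U'(3,4) by simp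
    ultimately show ?case using y'(1) by blast
  qed
  obtain C :: nat where C: "A [^] C = \<zero>" using A_nilpotent by blast
  have "z \<in> U" if "z \<in> carrier P" for z
    using dec[OF that, of C] U'(1) by (auto simp: C subset_iff)
  then show "U = carrier P" using U'(1) by blast
qed

subsection \<open>Decomposition into intervals\<close>

text \<open>Closing under isomorphism in the second rule keeps all modules inside
  \<open>'a lmod\<close>; the zero module is covered as an interval of length 0.\<close>

inductive interval_sum :: "'a lmod \<Rightarrow> bool"
  where
    interval_sum_interval: "interval M u l \<Longrightarrow> interval_sum M"
  | interval_sum_sum: "\<lbrakk>interval_sum M1; interval_sum M2; left_module R M; lmod_iso R M (lmod_sum M1 M2)\<rbrakk>
      \<Longrightarrow> interval_sum M"

lemma interval_sum_fg: "interval_sum M \<Longrightarrow> M \<in> fg_modules R"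
proof (induction rule: interval_sum.induct)
  case (interval_sum_interval M u l)
  then show ?case by (rule interval_in_fg)
next
  case (interval_sum_sum M1 M2 M)
  then have lm: "left_module R M1" "left_module R M2" "fin_gen R M1" "fin_gen R M2" by (auto simp: fg_modules_def)
  have "fin_gen R M"
    using fin_gen_iso[OF lmod_sum_left_module[OF lm(1,2)] interval_sum_sum(3) lmod_iso_sym[OF interval_sum_sum(3,4)]]
      fin_gen_sum[OF lm] by blast
  then show ?case using interval_sum_sum(3) by (simp add: fg_modules_def)
qed

text \<open>Some vertex component of an element outside \<open>D\<close> is outside
  \<open>D\<close>, since the idempotents sum to one. Multiplying it by \<open>A\<close> as long as
  it stays outside gives the desired element; nilpotency ends the process.\<close>

lemma homogeneous_outside:
  assumes M: "left_module R M" and D: "submodule D R M" "D \<noteq> carrier M"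
  obtains y w where "y \<in> carrier M" "y \<notin> D" "e w \<odot>\<^bsub>M\<^esub> y = y" "A \<odot>\<^bsub>M\<^esub> y \<in> D"
proof -
  interpret M: left_module R M by fact
  note D' = M.submoduleD[OF D(1)]
  obtain y0 where y0: "y0 \<in> carrier M" "y0 \<notin> D" using D D'(1) by blast
  have "\<exists>i. e i \<odot>\<^bsub>M\<^esub> y0 \<notin> D"
  proof (rule ccontr)
    assume "\<not> ?thesis"
    then have *: "e i \<odot>\<^bsub>M\<^esub> y0 \<in> D" for i by simp
    have "(\<Oplus>i\<in>{..<n}. e i) \<odot>\<^bsub>M\<^esub> y0 \<in> D" for n
    proof (induction n)
      case 0
      then show ?case using y0 D'(2) by simp
    next
      case (Suc n)
      then show ?case using y0 * D'(3) by (simp add: lessThan_Suc M.smult_l_distr)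
    qed
    from this[of N] show False using y0 by (simp add: e_sum M.smult_one)
  qed
  then obtain i where i: "e i \<odot>\<^bsub>M\<^esub> y0 \<notin> D" by blast
  define y1 where "y1 = e i \<odot>\<^bsub>M\<^esub> y0"
  have y1: "y1 \<in> carrier M" "y1 \<notin> D" "e i \<odot>\<^bsub>M\<^esub> y1 = y1"
    using y0 i by (simp_all add: y1_def M.smult_closed M.smult_assoc1[symmetric] e_idem)
  \<comment> \<open>\<open>m\<close> is the first exponent that leads into \<open>D\<close>,
    positive because \<open>y1\<close> is outside; the power just before it is the one
    wanted.\<close>
  define m where "m = (LEAST m::nat. A [^] m \<odot>\<^bsub>M\<^esub> y1 \<in> D)"
  obtain C :: nat where C: "A [^] C = \<zero>" using A_nilpotent by blast
  have "A [^] C \<odot>\<^bsub>M\<^esub> y1 \<in> D" using y1(1) D'(2) by (simp add: C)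
  then have m: "A [^] m \<odot>\<^bsub>M\<^esub> y1 \<in> D" unfolding m_def by (rule LeastI)
  have "m \<noteq> 0" using m y1 by (auto simp: M.smult_one intro: gr0I)
  then obtain k where k: "m = Suc k" by (cases m) auto
  have notk: "A [^] k \<odot>\<^bsub>M\<^esub> y1 \<notin> D" using not_less_Least[of k "\<lambda>m. A [^] m \<odot>\<^bsub>M\<^esub> y1 \<in> D"] k by (auto simp: m_def)
  have "e (i + k) \<odot>\<^bsub>M\<^esub> (A [^] k \<odot>\<^bsub>M\<^esub> y1) = (e (i + k) \<otimes> A [^] k) \<odot>\<^bsub>M\<^esub> y1" using y1(1) by (simp add: M.smult_assoc1)
  also have "\<dots> = A [^] k \<odot>\<^bsub>M\<^esub> (e i \<odot>\<^bsub>M\<^esub> y1)" unfolding A_pow_e_comm[symmetric] using y1(1) by (simp add: M.smult_assoc1)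
  finally have "e (i + k) \<odot>\<^bsub>M\<^esub> (A [^] k \<odot>\<^bsub>M\<^esub> y1) = A [^] k \<odot>\<^bsub>M\<^esub> y1" using y1(3) by simp
  moreover have "A \<odot>\<^bsub>M\<^esub> (A [^] k \<odot>\<^bsub>M\<^esub> y1) \<in> D"
    using m y1(1) unfolding k A_pow_Suc by (simp add: M.smult_assoc1)
  ultimately show ?thesis using that[of "A [^] k \<odot>\<^bsub>M\<^esub> y1"] notk y1(1) M.smult_closed by simp
qed

text \<open>A homogeneous element of maximal length spans a direct summand: a submodule \<open>B\<close> which is
  maximal among those meeting the cyclic submodule of \<open>x\<close> trivially is a complement, since an
  element outside the sum could be corrected by an element of the cyclic submodule so that \<open>A\<close>
  maps it into \<open>B\<close>.\<close>

lemma maximal_length_complement: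
  assumes M: "left_module R M" and x: "x \<in> carrier M" "e u \<odot>\<^bsub>M\<^esub> x = x"
    and l: "A [^] (l::nat) \<odot>\<^bsub>M\<^esub> x \<noteq> \<zero>\<^bsub>M\<^esub>" "\<And>y. y \<in> carrier M \<Longrightarrow> A [^] Suc l \<odot>\<^bsub>M\<^esub> y = \<zero>\<^bsub>M\<^esub>"
  obtains B where "submodule B R M" "{a \<odot>\<^bsub>M\<^esub> x | a. a \<in> carrier R} \<inter> B = {\<zero>\<^bsub>M\<^esub>}"
    "\<And>y. y \<in> carrier M \<Longrightarrow> \<exists>a\<in>carrier R. \<exists>b\<in>B. y = a \<odot>\<^bsub>M\<^esub> x \<oplus>\<^bsub>M\<^esub> b"
proof -
  interpret M: left_module R M by fact
  define X where "X = {a \<odot>\<^bsub>M\<^esub> x | a. a \<in> carrier R}"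
  have X: "submodule X R M" unfolding X_def by (rule M.submodule_cyclic[OF x(1)])
  note X' = M.submoduleD[OF X]
  define \<B> where "\<B> = {B. submodule B R M \<and> X \<inter> B = {\<zero>\<^bsub>M\<^esub>}}"
  have "\<exists>B\<in>\<B>. \<forall>B'\<in>\<B>. B \<subseteq> B' \<longrightarrow> B' = B"
  proof (rule subset_Zorn_nonempty)
    show "\<B> \<noteq> {}" using M.submodule_zero X'(2) by (auto simp: \<B>_def)
  next
    fix \<C> assume ne: "\<C> \<noteq> {}" and ch: "subset.chain \<B> \<C>"
    have sub: "submodule B R M" "X \<inter> B = {\<zero>\<^bsub>M\<^esub>}" if "B \<in> \<C>" for B
      using that ch by (auto simp: subset.chain_def \<B>_def)
    have "submodule (\<Union>\<C>) R M"
      unfolding M.submodule_iff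
    proof (intro conjI ballI)
      show "\<Union>\<C> \<subseteq> carrier M" using sub M.submoduleD(1) by blast
      show "\<zero>\<^bsub>M\<^esub> \<in> \<Union>\<C>" using ne sub M.submoduleD(2) by blast
    next
      fix y z assume "y \<in> \<Union>\<C>" "z \<in> \<Union>\<C>"
      then obtain B B' where B: "B \<in> \<C>" "y \<in> B" "B' \<in> \<C>" "z \<in> B'" by blast
      then consider "B \<subseteq> B'" | "B' \<subseteq> B" using ch by (auto simp: subset.chain_def)
      then show "y \<oplus>\<^bsub>M\<^esub> z \<in> \<Union>\<C>"
      proof cases
        case 1
        then have "y \<in> B'" using B by blast
        then show ?thesis using M.submoduleD(3)[OF sub(1)[OF B(3)]] B by blast
      next
        case 2
        then have "z \<in> B" using B by blast
        then show ?thesis using M.submoduleD(3)[OF sub(1)[OF B(1)]] B by blast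
      qed
    next
      fix a y assume "a \<in> carrier R" "y \<in> \<Union>\<C>"
      then show "a \<odot>\<^bsub>M\<^esub> y \<in> \<Union>\<C>" using sub(1) M.submoduleD(4) by blast
    qed
    moreover have "X \<inter> \<Union>\<C> = {\<zero>\<^bsub>M\<^esub>}" using sub(2) ne by blast
    ultimately show "\<Union>\<C> \<in> \<B>" by (simp add: \<B>_def)
  qed
  then obtain B where B: "submodule B R M" "X \<inter> B = {\<zero>\<^bsub>M\<^esub>}"
    and max: "\<And>B'. \<lbrakk>submodule B' R M; X \<inter> B' = {\<zero>\<^bsub>M\<^esub>}; B \<subseteq> B'\<rbrakk> \<Longrightarrow> B' = B"
    by (auto simp: \<B>_def)
  note B' = M.submoduleD[OF B(1)]
  define D where "D = {y \<oplus>\<^bsub>M\<^esub> z | y z. y \<in> X \<and> z \<in> B}"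
  have D: "submodule D R M" unfolding D_def by (rule M.submodule_sum[OF X B(1)])
  note D' = M.submoduleD[OF D]
  have XD: "y \<in> D" if "y \<in> X" for y
  proof -
    have "y = y \<oplus>\<^bsub>M\<^esub> \<zero>\<^bsub>M\<^esub>" using that X'(1) by (simp add: subset_iff)
    then show ?thesis using that B'(2) unfolding D_def by blast
  qed
  have BD: "y \<in> D" if "y \<in> B" for y
  proof -
    have "y = \<zero>\<^bsub>M\<^esub> \<oplus>\<^bsub>M\<^esub> y" using that B'(1) by (simp add: subset_iff)
    then show ?thesis using that X'(2) unfolding D_def by blast
  qed
  have "D = carrier M"
  proof (rule ccontr)
    assume "D \<noteq> carrier M"
    then obtain y w where y: "y \<in> carrier M" "y \<notin> D" "e w \<odot>\<^bsub>M\<^esub> y = y" "A \<odot>\<^bsub>M\<^esub> y \<in> D"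
      using homogeneous_outside[OF M D] by blast
    obtain a b where ab: "a \<in> carrier R" "b \<in> B" "A \<odot>\<^bsub>M\<^esub> y = a \<odot>\<^bsub>M\<^esub> x \<oplus>\<^bsub>M\<^esub> b"
      using y(4) by (auto simp: D_def X_def)
    have bc: "b \<in> carrier M" using ab B'(1) by blast
    \<comment> \<open>Maximality of the length kills \<open>A [^] l (A y)\<close>. As
      \<open>X\<close> and \<open>B\<close> meet trivially, its part in \<open>X\<close> vanishes
      separately, which forces the scalar part of \<open>a\<close> to be zero: \<open>a x\<close> is
      divisible by \<open>A\<close> within \<open>X\<close>.\<close>
    have "A [^] l \<odot>\<^bsub>M\<^esub> (A \<odot>\<^bsub>M\<^esub> y) = A [^] Suc l \<odot>\<^bsub>M\<^esub> y" using y(1) by (simp add: M.smult_assoc1)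
    also have "\<dots> = \<zero>\<^bsub>M\<^esub>" by (rule l(2)[OF y(1)])
    finally have "A [^] l \<odot>\<^bsub>M\<^esub> (a \<odot>\<^bsub>M\<^esub> x) \<oplus>\<^bsub>M\<^esub> A [^] l \<odot>\<^bsub>M\<^esub> b = \<zero>\<^bsub>M\<^esub>"
      using ab x(1) bc by (simp add: M.smult_r_distr M.smult_closed)
    then have "A [^] l \<odot>\<^bsub>M\<^esub> (a \<odot>\<^bsub>M\<^esub> x) = \<ominus>\<^bsub>M\<^esub> (A [^] l \<odot>\<^bsub>M\<^esub> b)"
      using ab x(1) bc by (simp add: M.smult_closed M.M.minus_equality)
    moreover have "a \<odot>\<^bsub>M\<^esub> x \<in> X" using ab(1) by (auto simp: X_def)
    then have "A [^] l \<odot>\<^bsub>M\<^esub> (a \<odot>\<^bsub>M\<^esub> x) \<in> X" using X'(4) by simp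
    moreover have "\<ominus>\<^bsub>M\<^esub> (A [^] l \<odot>\<^bsub>M\<^esub> b) \<in> B" using B'(4,5) ab by simp
    ultimately have z: "A [^] l \<odot>\<^bsub>M\<^esub> (a \<odot>\<^bsub>M\<^esub> x) = \<zero>\<^bsub>M\<^esub>" using B(2) by auto
    obtain t d where t: "t \<in> T" and d: "d \<in> carrier R"
      and ax: "a \<odot>\<^bsub>M\<^esub> x = t \<odot>\<^bsub>M\<^esub> x \<oplus>\<^bsub>M\<^esub> A \<odot>\<^bsub>M\<^esub> (d \<odot>\<^bsub>M\<^esub> x)"
      by (rule e_split_smult[OF M x ab(1)])
    note [simp] = T_closed[OF t]
    have "A [^] l \<odot>\<^bsub>M\<^esub> (A \<odot>\<^bsub>M\<^esub> (d \<odot>\<^bsub>M\<^esub> x)) = A [^] Suc l \<odot>\<^bsub>M\<^esub> (d \<odot>\<^bsub>M\<^esub> x)"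
      using x(1) d by (simp add: M.smult_assoc1 M.smult_closed)
    also have "\<dots> = \<zero>\<^bsub>M\<^esub>" by (rule l(2)) (use x d M.smult_closed in simp)
    finally have "A [^] l \<odot>\<^bsub>M\<^esub> (t \<odot>\<^bsub>M\<^esub> x) = \<zero>\<^bsub>M\<^esub>"
      using z x(1) d unfolding ax by (simp add: M.smult_r_distr M.smult_closed)
    moreover have "A [^] l \<odot>\<^bsub>M\<^esub> (t \<odot>\<^bsub>M\<^esub> x) = t \<odot>\<^bsub>M\<^esub> (A [^] l \<odot>\<^bsub>M\<^esub> x)"
      using x(1) T_comm[OF t, of "A [^] l"] by (simp flip: M.smult_assoc1)
    ultimately have "t = \<zero>" using T_smult_eq_zero[OF M t, of "A [^] l \<odot>\<^bsub>M\<^esub> x"] l(1) x(1) M.smult_closed by auto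
    then have ax': "a \<odot>\<^bsub>M\<^esub> x = A \<odot>\<^bsub>M\<^esub> (d \<odot>\<^bsub>M\<^esub> x)" using ax x(1) d M.smult_closed by simp
    \<comment> \<open>The correction. Only the component at the vertex \<open>w\<close> of
      \<open>d x\<close> is subtracted, so that \<open>y'\<close> stays homogeneous while
      \<open>A y'\<close> loses its part in \<open>X\<close>.\<close>
    define g where "g = e w \<odot>\<^bsub>M\<^esub> (d \<odot>\<^bsub>M\<^esub> x)"
    have gX: "g \<in> X" unfolding g_def by (rule X'(4)) (use d in \<open>auto simp: X_def\<close>)
    have gc: "g \<in> carrier M" using gX X'(1) by blast
    define y' where "y' = y \<oplus>\<^bsub>M\<^esub> \<ominus>\<^bsub>M\<^esub> g"
    have y'c: "y' \<in> carrier M" using y(1) gc by (simp add: y'_def)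
    have y'D: "y' \<notin> D"
    proof
      assume "y' \<in> D"
      then have "y' \<oplus>\<^bsub>M\<^esub> g \<in> D" using D'(3) XD[OF gX] by blast
      then show False using y(1,2) gc by (simp add: y'_def M.M.a_assoc M.M.l_neg)
    qed
    have "e w \<odot>\<^bsub>M\<^esub> g = (e w \<otimes> e w) \<odot>\<^bsub>M\<^esub> (d \<odot>\<^bsub>M\<^esub> x)"
      using x(1) d by (simp add: g_def M.smult_assoc1 M.smult_closed)
    then have eg: "e w \<odot>\<^bsub>M\<^esub> g = g" by (simp add: e_idem g_def)
    have ey: "e w \<odot>\<^bsub>M\<^esub> y' = y'"
      using y(1,3) gc eg by (simp add: y'_def M.smult_r_distr M.smult_minus)
    have "A \<odot>\<^bsub>M\<^esub> y' = A \<odot>\<^bsub>M\<^esub> (e w \<odot>\<^bsub>M\<^esub> (y \<oplus>\<^bsub>M\<^esub> \<ominus>\<^bsub>M\<^esub> (d \<odot>\<^bsub>M\<^esub> x)))"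
      using y(1,3) x(1) d by (simp add: y'_def g_def M.smult_r_distr M.smult_minus M.smult_closed)
    also have "\<dots> = (A \<otimes> e w) \<odot>\<^bsub>M\<^esub> (y \<oplus>\<^bsub>M\<^esub> \<ominus>\<^bsub>M\<^esub> (d \<odot>\<^bsub>M\<^esub> x))"
      using y(1) x(1) d by (simp add: M.smult_assoc1 M.smult_closed)
    also have "\<dots> = e (Suc w) \<odot>\<^bsub>M\<^esub> (A \<odot>\<^bsub>M\<^esub> (y \<oplus>\<^bsub>M\<^esub> \<ominus>\<^bsub>M\<^esub> (d \<odot>\<^bsub>M\<^esub> x)))"
      unfolding A_e using y(1) x(1) d by (simp add: M.smult_assoc1 M.smult_closed)
    also have "A \<odot>\<^bsub>M\<^esub> (y \<oplus>\<^bsub>M\<^esub> \<ominus>\<^bsub>M\<^esub> (d \<odot>\<^bsub>M\<^esub> x)) = a \<odot>\<^bsub>M\<^esub> x \<oplus>\<^bsub>M\<^esub> b \<oplus>\<^bsub>M\<^esub> \<ominus>\<^bsub>M\<^esub> (a \<odot>\<^bsub>M\<^esub> x)"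
      using y(1) x(1) d by (simp add: M.smult_r_distr M.smult_minus M.smult_closed ab(3) ax')
    also have "\<dots> = b" using ab(1) bc x(1) by (simp add: M.smult_closed M.M.a_comm[of _ b] M.M.a_assoc M.M.r_neg)
    finally have Ay: "A \<odot>\<^bsub>M\<^esub> y' \<in> B" using B'(4) ab(2) by simp
    define Y where "Y = {a \<odot>\<^bsub>M\<^esub> y' | a. a \<in> carrier R}"
    have Y: "submodule Y R M" unfolding Y_def by (rule M.submodule_cyclic[OF y'c])
    define B2 where "B2 = {z \<oplus>\<^bsub>M\<^esub> v | z v. z \<in> Y \<and> v \<in> B}"
    have B2: "submodule B2 R M" unfolding B2_def by (rule M.submodule_sum[OF Y B(1)])
    have y'Y: "y' \<in> Y" using M.smult_one[OF y'c] by (auto simp: Y_def intro!: exI[of _ \<one>])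
    have BB2: "B \<subseteq> B2"
    proof
      fix v assume "v \<in> B"
      moreover from this have "v = \<zero>\<^bsub>M\<^esub> \<oplus>\<^bsub>M\<^esub> v" using B'(1) by (simp add: subset_iff)
      ultimately show "v \<in> B2" using M.submoduleD(2)[OF Y] unfolding B2_def by blast
    qed
    have "y' = y' \<oplus>\<^bsub>M\<^esub> \<zero>\<^bsub>M\<^esub>" using y'c by simp
    then have y'B2: "y' \<in> B2" using y'Y B'(2) unfolding B2_def by blast
    have "z = \<zero>\<^bsub>M\<^esub>" if z: "z \<in> X" "z \<in> B2" for z
    proof -
      \<comment> \<open>\<open>A y'\<close> lies in \<open>B\<close>, so modulo \<open>B\<close> a
        multiple of \<open>y'\<close> is a scalar multiple \<open>s y'\<close>. A nonzero
        \<open>s\<close> could be inverted, putting \<open>y'\<close> into \<open>D\<close>; hence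
        \<open>s = 0\<close> and \<open>z\<close> lies in both \<open>X\<close> and
        \<open>B\<close>.\<close>
      obtain r v where rv: "r \<in> carrier R" "v \<in> B" "z = r \<odot>\<^bsub>M\<^esub> y' \<oplus>\<^bsub>M\<^esub> v" using z(2) by (auto simp: B2_def Y_def)
      obtain s q where s: "s \<in> T" and q: "q \<in> carrier R"
        and sq: "r \<odot>\<^bsub>M\<^esub> y' = s \<odot>\<^bsub>M\<^esub> y' \<oplus>\<^bsub>M\<^esub> A \<odot>\<^bsub>M\<^esub> (q \<odot>\<^bsub>M\<^esub> y')"
        by (rule e_split_smult[OF M y'c ey rv(1)])
      note [simp] = T_closed[OF s]
      obtain q' where q': "q' \<in> carrier R" "A \<otimes> q = q' \<otimes> A" using A_left[OF q] by blast
      have "A \<odot>\<^bsub>M\<^esub> (q \<odot>\<^bsub>M\<^esub> y') = q' \<odot>\<^bsub>M\<^esub> (A \<odot>\<^bsub>M\<^esub> y')"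
        using q q' y'c by (simp flip: M.smult_assoc1)
      then have ry: "r \<odot>\<^bsub>M\<^esub> y' = s \<odot>\<^bsub>M\<^esub> y' \<oplus>\<^bsub>M\<^esub> q' \<odot>\<^bsub>M\<^esub> (A \<odot>\<^bsub>M\<^esub> y')" using sq by simp
      define v' where "v' = q' \<odot>\<^bsub>M\<^esub> (A \<odot>\<^bsub>M\<^esub> y') \<oplus>\<^bsub>M\<^esub> v"
      have v': "v' \<in> B" unfolding v'_def using B'(3,4) Ay q'(1) rv(2) by blast
      have v'c: "v' \<in> carrier M" "v \<in> carrier M" using v' rv(2) B'(1) by auto
      have zs: "z = s \<odot>\<^bsub>M\<^esub> y' \<oplus>\<^bsub>M\<^esub> v'"
        using y'c q'(1) v'c unfolding v'_def rv(3) ry by (simp add: M.smult_closed M.M.a_assoc)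
      have "s = \<zero>"
      proof (rule ccontr)
        assume "s \<noteq> \<zero>"
        then obtain s' where s': "s' \<in> T" "s' \<otimes> s = \<one>" using T_inv[OF s] by blast
        note [simp] = T_closed[OF s'(1)]
        have "z \<oplus>\<^bsub>M\<^esub> \<ominus>\<^bsub>M\<^esub> v' = s \<odot>\<^bsub>M\<^esub> y'"
          using y'c v'c unfolding zs by (simp add: M.smult_closed M.M.a_assoc M.M.r_neg)
        then have "s' \<odot>\<^bsub>M\<^esub> (z \<oplus>\<^bsub>M\<^esub> \<ominus>\<^bsub>M\<^esub> v') = y'"
          using s' y'c by (simp add: M.smult_assoc1[symmetric] M.smult_one)
        moreover have "s' \<odot>\<^bsub>M\<^esub> (z \<oplus>\<^bsub>M\<^esub> \<ominus>\<^bsub>M\<^esub> v') \<in> D"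
          using D'(4)[of s'] D'(3)[OF XD[OF z(1)] D'(5)[OF BD[OF v']]] by simp
        ultimately show False using y'D by simp
      qed
      then have "z = v'" using zs y'c v'c by simp
      then show ?thesis using z(1) v' B(2) by blast
    qed
    then have "X \<inter> B2 = {\<zero>\<^bsub>M\<^esub>}" using X'(2) M.submoduleD(2)[OF B2] by blast
    then have "B2 = B" using max[OF B2 _ BB2] by blast
    then show False using y'B2 BD y'D by blast
  qed
  then show ?thesis
    using that[OF B(1)] B(2) unfolding D_def X_def by blast
qed

end

lemma internal_sum_iso:
  assumes M: "left_module R M" and X: "submodule X R M" and B: "submodule B R M"
    and int: "X \<inter> B = {\<zero>\<^bsub>M\<^esub>}" and sum: "\<And>y. y \<in> carrier M \<Longrightarrow> \<exists>x\<in>X. \<exists>b\<in>B. y = x \<oplus>\<^bsub>M\<^esub> b"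
  shows "lmod_iso R M (lmod_sum (M\<lparr>carrier := X\<rparr>) (M\<lparr>carrier := B\<rparr>))"
proof -
  interpret M: left_module R M by fact
  note X' = M.submoduleD[OF X] and B' = M.submoduleD[OF B]
  let ?S = "lmod_sum (M\<lparr>carrier := X\<rparr>) (M\<lparr>carrier := B\<rparr>)"
  have S: "left_module R ?S" using M.submodule_left_module X B by (intro lmod_sum_left_module)
  define h where "h = (\<lambda>(x, b). x \<oplus>\<^bsub>M\<^esub> b)"
  have h: "h \<in> lmod_hom R ?S M"
    using X'(1) B'(1) by (auto simp: lmod_hom_def h_def subset_iff M.smult_r_distr M.M.add.m_ac)
  have "inj_on h (carrier ?S)"
    unfolding lmod_hom_inj_iff[OF S M h]
  proof (intro ballI impI)
    fix z assume z: "z \<in> carrier ?S" "h z = \<zero>\<^bsub>M\<^esub>"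
    obtain x b where xb: "z = (x, b)" "x \<in> X" "b \<in> B" using z(1) by auto
    then have c: "x \<in> carrier M" "b \<in> carrier M" using X'(1) B'(1) by auto
    have "x \<oplus>\<^bsub>M\<^esub> b = \<zero>\<^bsub>M\<^esub>" using z(2) xb by (simp add: h_def)
    then have "x = \<ominus>\<^bsub>M\<^esub> b" using c by (simp add: M.M.minus_equality)
    then have "x \<in> B" using B'(5)[OF xb(3)] by simp
    then have x0: "x = \<zero>\<^bsub>M\<^esub>" using int xb(2) by blast
    then have "b = \<zero>\<^bsub>M\<^esub>" using \<open>x \<oplus>\<^bsub>M\<^esub> b = \<zero>\<^bsub>M\<^esub>\<close> c by simp
    then show "z = \<zero>\<^bsub>?S\<^esub>" using xb x0 by simp
  qed
  moreover have "h ` carrier ?S = carrier M"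
  proof (intro equalityI subsetI)
    fix y assume "y \<in> h ` carrier ?S"
    then show "y \<in> carrier M" using lmod_hom_closed[OF h] by blast
  next
    fix y assume "y \<in> carrier M"
    then obtain x b where "x \<in> X" "b \<in> B" "y = x \<oplus>\<^bsub>M\<^esub> b" using sum by blast
    then have "(x, b) \<in> carrier ?S" "y = h (x, b)" by (simp_all add: h_def)
    then show "y \<in> h ` carrier ?S" by blast
  qed
  ultimately have "lmod_iso R ?S M" using h by (auto simp: lmod_iso_def bij_betw_def)
  then show ?thesis by (rule lmod_iso_sym[OF S])
qed

context cyclic_shift_ring
begin

text \<open>Induction on the number of homogeneous generators. One of maximal length spans an
  interval and splits off; the projections of the remaining ones generate the complement and are
  again homogeneous, so one generator fewer is needed.\<close>

lemma interval_sum_homogeneous: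
  fixes M :: "'a lmod"
  assumes "finite S" "left_module R M" "S \<subseteq> carrier M" "\<And>x. x \<in> S \<Longrightarrow> \<exists>u. e u \<odot>\<^bsub>M\<^esub> x = x"
    "\<And>U. \<lbrakk>submodule U R M; S \<subseteq> U\<rbrakk> \<Longrightarrow> U = carrier M"
  shows "interval_sum M"
  using assms
proof (induction "card S" arbitrary: S M rule: less_induct)
  case less
  note M = less.prems(2) and S = less.prems(1,3,4) and gen = less.prems(5)
  interpret M: left_module R M by fact
  show ?case
  proof (cases "carrier M = {\<zero>\<^bsub>M\<^esub>}")
    case True
    have "{a \<odot>\<^bsub>M\<^esub> \<zero>\<^bsub>M\<^esub> | a. a \<in> carrier R} = {\<zero>\<^bsub>M\<^esub>}"
    proof (intro equalityI subsetI)
      fix y assume "y \<in> {\<zero>\<^bsub>M\<^esub>}"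
      then have "y = \<zero> \<odot>\<^bsub>M\<^esub> \<zero>\<^bsub>M\<^esub>" by simp
      then show "y \<in> {a \<odot>\<^bsub>M\<^esub> \<zero>\<^bsub>M\<^esub> | a. a \<in> carrier R}" using zero_closed by blast
    qed auto
    then have "interval_gen M 0 0 \<zero>\<^bsub>M\<^esub>" unfolding interval_gen_def using True by simp
    then show ?thesis using M by (auto simp: interval_def intro!: interval_sum_interval)
  next
    case False
    obtain C :: nat where C: "A [^] C = \<zero>" using A_nilpotent by blast
    \<comment> \<open>The nilpotency index of \<open>A\<close> on \<open>M\<close>. It is attained
      at a generator, because the elements killed by a smaller power form a submodule.\<close>
    define k where "k = (LEAST k::nat. \<forall>y\<in>carrier M. A [^] k \<odot>\<^bsub>M\<^esub> y = \<zero>\<^bsub>M\<^esub>)"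
    have "\<forall>y\<in>carrier M. A [^] C \<odot>\<^bsub>M\<^esub> y = \<zero>\<^bsub>M\<^esub>" by (simp add: C)
    then have k: "\<forall>y\<in>carrier M. A [^] k \<odot>\<^bsub>M\<^esub> y = \<zero>\<^bsub>M\<^esub>" unfolding k_def by (rule LeastI)
    have "k \<noteq> 0"
    proof
      assume "k = 0"
      then have "y = \<zero>\<^bsub>M\<^esub>" if "y \<in> carrier M" for y using k that M.smult_one by simp
      then show False using False M.M.zero_closed by blast
    qed
    then obtain l where l: "k = Suc l" by (cases k) auto
    have nl: "\<not> (\<forall>y\<in>carrier M. A [^] l \<odot>\<^bsub>M\<^esub> y = \<zero>\<^bsub>M\<^esub>)"
      using not_less_Least[of l "\<lambda>k. \<forall>y\<in>carrier M. A [^] k \<odot>\<^bsub>M\<^esub> y = \<zero>\<^bsub>M\<^esub>"] l by (simp add: k_def)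
    have "\<exists>s\<in>S. A [^] l \<odot>\<^bsub>M\<^esub> s \<noteq> \<zero>\<^bsub>M\<^esub>"
    proof (rule ccontr)
      assume "\<not> ?thesis"
      then have "S \<subseteq> {y \<in> carrier M. A [^] l \<odot>\<^bsub>M\<^esub> y = \<zero>\<^bsub>M\<^esub>}" using S(2) by blast
      moreover have "submodule {y \<in> carrier M. A [^] l \<odot>\<^bsub>M\<^esub> y = \<zero>\<^bsub>M\<^esub>} R M"
        unfolding M.submodule_iff using pow_smult_zero[OF M] by (auto simp: M.smult_r_distr M.smult_closed)
      ultimately show False using gen nl by blast
    qed
    then obtain x where x: "x \<in> S" "A [^] l \<odot>\<^bsub>M\<^esub> x \<noteq> \<zero>\<^bsub>M\<^esub>" by blast
    have xc: "x \<in> carrier M" using x S(2) by blast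
    obtain u where u: "e u \<odot>\<^bsub>M\<^esub> x = x" using S(3) x(1) by blast
    have kl: "A [^] Suc l \<odot>\<^bsub>M\<^esub> y = \<zero>\<^bsub>M\<^esub>" if "y \<in> carrier M" for y using k that unfolding l by blast
    define X where "X = {a \<odot>\<^bsub>M\<^esub> x | a. a \<in> carrier R}"
    have X: "submodule X R M" unfolding X_def by (rule M.submodule_cyclic[OF xc])
    note X' = M.submoduleD[OF X]
    have xX: "x \<in> X" using M.smult_one[OF xc] by (auto simp: X_def intro!: exI[of _ \<one>])
    obtain B where B: "submodule B R M" "X \<inter> B = {\<zero>\<^bsub>M\<^esub>}"
      and dec: "\<And>y. y \<in> carrier M \<Longrightarrow> \<exists>a\<in>carrier R. \<exists>b\<in>B. y = a \<odot>\<^bsub>M\<^esub> x \<oplus>\<^bsub>M\<^esub> b"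
      by (rule maximal_length_complement[OF M xc u x(2) kl, folded X_def], assumption, rule that; assumption)
    have XB: "\<exists>z\<in>X. \<exists>b\<in>B. y = z \<oplus>\<^bsub>M\<^esub> b" if "y \<in> carrier M" for y
      using dec[OF that] unfolding X_def by blast
    note B' = M.submoduleD[OF B(1)]
    let ?X = "M\<lparr>carrier := X\<rparr>" and ?B = "M\<lparr>carrier := B\<rparr>"
    have lm: "left_module R ?X" "left_module R ?B" using M.submodule_left_module X B by auto
    have "interval_gen ?X u (Suc l) x"
      unfolding interval_gen_def
    proof (intro conjI allI)
      fix m :: nat
      have "A [^] m \<odot>\<^bsub>M\<^esub> x = \<zero>\<^bsub>M\<^esub> \<longleftrightarrow> Suc l \<le> m"
        using pow_smult_mono[OF M xc kl[OF xc]] pow_smult_mono[OF M xc, of m l] x(2) not_less_eq_eq by blast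
      then show "A [^] m \<odot>\<^bsub>?X\<^esub> x = \<zero>\<^bsub>?X\<^esub> \<longleftrightarrow> Suc l \<le> m" by simp
    qed (use xX u in \<open>simp_all add: X_def\<close>)
    then have "interval_sum ?X" using lm(1) by (auto simp: interval_def intro!: interval_sum_interval)
    moreover have "interval_sum ?B"
    proof -
      define \<pi> where "\<pi> = (\<lambda>y. SOME b. b \<in> B \<and> (\<exists>z\<in>X. y = z \<oplus>\<^bsub>M\<^esub> b))"
      have \<pi>: "\<pi> y \<in> B \<and> (\<exists>z\<in>X. y = z \<oplus>\<^bsub>M\<^esub> \<pi> y)" if "y \<in> carrier M" for y
        unfolding \<pi>_def by (rule someI_ex) (use XB[OF that] in blast)
      let ?S = "\<pi> ` (S - {x})"
      have "card ?S < card S"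
        using card_image_le[of "S - {x}" \<pi>] card_Diff1_less[OF S(1) x(1)] S(1) by simp
      moreover have "finite ?S" using S(1) by simp
      moreover have "?S \<subseteq> carrier ?B" using \<pi> S(2) by auto
      moreover have "\<exists>w. e w \<odot>\<^bsub>?B\<^esub> b = b" if bS: "b \<in> ?S" for b
      proof -
        obtain s where s: "s \<in> S" "b = \<pi> s" using bS by blast
        obtain w where w: "e w \<odot>\<^bsub>M\<^esub> s = s" using S(3)[OF s(1)] by blast
        obtain z where z: "z \<in> X" "s = z \<oplus>\<^bsub>M\<^esub> b" and b: "b \<in> B" using \<pi>[of s] s S(2) by blast
        have c: "z \<in> carrier M" "b \<in> carrier M" using z b X'(1) B'(1) by auto
        \<comment> \<open>\<open>e w\<close> reproduces \<open>s\<close> and preserves both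
          summands, so by uniqueness of components it also reproduces the component
          \<open>b\<close>.\<close>
        define z' b' where "z' = e w \<odot>\<^bsub>M\<^esub> z" and "b' = e w \<odot>\<^bsub>M\<^esub> b"
        have z': "z' \<in> X" "b' \<in> B" using X'(4) B'(4) z(1) b by (auto simp: z'_def b'_def)
        have c': "z' \<in> carrier M" "b' \<in> carrier M" using z' X'(1) B'(1) by auto
        have eq: "z' \<oplus>\<^bsub>M\<^esub> b' = z \<oplus>\<^bsub>M\<^esub> b" using w c unfolding z(2) by (simp add: M.smult_r_distr z'_def b'_def)
        have "b' \<oplus>\<^bsub>M\<^esub> \<ominus>\<^bsub>M\<^esub> b = \<ominus>\<^bsub>M\<^esub> z' \<oplus>\<^bsub>M\<^esub> (z' \<oplus>\<^bsub>M\<^esub> b') \<oplus>\<^bsub>M\<^esub> \<ominus>\<^bsub>M\<^esub> b"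
          using c c' by (simp add: M.M.r_neg1)
        also have "\<dots> = \<ominus>\<^bsub>M\<^esub> z' \<oplus>\<^bsub>M\<^esub> z" unfolding eq using c c' by (simp add: M.M.a_assoc M.M.r_neg)
        finally have "b' \<oplus>\<^bsub>M\<^esub> \<ominus>\<^bsub>M\<^esub> b = \<ominus>\<^bsub>M\<^esub> z' \<oplus>\<^bsub>M\<^esub> z" .
        moreover have "\<ominus>\<^bsub>M\<^esub> z' \<oplus>\<^bsub>M\<^esub> z \<in> X" using X'(3,5) z' z by blast
        moreover have "b' \<oplus>\<^bsub>M\<^esub> \<ominus>\<^bsub>M\<^esub> b \<in> B" using B'(3,5) z' b by blast
        ultimately have "b' \<oplus>\<^bsub>M\<^esub> \<ominus>\<^bsub>M\<^esub> b = \<zero>\<^bsub>M\<^esub>" using B(2) by auto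
        then have "b' = b" using c c' by (metis M.M.a_inv_closed M.M.minus_equality M.M.minus_minus)
        then show ?thesis by (auto simp: b'_def)
      qed
      moreover have "U = carrier ?B" if U: "submodule U R ?B" "?S \<subseteq> U" for U
      proof -
        have U1: "submodule U R M" by (rule submodule_trans[OF M B(1) U(1)])
        have UB: "U \<subseteq> B" using left_module.submoduleD(1)[OF lm(2) U(1)] by simp
        \<comment> \<open>To see that the projections generate \<open>B\<close>, enlarge a submodule
          \<open>U\<close> of \<open>B\<close> containing them by \<open>X\<close>: the sum contains
          all of \<open>S\<close>, hence is \<open>M\<close>, and intersecting with \<open>B\<close>
          gives back \<open>U\<close>.\<close>
        define W where "W = {z \<oplus>\<^bsub>M\<^esub> v | z v. z \<in> X \<and> v \<in> U}"
        have W: "submodule W R M" unfolding W_def by (rule M.submodule_sum[OF X U1])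
        have "S \<subseteq> W"
        proof
          fix s assume s: "s \<in> S"
          show "s \<in> W"
          proof (cases "s = x")
            case True
            have "x = x \<oplus>\<^bsub>M\<^esub> \<zero>\<^bsub>M\<^esub>" using xc by simp
            then show ?thesis using True xX M.submoduleD(2)[OF U1] unfolding W_def by blast
          next
            case False
            then have "\<pi> s \<in> U" using s U(2) by blast
            then show ?thesis using \<pi>[of s] s S(2) unfolding W_def by blast
          qed
        qed
        then have Wc: "W = carrier M" using gen[OF W] by blast
        have "b \<in> U" if b: "b \<in> B" for b
        proof -
          have "b \<in> W" using b B'(1) Wc by blast
          then obtain z v where zv: "z \<in> X" "v \<in> U" "b = z \<oplus>\<^bsub>M\<^esub> v" by (auto simp: W_def)
          have c: "z \<in> carrier M" "v \<in> carrier M" using zv X'(1) UB B'(1) by auto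
          have "z = b \<oplus>\<^bsub>M\<^esub> \<ominus>\<^bsub>M\<^esub> v" using c zv(3) by (simp add: M.M.a_assoc M.M.r_neg)
          moreover have "b \<oplus>\<^bsub>M\<^esub> \<ominus>\<^bsub>M\<^esub> v \<in> B" using b zv(2) UB B'(3,5) by blast
          ultimately have "z = \<zero>\<^bsub>M\<^esub>" using zv(1) B(2) by auto
          then show ?thesis using zv c by simp
        qed
        then show ?thesis using UB by auto
      qed
      ultimately show ?thesis using less.hyps[of ?S ?B] lm(2) by blast
    qed
    ultimately show ?thesis
      using internal_sum_iso[OF M X B XB] M by (blast intro: interval_sum_sum)
  qed
qed

lemma fg_interval_sum:
  assumes "M \<in> fg_modules R" shows "interval_sum M"
proof -
  have M: "left_module R M" using assms by (simp add: fg_modules_def)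
  interpret M: left_module R M by fact
  obtain S where S: "finite S" "S \<subseteq> carrier M" "\<And>U. submodule U R M \<Longrightarrow> S \<subseteq> U \<Longrightarrow> U = carrier M"
    using assms by (auto simp: fg_modules_def fin_gen_def)
  let ?S = "(\<lambda>(i, s). e i \<odot>\<^bsub>M\<^esub> s) ` ({..<N} \<times> S)"
  show ?thesis
  proof (rule interval_sum_homogeneous[OF _ M])
    show "finite ?S" using S(1) by simp
    show "?S \<subseteq> carrier M" using S(2) M.smult_closed by auto
    show "\<exists>u. e u \<odot>\<^bsub>M\<^esub> x = x" if "x \<in> ?S" for x
    proof -
      obtain i s where "x = e i \<odot>\<^bsub>M\<^esub> s" "s \<in> carrier M" using \<open>x \<in> ?S\<close> S(2) by auto
      then have "e i \<odot>\<^bsub>M\<^esub> x = x" using e_idem by (simp flip: M.smult_assoc1)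
      then show ?thesis by blast
    qed
    fix U assume U: "submodule U R M" "?S \<subseteq> U"
    note U' = M.submoduleD[OF U(1)]
    have "s \<in> U" if s: "s \<in> S" for s
    proof -
      have sc: "s \<in> carrier M" using s S(2) by blast
      have "n \<le> N \<Longrightarrow> (\<Oplus>i\<in>{..<n}. e i) \<odot>\<^bsub>M\<^esub> s \<in> U" for n
      proof (induction n)
        case 0
        then show ?case using U'(2) sc by simp
      next
        case (Suc n)
        then have "(n, s) \<in> {..<N} \<times> S" using s by simp
        then have "e n \<odot>\<^bsub>M\<^esub> s \<in> U" using U(2) by (auto dest: image_subset_iff[THEN iffD1])
        then show ?case using Suc sc U'(3) by (simp add: lessThan_Suc M.smult_l_distr)
      qed
      from this[of N] show ?thesis using sc by (simp add: e_sum M.smult_one)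
    qed
    then show "U = carrier M" using S(3)[OF U(1)] by blast
  qed
qed

lemma interval_sum_cover:
  "interval_sum M \<Longrightarrow> \<exists>P p. P \<in> fg_modules R \<and> projective R P \<and> p \<in> lmod_epi R P M \<and>
    carrier (lmod_ker P M p) \<subseteq> {A \<odot>\<^bsub>P\<^esub> y | y. y \<in> carrier P} \<and> fin_gen R (lmod_ker P M p)"
proof (induction rule: interval_sum.induct)
  case (interval_sum_interval M u l)
  have M: "left_module R M" using interval_sum_interval by (simp add: interval_def)
  then interpret M: left_module R M .
  show ?case
  proof (cases "l = 0")
    case True
    \<comment> \<open>Length 0: the zero module covers itself. The projective at \<open>u\<close>
      would have itself as kernel here.\<close>
    obtain x where x: "interval_gen M u l x" using interval_sum_interval by (auto simp: interval_def)
    have "A [^] (0::nat) \<odot>\<^bsub>M\<^esub> x = \<zero>\<^bsub>M\<^esub>" "x \<in> carrier M" using x True unfolding interval_gen_def by blast+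
    then have "x = \<zero>\<^bsub>M\<^esub>" using M.smult_one by simp
    then have z: "carrier M = {\<zero>\<^bsub>M\<^esub>}" using x by (auto simp: interval_gen_def)
    have ker: "lmod_ker M M id = M\<lparr>carrier := {\<zero>\<^bsub>M\<^esub>}\<rparr>" using z by (auto simp: lmod_ker_def)
    have "fin_gen R (lmod_ker M M id)" by (rule zero_submodule_fg(2)[OF M ker])
    moreover have "carrier (lmod_ker M M id) \<subseteq> {A \<odot>\<^bsub>M\<^esub> y | y. y \<in> carrier M}"
      unfolding ker by (auto intro!: exI[of _ "\<zero>\<^bsub>M\<^esub>"])
    moreover have "id \<in> lmod_epi R M M" using lmod_hom_id by (auto simp: lmod_epi_def)
    ultimately show ?thesis
      using projective_zero[OF M z] interval_in_fg[OF interval_sum_interval] by blast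
  next
    case False
    obtain P :: "'a lmod" where P: "interval P u (c u)" using interval_exists by blast
    obtain p where p: "p \<in> lmod_epi R P M" "interval (lmod_ker P M p) (u + l) (c u - l)"
      "carrier (lmod_ker P M p) \<subseteq> {A \<odot>\<^bsub>P\<^esub> y | y. y \<in> carrier P}"
      by (rule interval_presentation[OF interval_sum_interval P], rule that) (use False in \<open>assumption | simp\<close>)+
    then show ?thesis
      using interval_in_fg[OF P] interval_projective[OF P] interval_fg[OF p(2)] by blast
  qed
next
  case (interval_sum_sum M1 M2 M)
  note sums = interval_sum_sum.hyps
  obtain P p where
    P: "P \<in> fg_modules R" "projective R P" "p \<in> lmod_epi R P M1"
      "carrier (lmod_ker P M1 p) \<subseteq> {A \<odot>\<^bsub>P\<^esub> y | y. y \<in> carrier P}" "fin_gen R (lmod_ker P M1 p)"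
    using interval_sum_sum.IH(1) by (elim exE conjE) (rule that)
  obtain Q q where
    Q: "Q \<in> fg_modules R" "projective R Q" "q \<in> lmod_epi R Q M2"
      "carrier (lmod_ker Q M2 q) \<subseteq> {A \<odot>\<^bsub>Q\<^esub> y | y. y \<in> carrier Q}" "fin_gen R (lmod_ker Q M2 q)"
    using interval_sum_sum.IH(2) by (elim exE conjE) (rule that)
  have lm: "left_module R M1" "left_module R M2" "left_module R M" "left_module R P" "left_module R Q"
    using interval_sum_fg[OF sums(1)] interval_sum_fg[OF sums(2)] sums(3)
      P(1) Q(1) by (auto simp: fg_modules_def)
  interpret P: left_module R P by fact
  interpret Q: left_module R Q by fact
  obtain D f h where D: "D \<in> fg_modules R" "projective R D" "f \<in> lmod_epi R D M"
    and h: "h \<in> lmod_hom R D (lmod_sum P Q)" "bij_betw h (carrier D) (carrier (lmod_sum P Q))"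
    and f: "\<And>x. x \<in> carrier D \<Longrightarrow> f x = \<zero>\<^bsub>M\<^esub> \<longleftrightarrow> p (fst (h x)) = \<zero>\<^bsub>M1\<^esub> \<and> q (snd (h x)) = \<zero>\<^bsub>M2\<^esub>"
    and iso: "lmod_iso R (lmod_ker D M f) (lmod_sum (lmod_ker P M1 p) (lmod_ker Q M2 q))"
    by (rule presentation_sum[OF lm(1-3) sums(4) P(1-3) Q(1-3) zero_neq_one], rule that; assumption)
  have lmD: "left_module R D" using D(1) by (simp add: fg_modules_def)
  interpret D: left_module R D by fact
  have lmK: "left_module R (lmod_ker P M1 p)" "left_module R (lmod_ker Q M2 q)" "left_module R (lmod_ker D M f)"
    using lmod_ker_left_module[OF lm(4,1)] lmod_ker_left_module[OF lm(5,2)] lmod_ker_left_module[OF lmD lm(3)]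
      P(3) Q(3) D(3) by (auto simp: lmod_epi_def)
  have "carrier (lmod_ker D M f) \<subseteq> {A \<odot>\<^bsub>D\<^esub> y | y. y \<in> carrier D}"
  proof
    fix x assume "x \<in> carrier (lmod_ker D M f)"
    then have x: "x \<in> carrier D" "f x = \<zero>\<^bsub>M\<^esub>" by (auto simp: lmod_ker_def)
    obtain x1 x2 where hx: "h x = (x1, x2)" by fastforce
    have hc: "x1 \<in> carrier P" "x2 \<in> carrier Q" using lmod_hom_closed[OF h(1) x(1)] hx by auto
    then have "x1 \<in> carrier (lmod_ker P M1 p)" "x2 \<in> carrier (lmod_ker Q M2 q)"
      using f[OF x(1)] x(2) hx by (auto simp: lmod_ker_def)
    then obtain y1 y2 where y: "y1 \<in> carrier P" "x1 = A \<odot>\<^bsub>P\<^esub> y1" "y2 \<in> carrier Q" "x2 = A \<odot>\<^bsub>Q\<^esub> y2"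
      using P(4) Q(4) by blast
    have "(y1, y2) \<in> h ` carrier D" using h(2) y by (simp add: bij_betw_def)
    then obtain y' where y': "y' \<in> carrier D" "h y' = (y1, y2)" by auto
    have "h (A \<odot>\<^bsub>D\<^esub> y') = h x" using lmod_hom_smult[OF h(1) A_closed y'(1)] y' y hx by simp
    then have "A \<odot>\<^bsub>D\<^esub> y' = x" using h(2) x(1) y'(1) D.smult_closed by (auto simp: bij_betw_def dest: inj_onD)
    then show "x \<in> {A \<odot>\<^bsub>D\<^esub> y | y. y \<in> carrier D}" using y'(1) by auto
  qed
  moreover have "fin_gen R (lmod_ker D M f)"
    using fin_gen_iso[OF lmod_sum_left_module[OF lmK(1,2)] lmK(3) lmod_iso_sym[OF lmK(3) iso]
        fin_gen_sum[OF lmK(1,2) P(5) Q(5)]] .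
  ultimately show ?case using D by (intro exI[of _ D] exI[of _ f] conjI)
qed

sublocale ring_with_covers R
proof
  show "\<zero> \<noteq> \<one>" by (rule zero_neq_one)
  fix M :: "'a lmod" assume "M \<in> fg_modules R"
  from interval_sum_cover[OF fg_interval_sum[OF this]] obtain P p where
    P: "P \<in> fg_modules R" "projective R P" "p \<in> lmod_epi R P M"
    "carrier (lmod_ker P M p) \<subseteq> {A \<odot>\<^bsub>P\<^esub> y | y. y \<in> carrier P}" "fin_gen R (lmod_ker P M p)" by blast
  have "left_module R P" using P(1) by (simp add: fg_modules_def)
  then have "superfluous R P (carrier (lmod_ker P M p))" using superfluous_image_A P(4) by blast
  then show "\<exists>P p. projective_cover R M P p \<and> fin_gen R (lmod_ker P M p)"
    using P by (auto simp: projective_cover_def)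
qed

end

section \<open>Iterates of a monotone map commuting with a translation\<close>

lemma funpow_shift:
  fixes f :: "nat \<Rightarrow> nat"
  assumes "\<And>u. f (u + N) = f u + N"
  shows "(f ^^ n) (u + k * N) = (f ^^ n) u + k * N"
proof -
  have 1: "f (u + k * N) = f u + k * N" for u k
  proof (induction k)
    case (Suc k)
    have "f (u + Suc k * N) = f ((u + k * N) + N)" by (simp add: algebra_simps)
    then show ?case using assms Suc by simp
  qed simp
  show ?thesis by (induction n) (simp_all add: 1)
qed

text \<open>Modulo \<open>N\<close>, the map \<open>f\<close> loses at least one value in each step until it becomes a
  permutation of its image, and monotonicity forces all points of that image to rotate
  by the same amount.\<close>

lemma monotone_shift_eventually_periodic:
  fixes f :: "nat \<Rightarrow> nat"
  assumes N: "0 < N" and mono: "mono f" and shift: "\<And>u. f (u + N) = f u + N" and ge: "\<And>u. u \<le> f u"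
    and card: "card ((\<lambda>u. f u mod N) ` UNIV) \<le> r"
  obtains n m where "0 < n" "\<And>u. (f ^^ (r + n)) u = (f ^^ r) u + m * N"
proof -
  define g where "g = (\<lambda>x. f x mod N)"
  have sh: "(f ^^ n) (u + k * N) = (f ^^ n) u + k * N" for n u k
    by (rule funpow_shift[of f, OF shift])
  have gN: "g x < N" for x using N by (simp add: g_def)
  have g_mod: "g (x mod N) = g x" for x
  proof -
    have "f x = f (x mod N + x div N * N)" by (simp add: mod_div_mult_eq)
    then show ?thesis using sh[of 1 "x mod N" "x div N"] by (simp add: g_def)
  qed
  have gf: "(g ^^ t) (x mod N) = (f ^^ t) x mod N" for t x
  proof (induction t)
    case (Suc t)
    have "(g ^^ Suc t) (x mod N) = g ((f ^^ t) x mod N)" using Suc by simp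
    then show ?case using g_mod by (simp add: g_def)
  qed simp
  define E where "E = (\<lambda>t. (g ^^ t) ` {..<N})"
  have E_Suc: "E (Suc t) = g ` E t" for t by (simp add: E_def image_comp)
  have E_fin: "finite (E t)" "E t \<noteq> {}" for t using N by (auto simp: E_def)
  have E_dec: "E (Suc t) \<subseteq> E t" for t
  proof (induction t)
    case 0
    then show ?case using gN by (auto simp: E_def)
  next
    case (Suc t)
    then show ?case unfolding E_Suc[of "Suc t"] E_Suc[of t] by (metis E_Suc image_mono)
  qed
  \<comment> \<open>Until the images stabilise, each step loses at least one residue, starting from
    at most \<open>r\<close> after the first step. At \<open>t = r\<close> the second alternative
    would leave the empty set.\<close>
  have "E (Suc t) = E t \<or> card (E (Suc t)) + t \<le> r" for t
  proof (induction t)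
    case 0
    have "E (Suc 0) \<subseteq> (\<lambda>u. f u mod N) ` UNIV" by (auto simp: E_def g_def)
    moreover have "finite ((\<lambda>u. f u mod N) ` UNIV)" by (rule finite_subset[of _ "{..<N}"]) (use N in auto)
    ultimately have "card (E (Suc 0)) \<le> card ((\<lambda>u. f u mod N) ` UNIV)" by (rule card_mono[rotated])
    then show ?case using card by simp
  next
    case (Suc t)
    show ?case
    proof (cases "E (Suc (Suc t)) = E (Suc t)")
      case False
      then have ne: "E (Suc t) \<noteq> E t" using E_Suc by metis
      have "E (Suc (Suc t)) \<subset> E (Suc t)" using E_dec False by blast
      then have "card (E (Suc (Suc t))) < card (E (Suc t))" using E_fin(1) psubset_card_mono by blast
      then show ?thesis using Suc ne by linarith
    qed simp
  qed
  from this[of r] have Er: "g ` E r = E r"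
  proof
    assume "card (E (Suc r)) + r \<le> r"
    then have "card (E (Suc r)) = 0" by simp
    then show ?thesis using E_fin by (metis card_eq_0_iff)
  qed (simp add: E_Suc)
  have injE: "inj_on g (E r)" using Er E_fin(1) by (metis eq_card_imp_inj_on)
  have gE: "(g ^^ t) x \<in> E r" if "x \<in> E r" for t x
    using that Er by (induction t) auto
  have inj_t: "inj_on (g ^^ t) (E r)" for t
  proof (induction t)
    case (Suc t)
    have "(g ^^ t) ` E r \<subseteq> E r" using gE by blast
    then have "inj_on g ((g ^^ t) ` E r)" using injE inj_on_subset by blast
    then show ?case unfolding funpow.simps by (rule comp_inj_on[OF Suc])
  qed simp
  \<comment> \<open>Infinitely many powers of \<open>g\<close> act on a finite set, so two of them
    agree there. As \<open>g\<close> is injective on it, the smaller power cancels and some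
    \<open>g ^^ n\<close> is the identity.\<close>
  have "\<not> inj (\<lambda>t. restrict (g ^^ t) (E r))"
  proof
    assume "inj (\<lambda>t. restrict (g ^^ t) (E r))"
    moreover have "range (\<lambda>t. restrict (g ^^ t) (E r)) \<subseteq> E r \<rightarrow>\<^sub>E E r" using gE by auto
    moreover have "finite (E r \<rightarrow>\<^sub>E E r)" using E_fin by (simp add: finite_PiE)
    ultimately show False using infinite_UNIV_nat by (meson finite_imageD finite_subset)
  qed
  then obtain s t where st: "s < t" "restrict (g ^^ s) (E r) = restrict (g ^^ t) (E r)"
    unfolding inj_def by (metis nat_neq_iff)
  define n where "n = t - s"
  have n: "0 < n" "t = s + n" using st(1) by (simp_all add: n_def)
  have gn: "(g ^^ n) x = x" if "x \<in> E r" for x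
  proof -
    have "(g ^^ s) x = (g ^^ s) ((g ^^ n) x)" using fun_cong[OF st(2), of x] that by (simp add: n(2) funpow_add)
    then show ?thesis using inj_onD[OF inj_t[of s]] that gE by metis
  qed
  define F where "F = f ^^ n"
  have F_mono: "mono F" unfolding F_def using mono by (rule mono_pow)
  have F_sh: "F (u + k * N) = F u + k * N" for u k unfolding F_def by (rule sh)
  have F_ge: "y \<le> F y" for y
  proof -
    have "y \<le> (f ^^ j) y" for j using ge by (induction j) (auto intro: order_trans)
    then show ?thesis by (simp add: F_def)
  qed
  have F_eq: "\<exists>k. F ((f ^^ r) u) = (f ^^ r) u + k * N" for u
  proof -
    have "(f ^^ r) u mod N \<in> E r" using gf[of r u, symmetric] N by (auto simp: E_def)
    then have "F ((f ^^ r) u) mod N = (f ^^ r) u mod N" using gn gf[of n "(f ^^ r) u"] by (simp add: F_def)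
    then have "N dvd F ((f ^^ r) u) - (f ^^ r) u" using F_ge mod_eq_dvd_iff_nat by metis
    then obtain k where "F ((f ^^ r) u) - (f ^^ r) u = N * k" by blast
    then have "F ((f ^^ r) u) = (f ^^ r) u + k * N" using F_ge[of "(f ^^ r) u"] by (simp add: mult.commute)
    then show ?thesis by blast
  qed
  define y0 where "y0 = (f ^^ r) 0"
  obtain m where m: "F y0 = y0 + m * N" using F_eq[of 0] by (auto simp: y0_def)
  show ?thesis
  proof (rule that[OF n(1)])
    fix u
    define y where "y = (f ^^ r) u"
    obtain k where k: "F y = y + k * N" using F_eq[of u] by (auto simp: y_def)
    have "y0 \<le> y" unfolding y0_def y_def using mono_pow[OF mono] by (simp add: monoD)
    \<comment> \<open>The number of full turns from the reference point \<open>y0\<close> to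
      \<open>y\<close>; thus \<open>y\<close> is caught between two translates of \<open>y0\<close>,
      on both of which the advance of \<open>F\<close> is known to be \<open>m * N\<close>.\<close>
    define q where "q = (y - y0) div N"
    have q: "y0 + q * N \<le> y" "y < y0 + Suc q * N"
    proof -
      have "y - y0 = q * N + (y - y0) mod N" by (simp add: q_def)
      moreover have "(y - y0) mod N < N" using N by simp
      ultimately show "y0 + q * N \<le> y" "y < y0 + Suc q * N" using \<open>y0 \<le> y\<close> by auto
    qed
    \<comment> \<open>By monotonicity the advance at \<open>y\<close> differs from the advance at
      the two translates by less than one full turn; both being multiples of \<open>N\<close>, they
      are equal.\<close>
    have "k = m"
    proof (cases "y = y0 + q * N")
      case True
      then have "F y = y + m * N" using F_sh[of y0 q] m by simp
      then show ?thesis using k N by simp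
    next
      case False
      have "y0 + m * N + q * N \<le> y + k * N" using monoD[OF F_mono q(1)] F_sh[of y0 q] m k by simp
      then have "m * N < Suc k * N" using q(2) by simp
      then have 1: "m \<le> k" by (simp only: mult_less_cancel2) auto
      have "y + k * N \<le> y0 + m * N + Suc q * N"
        using monoD[OF F_mono less_imp_le[OF q(2)]] F_sh[of y0 "Suc q"] m k by simp
      then have "k * N < Suc m * N" using q(1) False by simp
      then have 2: "k \<le> m" by (simp only: mult_less_cancel2) auto
      show ?thesis using 1 2 by simp
    qed
    then show "(f ^^ (r + n)) u = (f ^^ r) u + m * N"
      using k by (simp add: y_def F_def add.commute[of r n] funpow_add)
  qed
qed

section \<open>The upper bound for the phi-dimension\<close>

context cyclic_shift_ring
begin

definition f :: "nat \<Rightarrow> nat"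
  where "f u = u + c u"

lemma f_mono: "mono f"
  unfolding mono_iff_le_Suc f_def using c_Suc by (simp add: le_SucI)

lemma f_shift: "f (u + N) = f u + N"
  using c_mod[of "u + N" u] by (simp add: f_def)

lemma f_ge: "u \<le> f u"
  by (simp add: f_def)

lemma K0_class_interval:
  fixes M M' :: "'a lmod"
  assumes "interval M u l" "interval M' u' l" "u mod N = u' mod N"
  shows "K0_class R M = K0_class R M'"
  using K0_class_iso[OF interval_in_fg[OF assms(1)] interval_in_fg[OF assms(2)] interval_iso[OF assms]] .

lemma K0_L_interval:
  fixes M :: "'a lmod"
  assumes M: "interval M u (v - u)" and uv: "u \<le> v"
  obtains K :: "'a lmod" where "interval K v (f u - v)" "K0_L R (K0_class R M) = K0_class R K" "v \<le> f u"
proof -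
  have le: "v \<le> f u" using interval_length_le[OF M] uv by (simp add: f_def)
  obtain P :: "'a lmod" where P: "interval P u (c u)" using interval_exists by blast
  obtain p where p: "p \<in> lmod_epi R P M" "interval (lmod_ker P M p) (u + (v - u)) (c u - (v - u))"
    using interval_presentation[OF M P] by metis
  have "interval (lmod_ker P M p) v (f u - v)" using p(2) uv by (simp add: f_def add.commute)
  then show ?thesis
    using that le K0_L_class(2)[OF interval_in_fg[OF M] interval_in_fg[OF P] interval_projective[OF P] p(1)] by blast
qed

lemma K0_L_pow_interval:
  fixes M :: "'a lmod"
  assumes M: "interval M u (v - u)" and uv: "u \<le> v"
  shows "\<exists>K :: 'a lmod. interval K ((f ^^ t) u) ((f ^^ t) v - (f ^^ t) u) \<and>
    (K0_L R ^^ (2 * t)) (K0_class R M) = K0_class R K \<and> (f ^^ t) u \<le> (f ^^ t) v"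
proof (induction t)
  case 0
  then show ?case using M uv by auto
next
  case (Suc t)
  then obtain K :: "'a lmod" where K: "interval K ((f ^^ t) u) ((f ^^ t) v - (f ^^ t) u)"
    "(K0_L R ^^ (2 * t)) (K0_class R M) = K0_class R K" "(f ^^ t) u \<le> (f ^^ t) v" by blast
  obtain K1 :: "'a lmod" where K1: "interval K1 ((f ^^ t) v) (f ((f ^^ t) u) - (f ^^ t) v)"
    "K0_L R (K0_class R K) = K0_class R K1" "(f ^^ t) v \<le> f ((f ^^ t) u)"
    using K0_L_interval[OF K(1,3)] by blast
  obtain K2 :: "'a lmod" where K2: "interval K2 (f ((f ^^ t) u)) (f ((f ^^ t) v) - f ((f ^^ t) u))"
    "K0_L R (K0_class R K1) = K0_class R K2" "f ((f ^^ t) u) \<le> f ((f ^^ t) v)"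
    using K0_L_interval[OF K1(1,3)] by blast
  show ?case using K(2) K1(2) K2 by (intro exI[of _ K2]) simp
qed

text \<open>Interval classes generate \<open>K0\<close>, since every finitely generated module is an
  \<open>interval_sum\<close> and classes are additive. Periodicity of the syzygy operator therefore
  has to be verified on intervals only.\<close>

lemma K0_hom_ext_interval:
  assumes H: "comm_group H" and g: "g \<in> hom (K0 R) H" and h: "h \<in> hom (K0 R) H"
    and eq: "\<And>(M :: 'a lmod) u l. interval M u l \<Longrightarrow> g (K0_class R M) = h (K0_class R M)"
    and x: "x \<in> carrier (K0 R)"
  shows "g x = h x"
proof (rule K0_hom_ext[OF _ g h _ x])
  show "group H" using H by (simp add: comm_group_def)
  fix M :: "'a lmod" assume "M \<in> fg_modules R"
  then have "interval_sum M" by (rule fg_interval_sum)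
  then show "g (K0_class R M) = h (K0_class R M)"
  proof (induction rule: interval_sum.induct)
    case (interval_sum_interval M u l)
    then show ?case by (rule eq)
  next
    case (interval_sum_sum M1 M2 M)
    have fg: "M1 \<in> fg_modules R" "M2 \<in> fg_modules R" "M \<in> fg_modules R"
      using interval_sum_fg interval_sum_sum interval_sum.interval_sum_sum by blast+
    show ?case
      unfolding K0_class_sum[OF fg interval_sum_sum(4)]
      using hom_mult[OF g K0_class_closed[OF fg(1)] K0_class_closed[OF fg(2)]]
        hom_mult[OF h K0_class_closed[OF fg(1)] K0_class_closed[OF fg(2)]] interval_sum_sum by simp
  qed
qed

theorem phi_dim_le:
  assumes "card ((\<lambda>u. f u mod N) ` UNIV) \<le> r"
  shows "phi_dim R \<le> enat (2 * r)"
proof -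
  obtain n m where n: "0 < n" and per: "\<And>u. (f ^^ (r + n)) u = (f ^^ r) u + m * N"
    using monotone_shift_eventually_periodic[OF N_pos f_mono f_shift f_ge assms] by blast
  let ?L = "K0_L R"
  have periodic: "(?L ^^ (2 * (r + n))) x = (?L ^^ (2 * r)) x" if "x \<in> carrier (K0 R)" for x
  proof (rule K0_hom_ext_interval[OF comm_group_K0 K0_L_pow_hom K0_L_pow_hom _ that])
    fix M :: "'a lmod" and u l assume M: "interval M u l"
    then have M': "interval M u ((u + l) - u)" "u \<le> u + l" by auto
    obtain K :: "'a lmod" where K: "interval K ((f ^^ r) u) ((f ^^ r) (u + l) - (f ^^ r) u)"
      "(?L ^^ (2 * r)) (K0_class R M) = K0_class R K"
      using K0_L_pow_interval[OF M', of r] by blast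
    obtain K' :: "'a lmod" where K': "interval K' ((f ^^ (r + n)) u) ((f ^^ (r + n)) (u + l) - (f ^^ (r + n)) u)"
      "(?L ^^ (2 * (r + n))) (K0_class R M) = K0_class R K'"
      using K0_L_pow_interval[OF M', of "r + n"] by blast
    have "interval K' ((f ^^ r) u + m * N) ((f ^^ r) (u + l) - (f ^^ r) u)"
      using K'(1) unfolding per by simp
    then show "(?L ^^ (2 * (r + n))) (K0_class R M) = (?L ^^ (2 * r)) (K0_class R M)"
      unfolding K(2) K'(2) by (rule K0_class_interval[OF _ K(1)]) simp
  qed
  \<comment> \<open>Periodicity exhibits an inverse: on the image of the power \<open>2 * r\<close>,
    the power \<open>2 * n - 1\<close> undoes one application of \<open>?L\<close>. Here
    \<open>n > 0\<close> makes the exponent meaningful.\<close>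
  have "inj_on ?L ((?L ^^ (2 * r)) ` carrier (K0 R))"
  proof (rule inj_on_inverseI)
    fix y assume "y \<in> (?L ^^ (2 * r)) ` carrier (K0 R)"
    then obtain x where x: "x \<in> carrier (K0 R)" "y = (?L ^^ (2 * r)) x" by blast
    have "2 * (r + n) = Suc (2 * n - 1) + 2 * r" using n by simp
    then have "(?L ^^ (2 * (r + n))) x = (?L ^^ Suc (2 * n - 1)) y" unfolding x(2) by (simp only: funpow_add comp_apply)
    also have "\<dots> = (?L ^^ (2 * n - 1)) (?L y)" by (simp only: funpow_Suc_right comp_apply)
    finally show "(?L ^^ (2 * n - 1)) (?L y) = y" using periodic[OF x(1)] x(2) by simp
  qed
  then show ?thesis unfolding phi_dim_def by (intro SUP_least) (simp add: phi_le)
qed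

end

section \<open>Projective summands and split epimorphisms\<close>

lemma projective_summand:
  fixes M A B :: "'a lmod"
  assumes M: "projective R M" and A: "left_module R A" and B: "left_module R B"
    and iso: "lmod_iso R M (lmod_sum A B)"
  shows "projective R A"
  unfolding projective_def
proof (intro conjI allI impI A; (elim conjE)?)
  fix X Y :: "'a lmod" and g f
  assume XY: "left_module R X" "left_module R Y" "g \<in> lmod_epi R X Y" "f \<in> lmod_hom R A Y"
  have lmM: "left_module R M" using M by (rule projective_left_module)
  obtain h where h: "h \<in> lmod_hom R M (lmod_sum A B)" "bij_betw h (carrier M) (carrier (lmod_sum A B))"
    using iso by (auto simp: lmod_iso_def)
  let ?k = "inv_into (carrier M) h"
  have k: "?k \<in> lmod_hom R (lmod_sum A B) M" by (rule lmod_hom_inv_into[OF lmM h])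
  have fst: "fst \<in> lmod_hom R (lmod_sum A B) A" using lmod_fst_epi[OF B, of A] unfolding lmod_epi_def by blast
  have F: "f \<circ> (fst \<circ> h) \<in> lmod_hom R M Y"
    by (rule lmod_hom_comp[OF lmod_hom_comp[OF h(1) fst] XY(4)])
  obtain j where j: "j \<in> lmod_hom R M X" "\<And>p. p \<in> carrier M \<Longrightarrow> g (j p) = (f \<circ> (fst \<circ> h)) p"
    by (rule projectiveD[OF M XY(1-3) F], rule that; assumption)
  let ?i = "\<lambda>a. (a, \<zero>\<^bsub>B\<^esub>)"
  have i: "?i \<in> lmod_hom R A (lmod_sum A B)" by (rule lmod_inl_hom[OF A B])
  have "j \<circ> (?k \<circ> ?i) \<in> lmod_hom R A X" by (rule lmod_hom_comp[OF lmod_hom_comp[OF i k] j(1)])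
  moreover have "g ((j \<circ> (?k \<circ> ?i)) a) = f a" if "a \<in> carrier A" for a
    using j(2)[OF lmod_hom_closed[OF k lmod_hom_closed[OF i that]]]
      bij_betw_inv_into_right[OF h(2) lmod_hom_closed[OF i that]] by simp
  ultimately show "\<exists>f'\<in>lmod_hom R A X. \<forall>p\<in>carrier A. g (f' p) = f p" by blast
qed

text \<open>Schanuel's lemma applied to \<open>p\<close> and to the identity of \<open>M\<close>,
  whose kernel is zero.\<close>

lemma projective_epi_split:
  fixes P M :: "'a lmod"
  assumes P: "projective R P" and M: "projective R M" and p: "p \<in> lmod_epi R P M"
  shows "lmod_iso R P (lmod_sum (lmod_ker P M p) M)"
proof -
  have lm: "left_module R P" "left_module R M" using P M projective_left_module by auto
  have pk: "left_module R (lmod_ker P M p)" using lmod_ker_left_module[OF lm] p by (simp add: lmod_epi_def)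
  have id: "id \<in> lmod_epi R M M" using lmod_hom_id by (auto simp: lmod_epi_def)
  let ?Z = "lmod_ker M M id"
  have Z: "left_module R ?Z" using lmod_ker_left_module[OF lm(2,2) lmod_hom_id] .
  have Z0: "carrier ?Z = {\<zero>\<^bsub>?Z\<^esub>}"
    using left_module.submoduleD(2)[OF lm(2) left_module.submodule_carrier[OF lm(2)]] by (auto simp: lmod_ker_def)
  have "lmod_iso R (lmod_sum (lmod_ker P M p) M) (lmod_sum ?Z P)"
    by (rule schanuel[OF P M lm(2) p id])
  moreover have "lmod_iso R (lmod_sum ?Z P) P"
  proof -
    have "snd \<in> lmod_hom R (lmod_sum ?Z P) P" using lmod_snd_epi[OF Z, of P] unfolding lmod_epi_def by blast
    moreover have "bij_betw snd (carrier (lmod_sum ?Z P)) (carrier P)"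
      by (rule bij_betw_byWitness[where f' = "\<lambda>m. (\<zero>\<^bsub>?Z\<^esub>, m)"]) (auto simp: Z0)
    ultimately show ?thesis by (auto simp: lmod_iso_def)
  qed
  ultimately show ?thesis
    using lmod_iso_trans lmod_iso_sym[OF lmod_sum_left_module[OF pk lm(2)]] by blast
qed

context cyclic_shift_ring
begin

subsection \<open>The multiplicity of an interval as a direct summand\<close>

text \<open>The multiplicity of the interval module of length \<open>k + 1\<close> with top \<open>v\<close> in \<open>M\<close> is the dimension
  of the quotient of \<open>top_part\<close> by \<open>low_part\<close>; it is measured by chains of intermediate subspaces.\<close>

definition top_part :: "nat \<Rightarrow> nat \<Rightarrow> ('a, 'm) module \<Rightarrow> 'm set"
  where "top_part v k M = {x \<in> carrier M. e v \<odot>\<^bsub>M\<^esub> x = x \<and> A [^] Suc k \<odot>\<^bsub>M\<^esub> x = \<zero>\<^bsub>M\<^esub>}"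

text \<open>What intervals of the wrong type contribute: in a shorter one everything is killed by
  \<open>A [^] k\<close>, and in a longer one whatever \<open>A [^] Suc k\<close> kills is a
  multiple of \<open>A\<close>, as is the part at \<open>v\<close> of an interval with another
  top.\<close>

definition low_part :: "nat \<Rightarrow> nat \<Rightarrow> ('a, 'm) module \<Rightarrow> 'm set"
  where "low_part v k M = {x \<in> top_part v k M. \<exists>y\<in>carrier M. \<exists>z\<in>carrier M.
    x = A \<odot>\<^bsub>M\<^esub> y \<oplus>\<^bsub>M\<^esub> z \<and> A [^] k \<odot>\<^bsub>M\<^esub> z = \<zero>\<^bsub>M\<^esub>}"

text \<open>Intermediate subspaces over the scalars \<open>T\<close>, not submodules over
  \<open>R\<close>.\<close>

definition mid_part :: "nat \<Rightarrow> nat \<Rightarrow> ('a, 'm) module \<Rightarrow> 'm set \<Rightarrow> bool"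
  where "mid_part v k M W \<longleftrightarrow> low_part v k M \<subseteq> W \<and> W \<subseteq> top_part v k M \<and>
    (\<forall>x\<in>W. \<forall>y\<in>W. x \<oplus>\<^bsub>M\<^esub> y \<in> W) \<and> (\<forall>t\<in>T. \<forall>x\<in>W. t \<odot>\<^bsub>M\<^esub> x \<in> W)"

text \<open>The greatest length of a strict chain of subspaces is the dimension of the quotient;
  chains pass through isomorphisms and direct sums without any choice of a basis.\<close>

inductive mid_chain :: "nat \<Rightarrow> nat \<Rightarrow> ('a, 'm) module \<Rightarrow> nat \<Rightarrow> 'm set \<Rightarrow> bool" for v k M
  where
    mid_chain_0: "mid_part v k M W \<Longrightarrow> mid_chain v k M 0 W"
  | mid_chain_Suc: "\<lbrakk>mid_chain v k M n W; mid_part v k M W'; W \<subset> W'\<rbrakk> \<Longrightarrow> mid_chain v k M (Suc n) W'"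

definition multiplicity :: "nat \<Rightarrow> nat \<Rightarrow> ('a, 'm) module \<Rightarrow> nat \<Rightarrow> bool"
  where "multiplicity v k M n \<longleftrightarrow> (\<exists>W. mid_chain v k M n W) \<and> (\<forall>m W. mid_chain v k M m W \<longrightarrow> m \<le> n)"

lemma multiplicity_unique: "\<lbrakk>multiplicity v k M n; multiplicity v k M n'\<rbrakk> \<Longrightarrow> n = n'"
  unfolding multiplicity_def by (meson le_antisym)

lemma mid_chain_mid_part: "mid_chain v k M n W \<Longrightarrow> mid_part v k M W"
  by (erule mid_chain.cases) auto

lemma mid_part_carrier: "mid_part v k M W \<Longrightarrow> W \<subseteq> carrier M"
  by (auto simp: mid_part_def top_part_def)

lemma mid_part_zero:
  assumes "left_module R M" "mid_part v k M W" shows "\<zero>\<^bsub>M\<^esub> \<in> W"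
proof -
  interpret M: left_module R M by fact
  have "\<zero>\<^bsub>M\<^esub> = A \<odot>\<^bsub>M\<^esub> \<zero>\<^bsub>M\<^esub> \<oplus>\<^bsub>M\<^esub> \<zero>\<^bsub>M\<^esub>" by simp
  then have "\<zero>\<^bsub>M\<^esub> \<in> low_part v k M" unfolding low_part_def top_part_def by fastforce
  then show ?thesis using assms(2) by (auto simp: mid_part_def)
qed

lemma mid_part_minus:
  assumes "left_module R M" "mid_part v k M W" "x \<in> W" shows "\<ominus>\<^bsub>M\<^esub> x \<in> W"
proof -
  interpret M: left_module R M by fact
  have "x \<in> carrier M" using assms mid_part_carrier by blast
  then have "\<ominus>\<^bsub>M\<^esub> x = (\<ominus> \<one>) \<odot>\<^bsub>M\<^esub> x" by (simp add: M.minus_one_smult)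
  then show ?thesis using assms(2,3) T_minus_one by (auto simp: mid_part_def)
qed

lemma top_part_iso:
  assumes M: "left_module R M" and M': "left_module R M'"
    and h: "h \<in> lmod_hom R M M'" "bij_betw h (carrier M) (carrier M')" and x: "x \<in> carrier M"
  shows "h x \<in> top_part v k M' \<longleftrightarrow> x \<in> top_part v k M" "h x \<in> low_part v k M' \<longleftrightarrow> x \<in> low_part v k M"
proof -
  interpret M: left_module R M by fact
  interpret M': left_module R M' by fact
  have inj: "h y = h z \<longleftrightarrow> y = z" if "y \<in> carrier M" "z \<in> carrier M" for y z
    using h(2) that by (auto simp: bij_betw_def inj_on_def)
  have im: "\<exists>y\<in>carrier M. y' = h y" if "y' \<in> carrier M'" for y' using h(2) that by (auto simp: bij_betw_def)
  have pw: "a \<odot>\<^bsub>M'\<^esub> h y = \<zero>\<^bsub>M'\<^esub> \<longleftrightarrow> a \<odot>\<^bsub>M\<^esub> y = \<zero>\<^bsub>M\<^esub>" if "y \<in> carrier M" "a \<in> carrier R" for a y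
    using lmod_hom_smult[OF h(1) that(2,1)] lmod_hom_zero[OF M M' h(1)]
      inj[OF M.smult_closed[OF that(2,1)] M.M.zero_closed] by simp
  show top: "h x \<in> top_part v k M' \<longleftrightarrow> x \<in> top_part v k M"
    using lmod_hom_smult[OF h(1) e_closed x, of v] inj[OF M.smult_closed[OF e_closed x] x, of v]
      pw[OF x nat_pow_closed[OF A_closed], of "Suc k"] x lmod_hom_closed[OF h(1) x] unfolding top_part_def mem_Collect_eq by metis
  have eq: "h x = A \<odot>\<^bsub>M'\<^esub> h y \<oplus>\<^bsub>M'\<^esub> h z \<longleftrightarrow> x = A \<odot>\<^bsub>M\<^esub> y \<oplus>\<^bsub>M\<^esub> z"
    if "y \<in> carrier M" "z \<in> carrier M" for y z
  proof -
    have "A \<odot>\<^bsub>M'\<^esub> h y \<oplus>\<^bsub>M'\<^esub> h z = h (A \<odot>\<^bsub>M\<^esub> y \<oplus>\<^bsub>M\<^esub> z)"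
      using that M.smult_closed by (simp add: lmod_hom_smult[OF h(1)] lmod_hom_add[OF h(1)])
    then show ?thesis using inj[OF x, of "A \<odot>\<^bsub>M\<^esub> y \<oplus>\<^bsub>M\<^esub> z"] that M.smult_closed by simp
  qed
  show "h x \<in> low_part v k M' \<longleftrightarrow> x \<in> low_part v k M"
  proof
    assume l: "h x \<in> low_part v k M'"
    then obtain y' z' where "y' \<in> carrier M'" "z' \<in> carrier M'" "h x = A \<odot>\<^bsub>M'\<^esub> y' \<oplus>\<^bsub>M'\<^esub> z'" "A [^] k \<odot>\<^bsub>M'\<^esub> z' = \<zero>\<^bsub>M'\<^esub>"
      unfolding low_part_def by blast
    then obtain y z where yz: "y \<in> carrier M" "z \<in> carrier M" "h x = A \<odot>\<^bsub>M'\<^esub> h y \<oplus>\<^bsub>M'\<^esub> h z" "A [^] k \<odot>\<^bsub>M'\<^esub> h z = \<zero>\<^bsub>M'\<^esub>"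
      using im by metis
    then have "x = A \<odot>\<^bsub>M\<^esub> y \<oplus>\<^bsub>M\<^esub> z" "A [^] k \<odot>\<^bsub>M\<^esub> z = \<zero>\<^bsub>M\<^esub>" using eq pw by simp_all
    then show "x \<in> low_part v k M" using l top yz(1,2) unfolding low_part_def by blast
  next
    assume l: "x \<in> low_part v k M"
    then obtain y z where yz: "y \<in> carrier M" "z \<in> carrier M" "x = A \<odot>\<^bsub>M\<^esub> y \<oplus>\<^bsub>M\<^esub> z" "A [^] k \<odot>\<^bsub>M\<^esub> z = \<zero>\<^bsub>M\<^esub>"
      unfolding low_part_def by blast
    then have "h x = A \<odot>\<^bsub>M'\<^esub> h y \<oplus>\<^bsub>M'\<^esub> h z" "A [^] k \<odot>\<^bsub>M'\<^esub> h z = \<zero>\<^bsub>M'\<^esub>" using eq pw by simp_all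
    then show "h x \<in> low_part v k M'"
      using l top lmod_hom_closed[OF h(1) yz(1)] lmod_hom_closed[OF h(1) yz(2)] unfolding low_part_def by blast
  qed
qed

lemma mid_part_iso:
  assumes M: "left_module R M" and M': "left_module R M'"
    and h: "h \<in> lmod_hom R M M'" "bij_betw h (carrier M) (carrier M')" and W: "mid_part v k M W"
  shows "mid_part v k M' (h ` W)"
proof -
  note iso = top_part_iso[OF M M' h]
  have Wc: "W \<subseteq> carrier M" by (rule mid_part_carrier[OF W])
  have im: "\<exists>y\<in>carrier M. y' = h y" if "y' \<in> carrier M'" for y' using h(2) that by (auto simp: bij_betw_def)
  show ?thesis
    unfolding mid_part_def
  proof (intro conjI ballI)
    show "low_part v k M' \<subseteq> h ` W"
    proof
      fix y assume y: "y \<in> low_part v k M'"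
      then have "y \<in> carrier M'" by (auto simp: low_part_def top_part_def)
      then obtain x where "x \<in> carrier M" "y = h x" using im by blast
      then show "y \<in> h ` W" using iso(2) y W by (auto simp: mid_part_def)
    qed
    show "h ` W \<subseteq> top_part v k M'" using iso(1) W Wc unfolding mid_part_def by blast
  next
    fix x y assume "x \<in> h ` W" "y \<in> h ` W"
    then obtain a b where "a \<in> W" "b \<in> W" "x = h a" "y = h b" by blast
    moreover from this have "x \<oplus>\<^bsub>M'\<^esub> y = h (a \<oplus>\<^bsub>M\<^esub> b)" using lmod_hom_add[OF h(1)] Wc by (simp add: subset_iff)
    ultimately show "x \<oplus>\<^bsub>M'\<^esub> y \<in> h ` W" using W by (auto simp: mid_part_def)
  next
    fix t x assume "t \<in> T" "x \<in> h ` W"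
    then obtain a where "t \<in> T" "a \<in> W" "x = h a" by blast
    moreover from this have "t \<odot>\<^bsub>M'\<^esub> x = h (t \<odot>\<^bsub>M\<^esub> a)" using lmod_hom_smult[OF h(1) T_closed] Wc by (simp add: subset_iff)
    ultimately show "t \<odot>\<^bsub>M'\<^esub> x \<in> h ` W" using W by (auto simp: mid_part_def)
  qed
qed

lemma mid_chain_iso:
  assumes M: "left_module R M" and M': "left_module R M'"
    and h: "h \<in> lmod_hom R M M'" "bij_betw h (carrier M) (carrier M')" and W: "mid_chain v k M n W"
  shows "mid_chain v k M' n (h ` W)"
  using W
proof (induction rule: mid_chain.induct)
  case (mid_chain_0 W)
  then show ?case by (intro mid_chain.mid_chain_0 mid_part_iso[OF M M' h])
next
  case (mid_chain_Suc n W W')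
  have "inj_on h W'" using h(2) mid_part_carrier[OF mid_chain_Suc(2)] by (auto simp: bij_betw_def intro: inj_on_subset)
  then have "h ` W \<subset> h ` W'" using mid_chain_Suc(3) by (simp add: image_strict_mono)
  then show ?case using mid_chain.mid_chain_Suc[OF mid_chain_Suc.IH mid_part_iso[OF M M' h mid_chain_Suc(2)]] by blast
qed

lemma multiplicity_iso:
  assumes M: "left_module R M" and M': "left_module R M'" and iso: "lmod_iso R M M'"
    and n: "multiplicity v k M n"
  shows "multiplicity v k M' n"
proof -
  obtain h where h: "h \<in> lmod_hom R M M'" "bij_betw h (carrier M) (carrier M')" using iso by (auto simp: lmod_iso_def)
  obtain g where g: "g \<in> lmod_hom R M' M" "bij_betw g (carrier M') (carrier M)"
    using lmod_iso_sym[OF M iso] by (auto simp: lmod_iso_def)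
  show ?thesis
    using n mid_chain_iso[OF M M' h] mid_chain_iso[OF M' M g] unfolding multiplicity_def by blast
qed

lemma top_part_sum: "top_part v k (lmod_sum M1 M2) = top_part v k M1 \<times> top_part v k M2"
  by (auto simp: top_part_def)

lemma low_part_sum: "low_part v k (lmod_sum M1 M2) = low_part v k M1 \<times> low_part v k M2"
proof (intro equalityI subsetI)
  fix x assume "x \<in> low_part v k (lmod_sum M1 M2)"
  then show "x \<in> low_part v k M1 \<times> low_part v k M2"
    unfolding low_part_def top_part_sum by fastforce
next
  fix x assume x: "x \<in> low_part v k M1 \<times> low_part v k M2"
  obtain x1 x2 where x12: "x = (x1, x2)" "x1 \<in> low_part v k M1" "x2 \<in> low_part v k M2" using x by auto
  then obtain y1 z1 y2 z2 where
    "y1 \<in> carrier M1" "z1 \<in> carrier M1" "x1 = A \<odot>\<^bsub>M1\<^esub> y1 \<oplus>\<^bsub>M1\<^esub> z1" "A [^] k \<odot>\<^bsub>M1\<^esub> z1 = \<zero>\<^bsub>M1\<^esub>"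
    "y2 \<in> carrier M2" "z2 \<in> carrier M2" "x2 = A \<odot>\<^bsub>M2\<^esub> y2 \<oplus>\<^bsub>M2\<^esub> z2" "A [^] k \<odot>\<^bsub>M2\<^esub> z2 = \<zero>\<^bsub>M2\<^esub>"
    unfolding low_part_def by blast
  then have "(y1, y2) \<in> carrier (lmod_sum M1 M2)" "(z1, z2) \<in> carrier (lmod_sum M1 M2)"
    "x = A \<odot>\<^bsub>lmod_sum M1 M2\<^esub> (y1, y2) \<oplus>\<^bsub>lmod_sum M1 M2\<^esub> (z1, z2)"
    "A [^] k \<odot>\<^bsub>lmod_sum M1 M2\<^esub> (z1, z2) = \<zero>\<^bsub>lmod_sum M1 M2\<^esub>"
    using x12 by simp_all
  moreover have "x \<in> top_part v k (lmod_sum M1 M2)" using x12 unfolding top_part_sum by (auto simp: low_part_def)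
  ultimately show "x \<in> low_part v k (lmod_sum M1 M2)" unfolding low_part_def by blast
qed

lemma mid_part_sum:
  assumes "mid_part v k M1 W1" "mid_part v k M2 W2"
  shows "mid_part v k (lmod_sum M1 M2) (W1 \<times> W2)"
  using assms unfolding mid_part_def top_part_sum low_part_sum by auto

text \<open>First the chain in \<open>M1\<close> is climbed over the bottom of the chain in
  \<open>M2\<close>, then the latter is climbed over the top of the former. Strictness survives
  because every subspace contains zero.\<close>

lemma mid_chain_sum:
  assumes M1: "left_module R M1" and M2: "left_module R M2"
    and W1: "mid_chain v k M1 a W1" and W2: "mid_chain v k M2 b W2"
  shows "mid_chain v k (lmod_sum M1 M2) (a + b) (W1 \<times> W2)"
  using W2
proof (induction rule: mid_chain.induct)
  case (mid_chain_0 W2)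
  show ?case
    using W1
  proof (induction rule: mid_chain.induct)
    case (mid_chain_0 W1)
    then show ?case using \<open>mid_part v k M2 W2\<close> by (auto intro!: mid_chain.mid_chain_0 mid_part_sum)
  next
    case (mid_chain_Suc n W W')
    have "W \<times> W2 \<subset> W' \<times> W2" using mid_chain_Suc(3) mid_part_zero[OF M2 \<open>mid_part v k M2 W2\<close>] by blast
    then show ?case
      using mid_chain.mid_chain_Suc[OF mid_chain_Suc.IH mid_part_sum[OF mid_chain_Suc(2) \<open>mid_part v k M2 W2\<close>]] by simp
  qed
next
  case (mid_chain_Suc n W W')
  have m1: "mid_part v k M1 W1" by (rule mid_chain_mid_part[OF W1])
  have "W1 \<times> W \<subset> W1 \<times> W'" using mid_chain_Suc(3) mid_part_zero[OF M1 m1] by blast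
  then show ?case
    using mid_chain.mid_chain_Suc[OF mid_chain_Suc.IH mid_part_sum[OF m1 mid_chain_Suc(2)]] by simp
qed

text \<open>A strict step of a chain in a direct sum is strict for the traces on the first summand
  or for the projections to the second one.\<close>

lemma mid_chain_split:
  assumes M1: "left_module R M1" and M2: "left_module R M2" and W: "mid_chain v k (lmod_sum M1 M2) n W"
  shows "\<exists>a b. mid_chain v k M1 a {x. (x, \<zero>\<^bsub>M2\<^esub>) \<in> W} \<and> mid_chain v k M2 b (snd ` W) \<and> n \<le> a + b"
proof -
  interpret M1: left_module R M1 by fact
  interpret M2: left_module R M2 by fact
  have S: "left_module R (lmod_sum M1 M2)" by (rule lmod_sum_left_module[OF M1 M2])
  have low0: "\<zero>\<^bsub>M2\<^esub> \<in> low_part v k M2" "\<zero>\<^bsub>M1\<^esub> \<in> low_part v k M1"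
  proof -
    have "\<zero>\<^bsub>M2\<^esub> = A \<odot>\<^bsub>M2\<^esub> \<zero>\<^bsub>M2\<^esub> \<oplus>\<^bsub>M2\<^esub> \<zero>\<^bsub>M2\<^esub>" "\<zero>\<^bsub>M1\<^esub> = A \<odot>\<^bsub>M1\<^esub> \<zero>\<^bsub>M1\<^esub> \<oplus>\<^bsub>M1\<^esub> \<zero>\<^bsub>M1\<^esub>" by simp_all
    then show "\<zero>\<^bsub>M2\<^esub> \<in> low_part v k M2" "\<zero>\<^bsub>M1\<^esub> \<in> low_part v k M1"
      unfolding low_part_def top_part_def by fastforce+
  qed
  have m1: "mid_part v k M1 {x. (x, \<zero>\<^bsub>M2\<^esub>) \<in> W}" if W: "mid_part v k (lmod_sum M1 M2) W" for W
    unfolding mid_part_def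
  proof (intro conjI ballI)
    show "low_part v k M1 \<subseteq> {x. (x, \<zero>\<^bsub>M2\<^esub>) \<in> W}" using W low0 unfolding mid_part_def low_part_sum by blast
    show "{x. (x, \<zero>\<^bsub>M2\<^esub>) \<in> W} \<subseteq> top_part v k M1" using W unfolding mid_part_def top_part_sum by blast
  next
    fix x y assume "x \<in> {x. (x, \<zero>\<^bsub>M2\<^esub>) \<in> W}" "y \<in> {x. (x, \<zero>\<^bsub>M2\<^esub>) \<in> W}"
    then have "(x, \<zero>\<^bsub>M2\<^esub>) \<oplus>\<^bsub>lmod_sum M1 M2\<^esub> (y, \<zero>\<^bsub>M2\<^esub>) \<in> W" using W unfolding mid_part_def by blast
    then show "x \<oplus>\<^bsub>M1\<^esub> y \<in> {x. (x, \<zero>\<^bsub>M2\<^esub>) \<in> W}" by simp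
  next
    fix t x assume t: "t \<in> T" "x \<in> {x. (x, \<zero>\<^bsub>M2\<^esub>) \<in> W}"
    then have "t \<odot>\<^bsub>lmod_sum M1 M2\<^esub> (x, \<zero>\<^bsub>M2\<^esub>) \<in> W" using W unfolding mid_part_def by blast
    then show "t \<odot>\<^bsub>M1\<^esub> x \<in> {x. (x, \<zero>\<^bsub>M2\<^esub>) \<in> W}" using T_closed[OF t(1)] by simp
  qed
  have m2: "mid_part v k M2 (snd ` W)" if W: "mid_part v k (lmod_sum M1 M2) W" for W
    unfolding mid_part_def
  proof (intro conjI ballI)
    have "{\<zero>\<^bsub>M1\<^esub>} \<times> low_part v k M2 \<subseteq> W" using W low0 unfolding mid_part_def low_part_sum by blast
    then have "snd ` ({\<zero>\<^bsub>M1\<^esub>} \<times> low_part v k M2) \<subseteq> snd ` W" by (rule image_mono)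
    then show "low_part v k M2 \<subseteq> snd ` W" by (simp only: snd_image_times insert_not_empty if_False)
    have "W \<subseteq> top_part v k M1 \<times> top_part v k M2" using W unfolding mid_part_def top_part_sum by blast
    then have "snd ` W \<subseteq> snd ` (top_part v k M1 \<times> top_part v k M2)" by (rule image_mono)
    then show "snd ` W \<subseteq> top_part v k M2" by (rule subset_trans) (simp only: snd_image_times split: if_split, simp)
  next
    fix x y assume "x \<in> snd ` W" "y \<in> snd ` W"
    then obtain a b where ab: "a \<in> W" "b \<in> W" "x = snd a" "y = snd b" by blast
    then have "a \<oplus>\<^bsub>lmod_sum M1 M2\<^esub> b \<in> W" using W unfolding mid_part_def by blast
    moreover have "snd (a \<oplus>\<^bsub>lmod_sum M1 M2\<^esub> b) = x \<oplus>\<^bsub>M2\<^esub> y" using ab by (cases a; cases b) simp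
    ultimately show "x \<oplus>\<^bsub>M2\<^esub> y \<in> snd ` W" by (metis image_eqI)
  next
    fix t x assume t: "t \<in> T" "x \<in> snd ` W"
    then obtain a where a: "a \<in> W" "x = snd a" by blast
    then have "t \<odot>\<^bsub>lmod_sum M1 M2\<^esub> a \<in> W" using W t(1) unfolding mid_part_def by blast
    moreover have "snd (t \<odot>\<^bsub>lmod_sum M1 M2\<^esub> a) = t \<odot>\<^bsub>M2\<^esub> x" using a by (cases a) simp
    ultimately show "t \<odot>\<^bsub>M2\<^esub> x \<in> snd ` W" by (metis image_eqI)
  qed
  show ?thesis
    using W
  proof (induction rule: mid_chain.induct)
    case (mid_chain_0 W)
    show ?case
      by (intro exI[of _ 0] conjI mid_chain.mid_chain_0[OF m1[OF mid_chain_0]] mid_chain.mid_chain_0[OF m2[OF mid_chain_0]]) simp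
  next
    case (mid_chain_Suc n W W')
    then obtain a b where ab: "mid_chain v k M1 a {x. (x, \<zero>\<^bsub>M2\<^esub>) \<in> W}" "mid_chain v k M2 b (snd ` W)" "n \<le> a + b"
      by blast
    have mW: "mid_part v k (lmod_sum M1 M2) W" by (rule mid_chain_mid_part[OF mid_chain_Suc(1)])
    have sub: "{x. (x, \<zero>\<^bsub>M2\<^esub>) \<in> W} \<subseteq> {x. (x, \<zero>\<^bsub>M2\<^esub>) \<in> W'}" "snd ` W \<subseteq> snd ` W'" using mid_chain_Suc(3) by blast+
    have ne: "{x. (x, \<zero>\<^bsub>M2\<^esub>) \<in> W} \<noteq> {x. (x, \<zero>\<^bsub>M2\<^esub>) \<in> W'} \<or> snd ` W \<noteq> snd ` W'"
    proof (rule ccontr)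
      assume "\<not> ?thesis"
      then have eq: "(x, \<zero>\<^bsub>M2\<^esub>) \<in> W' \<Longrightarrow> (x, \<zero>\<^bsub>M2\<^esub>) \<in> W" "snd ` W = snd ` W'" for x by blast+
      \<comment> \<open>If traces and projections agree, \<open>z\<close> shares its second
        coordinate with some element of \<open>W\<close>. Their difference lies in the trace of
        \<open>W'\<close>, hence in that of \<open>W\<close>, and adding the element back shows that
        \<open>z\<close> is in \<open>W\<close>.\<close>
      have "z \<in> W" if z: "z \<in> W'" for z
      proof -
        obtain x y where xy: "z = (x, y)" by fastforce
        have "y \<in> snd ` W" using z xy eq(2) by force
        then obtain x' where x': "(x', y) \<in> W" by force
        have c: "x \<in> carrier M1" "y \<in> carrier M2" "x' \<in> carrier M1"
          using mid_part_carrier[OF mid_chain_Suc(2)] mid_part_carrier[OF mW] z xy x' by auto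
        interpret S: left_module R "lmod_sum M1 M2" by (rule S)
        have "(\<ominus> \<one>) \<odot>\<^bsub>lmod_sum M1 M2\<^esub> (x', y) \<in> W'"
          using x' mid_chain_Suc(2,3) T_minus_one unfolding mid_part_def by blast
        then have "z \<oplus>\<^bsub>lmod_sum M1 M2\<^esub> ((\<ominus> \<one>) \<odot>\<^bsub>lmod_sum M1 M2\<^esub> (x', y)) \<in> W'"
          using z mid_chain_Suc(2) unfolding mid_part_def by blast
        then have "(x \<oplus>\<^bsub>M1\<^esub> \<ominus>\<^bsub>M1\<^esub> x', \<zero>\<^bsub>M2\<^esub>) \<in> W'"
          using c xy by (simp add: M1.minus_one_smult M2.minus_one_smult M2.M.r_neg)
        then have "(x \<oplus>\<^bsub>M1\<^esub> \<ominus>\<^bsub>M1\<^esub> x', \<zero>\<^bsub>M2\<^esub>) \<in> W" by (rule eq(1))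
        then have "(x \<oplus>\<^bsub>M1\<^esub> \<ominus>\<^bsub>M1\<^esub> x', \<zero>\<^bsub>M2\<^esub>) \<oplus>\<^bsub>lmod_sum M1 M2\<^esub> (x', y) \<in> W"
          using x' mW unfolding mid_part_def by blast
        then show "z \<in> W" using c xy by (simp add: M1.M.a_assoc M1.M.l_neg)
      qed
      then show False using mid_chain_Suc(3) by blast
    qed
    show ?case
    proof (cases "{x. (x, \<zero>\<^bsub>M2\<^esub>) \<in> W} = {x. (x, \<zero>\<^bsub>M2\<^esub>) \<in> W'}")
      case True
      then have "snd ` W \<subset> snd ` W'" using ne sub by blast
      then have "mid_chain v k M2 (Suc b) (snd ` W')"
        using mid_chain.mid_chain_Suc[OF ab(2) m2[OF mid_chain_Suc(2)]] by blast
      then show ?thesis using ab(1,3) unfolding True by (intro exI[of _ a] exI[of _ "Suc b"]) simp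
    next
      case False
      then have "{x. (x, \<zero>\<^bsub>M2\<^esub>) \<in> W} \<subset> {x. (x, \<zero>\<^bsub>M2\<^esub>) \<in> W'}" using sub by blast
      then have c1: "mid_chain v k M1 (Suc a) {x. (x, \<zero>\<^bsub>M2\<^esub>) \<in> W'}"
        using mid_chain.mid_chain_Suc[OF ab(1) m1[OF mid_chain_Suc(2)]] by blast
      show ?thesis
      proof (cases "snd ` W = snd ` W'")
        case True
        then show ?thesis using c1 ab(2,3) by (intro exI[of _ "Suc a"] exI[of _ b]) simp
      next
        case False
        then have "snd ` W \<subset> snd ` W'" using sub by blast
        then have "mid_chain v k M2 (Suc b) (snd ` W')"
          using mid_chain.mid_chain_Suc[OF ab(2) m2[OF mid_chain_Suc(2)]] by blast
        then show ?thesis using c1 ab(3) by (intro exI[of _ "Suc a"] exI[of _ "Suc b"]) simp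
      qed
    qed
  qed
qed

text \<open>Concatenated chains give the lower bound, splitting a chain gives the upper one.\<close>

lemma multiplicity_sum:
  assumes M1: "left_module R M1" and M2: "left_module R M2"
    and a: "multiplicity v k M1 a" and b: "multiplicity v k M2 b"
  shows "multiplicity v k (lmod_sum M1 M2) (a + b)"
  unfolding multiplicity_def
proof (intro conjI allI impI)
  obtain W1 W2 where "mid_chain v k M1 a W1" "mid_chain v k M2 b W2"
    using a b by (auto simp: multiplicity_def)
  then show "\<exists>W. mid_chain v k (lmod_sum M1 M2) (a + b) W" using mid_chain_sum[OF M1 M2] by blast
  fix m W assume "mid_chain v k (lmod_sum M1 M2) m W"
  then obtain a' b' where "mid_chain v k M1 a' {x. (x, \<zero>\<^bsub>M2\<^esub>) \<in> W}" "mid_chain v k M2 b' (snd ` W)" "m \<le> a' + b'"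
    using mid_chain_split[OF M1 M2] by blast
  then show "m \<le> a + b" using a b unfolding multiplicity_def by (meson add_mono order_trans)
qed


lemma mid_part_top:
  assumes M: "left_module R M" shows "mid_part v k M (top_part v k M)"
proof -
  interpret M: left_module R M by fact
  have "a \<odot>\<^bsub>M\<^esub> (t \<odot>\<^bsub>M\<^esub> x) = t \<odot>\<^bsub>M\<^esub> (a \<odot>\<^bsub>M\<^esub> x)" if "t \<in> T" "a \<in> carrier R" "x \<in> carrier M" for t a x
    using T_comm[OF that(1,2)] T_closed[OF that(1)] that by (simp flip: M.smult_assoc1)
  then show ?thesis
    unfolding mid_part_def top_part_def low_part_def using T_closed
    by (auto simp: M.smult_r_distr M.smult_closed)
qed

lemma mid_part_low:
  assumes M: "left_module R M" shows "mid_part v k M (low_part v k M)"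
proof -
  interpret M: left_module R M by fact
  have comm: "a \<odot>\<^bsub>M\<^esub> (t \<odot>\<^bsub>M\<^esub> x) = t \<odot>\<^bsub>M\<^esub> (a \<odot>\<^bsub>M\<^esub> x)" if "t \<in> T" "a \<in> carrier R" "x \<in> carrier M" for t a x
    using T_comm[OF that(1,2)] T_closed[OF that(1)] that by (simp flip: M.smult_assoc1)
  note top = mid_part_top[OF M, of v k, unfolded mid_part_def]
  show ?thesis
    unfolding mid_part_def
  proof (intro conjI ballI)
    show "low_part v k M \<subseteq> top_part v k M" by (auto simp: low_part_def)
  next
    fix x x' assume x: "x \<in> low_part v k M" "x' \<in> low_part v k M"
    then obtain y z where y: "y \<in> carrier M" "z \<in> carrier M" "x = A \<odot>\<^bsub>M\<^esub> y \<oplus>\<^bsub>M\<^esub> z" "A [^] k \<odot>\<^bsub>M\<^esub> z = \<zero>\<^bsub>M\<^esub>"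
      by (auto simp: low_part_def)
    obtain y' z' where y': "y' \<in> carrier M" "z' \<in> carrier M" "x' = A \<odot>\<^bsub>M\<^esub> y' \<oplus>\<^bsub>M\<^esub> z'" "A [^] k \<odot>\<^bsub>M\<^esub> z' = \<zero>\<^bsub>M\<^esub>"
      using x by (auto simp: low_part_def)
    have "x \<oplus>\<^bsub>M\<^esub> x' = A \<odot>\<^bsub>M\<^esub> (y \<oplus>\<^bsub>M\<^esub> y') \<oplus>\<^bsub>M\<^esub> (z \<oplus>\<^bsub>M\<^esub> z')"
      using y(1,2) y'(1,2) unfolding y(3) y'(3) by (simp add: M.smult_r_distr M.smult_closed M.M.add.m_ac)
    moreover have "A [^] k \<odot>\<^bsub>M\<^esub> (z \<oplus>\<^bsub>M\<^esub> z') = \<zero>\<^bsub>M\<^esub>" using y y' by (simp add: M.smult_r_distr)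
    moreover have "x \<oplus>\<^bsub>M\<^esub> x' \<in> top_part v k M" using x top by (auto simp: low_part_def)
    ultimately show "x \<oplus>\<^bsub>M\<^esub> x' \<in> low_part v k M"
      using M.M.add.m_closed[OF y(1) y'(1)] M.M.add.m_closed[OF y(2) y'(2)] unfolding low_part_def by blast
  next
    fix t x assume t: "t \<in> T" and x: "x \<in> low_part v k M"
    then obtain y z where y: "y \<in> carrier M" "z \<in> carrier M" "x = A \<odot>\<^bsub>M\<^esub> y \<oplus>\<^bsub>M\<^esub> z" "A [^] k \<odot>\<^bsub>M\<^esub> z = \<zero>\<^bsub>M\<^esub>"
      by (auto simp: low_part_def)
    note tc = T_closed[OF t]
    have "t \<odot>\<^bsub>M\<^esub> x = A \<odot>\<^bsub>M\<^esub> (t \<odot>\<^bsub>M\<^esub> y) \<oplus>\<^bsub>M\<^esub> t \<odot>\<^bsub>M\<^esub> z"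
      using y(1,2) tc unfolding y(3) by (simp add: M.smult_r_distr M.smult_closed comm[OF t])
    moreover have "A [^] k \<odot>\<^bsub>M\<^esub> (t \<odot>\<^bsub>M\<^esub> z) = \<zero>\<^bsub>M\<^esub>" using y tc by (simp add: comm[OF t])
    moreover have "t \<odot>\<^bsub>M\<^esub> x \<in> top_part v k M" using x t top by (auto simp: low_part_def)
    ultimately show "t \<odot>\<^bsub>M\<^esub> x \<in> low_part v k M"
      using M.smult_closed[OF tc y(1)] M.smult_closed[OF tc y(2)] unfolding low_part_def by blast
  qed auto
qed

text \<open>Every element is a scalar multiple of the generator plus a multiple of \<open>A\<close>.
  The generator survives in the quotient exactly when vertex and length both match, and then it
  spans a line.\<close>

lemma multiplicity_interval:
  assumes M: "interval M u m"
  shows "multiplicity v k M (if u mod N = v mod N \<and> m = Suc k then 1 else 0)"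
proof -
  have lm: "left_module R M" using M by (simp add: interval_def)
  interpret M: left_module R M by fact
  obtain x where xg: "interval_gen M u m x" using M by (auto simp: interval_def)
  then have x: "x \<in> carrier M" "e u \<odot>\<^bsub>M\<^esub> x = x" "carrier M = {a \<odot>\<^bsub>M\<^esub> x | a. a \<in> carrier R}"
    "\<And>n. A [^] n \<odot>\<^bsub>M\<^esub> x = \<zero>\<^bsub>M\<^esub> \<longleftrightarrow> m \<le> n"
    unfolding interval_gen_def by blast+
  have split: "\<exists>t\<in>T. \<exists>w\<in>carrier M. y = t \<odot>\<^bsub>M\<^esub> x \<oplus>\<^bsub>M\<^esub> A \<odot>\<^bsub>M\<^esub> w" if y: "y \<in> carrier M" for y
  proof -
    obtain a where a: "a \<in> carrier R" "y = a \<odot>\<^bsub>M\<^esub> x" using x(3) y by auto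
    obtain t d where "t \<in> T" "d \<in> carrier R" "y = t \<odot>\<^bsub>M\<^esub> x \<oplus>\<^bsub>M\<^esub> A \<odot>\<^bsub>M\<^esub> (d \<odot>\<^bsub>M\<^esub> x)"
      using e_split_smult[OF lm x(1,2) a(1)] a(2) by metis
    then show ?thesis using M.smult_closed[OF _ x(1)] by blast
  qed
  have A_zero: "A [^] n \<odot>\<^bsub>M\<^esub> y = \<zero>\<^bsub>M\<^esub>" if y: "y \<in> carrier M" "m \<le> n" for n y
  proof -
    obtain a where "a \<in> carrier R" "y = a \<odot>\<^bsub>M\<^esub> x" using x(3) y(1) by auto
    then show ?thesis using pow_smult_zero[OF lm x(1) _ ] x(4) y(2) by blast
  qed
  have low_top: "low_part v k M \<subseteq> top_part v k M" by (auto simp: low_part_def)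
  have AM_low: "y \<in> low_part v k M" if "y \<in> top_part v k M" "y = A \<odot>\<^bsub>M\<^esub> w" "w \<in> carrier M" for y w
  proof -
    have "y = A \<odot>\<^bsub>M\<^esub> w \<oplus>\<^bsub>M\<^esub> \<zero>\<^bsub>M\<^esub>" "A [^] k \<odot>\<^bsub>M\<^esub> \<zero>\<^bsub>M\<^esub> = \<zero>\<^bsub>M\<^esub>" using that by (simp_all add: M.smult_closed)
    then show ?thesis using that M.M.zero_closed unfolding low_part_def by blast
  qed
  show ?thesis
  proof (cases "u mod N = v mod N \<and> m = Suc k")
    case False
    have "y \<in> low_part v k M" if y: "y \<in> top_part v k M" for y
    proof -
      have y1: "y \<in> carrier M" "e v \<odot>\<^bsub>M\<^esub> y = y" "A [^] Suc k \<odot>\<^bsub>M\<^esub> y = \<zero>\<^bsub>M\<^esub>" using y unfolding top_part_def by blast+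
      obtain t w where t: "t \<in> T" and w: "w \<in> carrier M" "y = t \<odot>\<^bsub>M\<^esub> x \<oplus>\<^bsub>M\<^esub> A \<odot>\<^bsub>M\<^esub> w" using split[OF y1(1)] by blast
      note tc = T_closed[OF t]
      \<comment> \<open>Three ways to fail: at another vertex \<open>e v\<close> kills the scalar
        part; a shorter module is killed by \<open>A [^] k\<close>; in a longer one
        \<open>A [^] (m - 1) y = 0\<close> forces the scalar to vanish.\<close>
      consider "u mod N \<noteq> v mod N" | "m \<le> k" | "u mod N = v mod N" "Suc k < m" using False by linarith
      then show ?thesis
      proof cases
        case 1
        obtain b where b: "b \<in> carrier R" "e v \<otimes> A = A \<otimes> b" using A_right[OF e_closed] by blast
        have "e v \<odot>\<^bsub>M\<^esub> (t \<odot>\<^bsub>M\<^esub> x) = (t \<otimes> (e v \<otimes> e u)) \<odot>\<^bsub>M\<^esub> x"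
          using T_comm[OF t e_closed, of v] tc x(1,2) by (simp add: M.smult_assoc1[symmetric] m_assoc[symmetric]) (simp add: M.smult_assoc1)
        then have "e v \<odot>\<^bsub>M\<^esub> (t \<odot>\<^bsub>M\<^esub> x) = \<zero>\<^bsub>M\<^esub>" using e_orth[of v u] 1 tc x(1) by simp
        moreover have "e v \<odot>\<^bsub>M\<^esub> (A \<odot>\<^bsub>M\<^esub> w) = A \<odot>\<^bsub>M\<^esub> (b \<odot>\<^bsub>M\<^esub> w)"
          using b w(1) by (simp flip: M.smult_assoc1)
        ultimately have "y = A \<odot>\<^bsub>M\<^esub> (b \<odot>\<^bsub>M\<^esub> w)"
          using y1(2) w tc x(1) b(1) by (simp add: M.smult_r_distr M.smult_closed)
        then show ?thesis using AM_low[OF y] M.smult_closed[OF b(1) w(1)] by blast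
      next
        case 2
        have tx: "t \<odot>\<^bsub>M\<^esub> x \<in> carrier M" using tc x(1) M.smult_closed by simp
        have "y = A \<odot>\<^bsub>M\<^esub> w \<oplus>\<^bsub>M\<^esub> t \<odot>\<^bsub>M\<^esub> x" using w tx M.smult_closed by (simp add: M.M.a_comm)
        then show ?thesis using y w(1) tx A_zero[OF tx 2] unfolding low_part_def by blast
      next
        case 3
        then obtain m' where m': "m = Suc m'" by (cases m) auto
        have "A [^] m' \<odot>\<^bsub>M\<^esub> y = \<zero>\<^bsub>M\<^esub>" using pow_smult_mono[OF lm y1(1,3)] 3 m' by simp
        moreover have "A [^] m' \<odot>\<^bsub>M\<^esub> y = A [^] m' \<odot>\<^bsub>M\<^esub> (t \<odot>\<^bsub>M\<^esub> x) \<oplus>\<^bsub>M\<^esub> A [^] m \<odot>\<^bsub>M\<^esub> w"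
          using w(1) tc x(1) unfolding w(2) m' by (simp add: M.smult_r_distr M.smult_closed M.smult_assoc1)
        moreover have "A [^] m' \<odot>\<^bsub>M\<^esub> (t \<odot>\<^bsub>M\<^esub> x) = t \<odot>\<^bsub>M\<^esub> (A [^] m' \<odot>\<^bsub>M\<^esub> x)"
          using T_comm[OF t, of "A [^] m'"] tc x(1) by (simp flip: M.smult_assoc1)
        ultimately have "t \<odot>\<^bsub>M\<^esub> (A [^] m' \<odot>\<^bsub>M\<^esub> x) = \<zero>\<^bsub>M\<^esub>"
          using A_zero[OF w(1) order_refl] tc x(1) M.smult_closed by simp
        moreover have "A [^] m' \<odot>\<^bsub>M\<^esub> x \<noteq> \<zero>\<^bsub>M\<^esub>" using x(4) m' by simp
        ultimately have "t = \<zero>" using T_smult_eq_zero[OF lm t] x(1) M.smult_closed nat_pow_closed[OF A_closed] by blast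
        then have "y = A \<odot>\<^bsub>M\<^esub> w" using w x(1) M.smult_closed by simp
        then show ?thesis using AM_low[OF y] w(1) by blast
      qed
    qed
    then have mid: "mid_part v k M W \<Longrightarrow> W = top_part v k M" for W unfolding mid_part_def by blast
    have "mid_chain v k M n W \<Longrightarrow> n = 0" for n W
    proof (induction rule: mid_chain.induct)
      case (mid_chain_Suc n W W')
      then show ?case using mid[OF mid_chain_mid_part[OF mid_chain_Suc(1)]] mid[OF mid_chain_Suc(2)] by blast
    qed simp
    then show ?thesis
      unfolding multiplicity_def if_not_P[OF False] using mid_chain_0[OF mid_part_top[OF lm]] by blast
  next
    case True
    then have ev: "e v = e u" using e_mod by metis
    have "A [^] Suc k \<odot>\<^bsub>M\<^esub> x = \<zero>\<^bsub>M\<^esub>" by (rule iffD2[OF x(4)]) (use True in simp)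
    then have xt: "x \<in> top_part v k M" unfolding top_part_def ev using x(1,2) by blast
    have "x \<notin> low_part v k M"
    proof
      assume "x \<in> low_part v k M"
      then obtain y z where y: "y \<in> carrier M" "z \<in> carrier M" "x = A \<odot>\<^bsub>M\<^esub> y \<oplus>\<^bsub>M\<^esub> z" "A [^] k \<odot>\<^bsub>M\<^esub> z = \<zero>\<^bsub>M\<^esub>"
        unfolding low_part_def by blast
      have "A [^] k \<odot>\<^bsub>M\<^esub> (A \<odot>\<^bsub>M\<^esub> y \<oplus>\<^bsub>M\<^esub> z) = A [^] Suc k \<odot>\<^bsub>M\<^esub> y \<oplus>\<^bsub>M\<^esub> A [^] k \<odot>\<^bsub>M\<^esub> z"
        using y(1,2) by (simp add: M.smult_r_distr M.smult_closed M.smult_assoc1)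
      also have "\<dots> = \<zero>\<^bsub>M\<^esub>" using A_zero[OF y(1), of "Suc k"] True y(4) by simp
      finally have "A [^] k \<odot>\<^bsub>M\<^esub> x = \<zero>\<^bsub>M\<^esub>" using y(3) by simp
      then show False using x(4)[of k] True by simp
    qed
    then have strict: "low_part v k M \<subset> top_part v k M" using xt low_top by blast
    \<comment> \<open>No subspace lies strictly between: an element outside the lower part has a
      nonzero scalar coefficient, inverting it recovers the generator \<open>x\<close>, and
      \<open>x\<close> together with the lower part spans everything.\<close>
    have mid: "W = low_part v k M \<or> W = top_part v k M" if W: "mid_part v k M W" for W
    proof (cases "W = low_part v k M")
      case False
      then obtain w where w: "w \<in> W" "w \<notin> low_part v k M" using W unfolding mid_part_def by blast
      have dec: "\<exists>t\<in>T. \<exists>z\<in>low_part v k M. y = t \<odot>\<^bsub>M\<^esub> x \<oplus>\<^bsub>M\<^esub> z" if y: "y \<in> top_part v k M" for y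
      proof -
        have yc: "y \<in> carrier M" using y by (simp add: top_part_def)
        obtain t w where t: "t \<in> T" and w: "w \<in> carrier M" "y = t \<odot>\<^bsub>M\<^esub> x \<oplus>\<^bsub>M\<^esub> A \<odot>\<^bsub>M\<^esub> w" using split[OF yc] by blast
        note tc = T_closed[OF t]
        have tx: "t \<odot>\<^bsub>M\<^esub> x \<in> top_part v k M" using mid_part_top[OF lm, of v k] t xt unfolding mid_part_def by blast
        have txc: "t \<odot>\<^bsub>M\<^esub> x \<in> carrier M" using tc x(1) M.smult_closed by simp
        have Awc: "A \<odot>\<^bsub>M\<^esub> w \<in> carrier M" using w M.smult_closed by simp
        have "A \<odot>\<^bsub>M\<^esub> w = \<ominus>\<^bsub>M\<^esub> (t \<odot>\<^bsub>M\<^esub> x) \<oplus>\<^bsub>M\<^esub> y" using w(2) txc Awc by (simp add: M.M.r_neg1)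
        moreover have "\<ominus>\<^bsub>M\<^esub> (t \<odot>\<^bsub>M\<^esub> x) \<in> top_part v k M" by (rule mid_part_minus[OF lm mid_part_top[OF lm] tx])
        ultimately have "A \<odot>\<^bsub>M\<^esub> w \<in> top_part v k M" using mid_part_top[OF lm, of v k] y unfolding mid_part_def by metis
        then have "A \<odot>\<^bsub>M\<^esub> w \<in> low_part v k M" using AM_low w(1) by blast
        then show ?thesis using t w(2) by blast
      qed
      have wt: "w \<in> top_part v k M" using w W by (auto simp: mid_part_def)
      obtain t z where t: "t \<in> T" and z: "z \<in> low_part v k M" "w = t \<odot>\<^bsub>M\<^esub> x \<oplus>\<^bsub>M\<^esub> z" using dec[OF wt] by blast
      note tc = T_closed[OF t]
      have zc: "z \<in> carrier M" "z \<in> W" using z W by (auto simp: low_part_def top_part_def mid_part_def)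
      have t0: "t \<noteq> \<zero>" using w(2) z zc(1) x(1) by auto
      obtain t' where t': "t' \<in> T" "t' \<otimes> t = \<one>" using T_inv[OF t t0] by blast
      have "w \<oplus>\<^bsub>M\<^esub> \<ominus>\<^bsub>M\<^esub> z = t \<odot>\<^bsub>M\<^esub> x" using z(2) zc(1) tc x(1) M.smult_closed by (simp add: M.M.a_assoc M.M.r_neg)
      moreover have "w \<oplus>\<^bsub>M\<^esub> \<ominus>\<^bsub>M\<^esub> z \<in> W" using W w(1) mid_part_minus[OF lm W zc(2)] unfolding mid_part_def by blast
      ultimately have "t' \<odot>\<^bsub>M\<^esub> (t \<odot>\<^bsub>M\<^esub> x) \<in> W" using W t'(1) unfolding mid_part_def by metis
      moreover have "t' \<odot>\<^bsub>M\<^esub> (t \<odot>\<^bsub>M\<^esub> x) = x"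
        using t' T_closed[OF t'(1)] tc x(1) by (simp add: M.smult_one flip: M.smult_assoc1)
      ultimately have xW: "x \<in> W" by simp
      have "top_part v k M \<subseteq> W"
      proof
        fix y assume "y \<in> top_part v k M"
        then obtain s z where "s \<in> T" "z \<in> low_part v k M" "y = s \<odot>\<^bsub>M\<^esub> x \<oplus>\<^bsub>M\<^esub> z" using dec by blast
        then show "y \<in> W" using W xW unfolding mid_part_def by blast
      qed
      then show ?thesis using W unfolding mid_part_def by blast
    qed simp
    have "mid_chain v k M n W \<Longrightarrow> n = 0 \<or> n = 1 \<and> W = top_part v k M" for n W
    proof (induction rule: mid_chain.induct)
      case (mid_chain_Suc n W W')
      have "low_part v k M \<subseteq> W" "W' \<subseteq> top_part v k M"
        using mid_chain_mid_part[OF mid_chain_Suc(1)] mid_chain_Suc(2) by (auto simp: mid_part_def)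
      then have "W' = top_part v k M" "W \<noteq> top_part v k M" using mid[OF mid_chain_Suc(2)] mid_chain_Suc(3) by blast+
      then show ?case using mid_chain_Suc.IH by simp
    qed simp
    moreover have "mid_chain v k M (Suc 0) (top_part v k M)"
      by (rule mid_chain_Suc[OF mid_chain_0[OF mid_part_low[OF lm]] mid_part_top[OF lm] strict])
    ultimately show ?thesis using True unfolding multiplicity_def by auto
  qed
qed

lemma multiplicity_exists: "interval_sum M \<Longrightarrow> \<exists>n. multiplicity v k M n"
proof (induction rule: interval_sum.induct)
  case (interval_sum_interval M u l)
  then show ?case using multiplicity_interval by blast
next
  case (interval_sum_sum M1 M2 M)
  then obtain a b where ab: "multiplicity v k M1 a" "multiplicity v k M2 b" by blast
  have lm: "left_module R M1" "left_module R M2"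
    using interval_sum_fg interval_sum_sum(1,2) by (auto simp: fg_modules_def)
  show ?case
    using multiplicity_iso[OF lmod_sum_left_module[OF lm] interval_sum_sum(3) lmod_iso_sym[OF interval_sum_sum(3,4)]
        multiplicity_sum[OF lm ab]] by blast
qed

lemma multiplicity_fg_sum:
  assumes "M1 \<in> fg_modules R" "M2 \<in> fg_modules R" "M \<in> fg_modules R" "lmod_iso R M (lmod_sum M1 M2)"
    "multiplicity v k M1 a" "multiplicity v k M2 b" "multiplicity v k M n"
  shows "n = a + b"
proof -
  have lm: "left_module R M1" "left_module R M2" "left_module R M" using assms by (auto simp: fg_modules_def)
  show ?thesis
    using multiplicity_unique[OF multiplicity_iso[OF lm(3) lmod_sum_left_module[OF lm(1,2)] assms(4,7)]
        multiplicity_sum[OF lm(1,2) assms(5,6)]] .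
qed

text \<open>A projective interval of this type would split off the interval \<open>P\<close> of full
  length \<open>c u\<close> with the same top. But \<open>P\<close> has length different from
  \<open>k + 1\<close> and so multiplicity 0, while its summand would contribute 1.\<close>

lemma multiplicity_projective:
  assumes "c v \<noteq> Suc k"
  shows "interval_sum P \<Longrightarrow> projective R P \<Longrightarrow> multiplicity v k P 0"
proof (induction rule: interval_sum.induct)
  case (interval_sum_interval M u l)
  note M = interval_sum_interval(1)
  show ?case
  proof (cases "u mod N = v mod N \<and> l = Suc k")
    case True
    obtain P :: "'a lmod" where P: "interval P u (c u)" using interval_exists by blast
    obtain p where p: "p \<in> lmod_epi R P M" "interval (lmod_ker P M p) (u + l) (c u - l)"
      using interval_presentation[OF M P] by metis
    have iso: "lmod_iso R P (lmod_sum (lmod_ker P M p) M)"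
      by (rule projective_epi_split[OF interval_projective[OF P] interval_sum_interval(2) p(1)])
    have "multiplicity v k P 0" using multiplicity_interval[OF P, of v k] c_mod[of u v] True assms by simp
    moreover have "multiplicity v k M 1" using multiplicity_interval[OF M, of v k] True by simp
    ultimately have False
      using multiplicity_fg_sum[OF interval_in_fg[OF p(2)] interval_in_fg[OF M] interval_in_fg[OF P] iso
          multiplicity_interval[OF p(2), of v k]] by fastforce
    then show ?thesis ..
  next
    case False
    then have "(if u mod N = v mod N \<and> l = Suc k then 1 else 0) = (0::nat)" by simp
    then show ?thesis using multiplicity_interval[OF M, of v k] by simp
  qed
next
  case (interval_sum_sum M1 M2 M)
  have lm: "left_module R M1" "left_module R M2"
    using interval_sum_fg interval_sum_sum(1,2) by (auto simp: fg_modules_def)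
  have "lmod_iso R (lmod_sum M1 M2) (lmod_sum M2 M1)"
    unfolding lmod_iso_def
  proof (rule bexI[of _ prod.swap])
    show "bij_betw prod.swap (carrier (lmod_sum M1 M2)) (carrier (lmod_sum M2 M1))"
      by (rule bij_betw_byWitness[where f' = prod.swap]) auto
    show "prod.swap \<in> lmod_hom R (lmod_sum M1 M2) (lmod_sum M2 M1)" by (auto simp: lmod_hom_def)
  qed
  then have iso': "lmod_iso R M (lmod_sum M2 M1)" using lmod_iso_trans interval_sum_sum(4) by blast
  have "projective R M1" "projective R M2"
    using projective_summand[OF interval_sum_sum.prems lm interval_sum_sum(4)]
      projective_summand[OF interval_sum_sum.prems lm(2,1) iso'] by auto
  then have "multiplicity v k (lmod_sum M1 M2) (0 + 0)"
    using interval_sum_sum.IH multiplicity_sum[OF lm] by blast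
  then show ?case
    using multiplicity_iso[OF lmod_sum_left_module[OF lm] interval_sum_sum(3) lmod_iso_sym[OF interval_sum_sum(3,4)]] by simp
qed

section \<open>Classes of infinite order and infinite global dimension\<close>

text \<open>For a length other than 0 and the full length, counting summands of this type is
  additive and vanishes on projectives, hence is a homomorphism from \<open>K0\<close> to the
  integers. It takes the value 1 on the class, so no nonzero multiple of the class can
  vanish.\<close>

lemma K0_class_infinite_order:
  fixes M :: "'a lmod"
  assumes M: "interval M v l" and l: "0 < l" "l \<noteq> c v" and n: "K0_class R M [^]\<^bsub>K0 R\<^esub> (n::int) = \<one>\<^bsub>K0 R\<^esub>"
  shows "n = 0"
proof -
  obtain k where k: "l = Suc k" using l(1) gr0_implies_Suc by blast
  interpret K: comm_group "K0 R" by (rule comm_group_K0)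
  define d where "d = (\<lambda>X :: 'a lmod. THE n. multiplicity v k X n)"
  have d: "multiplicity v k X (d X)" if X: "X \<in> fg_modules R" for X
  proof -
    obtain n where n: "multiplicity v k X n" using multiplicity_exists[OF fg_interval_sum[OF X]] by blast
    then have "d X = n" unfolding d_def using multiplicity_unique by (intro the_equality) auto
    then show ?thesis using n by simp
  qed
  obtain g where g: "g \<in> hom (K0 R) integer_group" "\<And>X. X \<in> fg_modules R \<Longrightarrow> g (K0_class R X) = int (d X)"
  proof (rule K0_universal[OF abelian_integer_group, where R = R and f = "\<lambda>X. int (d X)"])
    show "int (d C) = int (d A') \<otimes>\<^bsub>integer_group\<^esub> int (d B)"
      if "A' \<in> fg_modules R" "B \<in> fg_modules R" "C \<in> fg_modules R" "lmod_iso R C (lmod_sum A' B)" for A' B C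
      using multiplicity_fg_sum[OF that d[OF that(1)] d[OF that(2)] d[OF that(3)]] by simp
    show "int (d P) = \<one>\<^bsub>integer_group\<^esub>" if "P \<in> fg_modules R" "projective R P" for P
    proof -
      have "c v \<noteq> Suc k" using l(2) k by simp
      then have "multiplicity v k P 0" using multiplicity_projective fg_interval_sum[OF that(1)] that(2) by blast
      then show ?thesis using multiplicity_unique[OF d[OF that(1)]] by simp
    qed
  qed auto
  interpret g: group_hom "K0 R" integer_group g
    using g(1) by (simp add: group_hom_def group_hom_axioms_def K.group_axioms)
  have fg: "M \<in> fg_modules R" by (rule interval_in_fg[OF M])
  have "multiplicity v k M 1" using multiplicity_interval[OF M, of v k] k by simp
  then have "g (K0_class R M) = 1" using g(2)[OF fg] multiplicity_unique[OF d[OF fg]] by simp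
  then have "g (K0_class R M [^]\<^bsub>K0 R\<^esub> n) = n" using g.hom_int_pow[OF K0_class_closed[OF fg]] by simp
  then show "n = 0" using n g.hom_one by simp
qed

text \<open>The interval of length \<open>l\<close> at \<open>v\<close> is half of its projective
  cover, and its syzygy is the other half, starting at \<open>v + l\<close>, which is the same
  vertex. So its class is fixed by \<open>K0_L\<close> and nonzero.\<close>

lemma gl_dim_infinite:
  assumes l: "0 < l" "l mod N = 0" "c v = l + l"
  shows "gl_dim R = \<infinity>"
proof -
  obtain M :: "'a lmod" where M: "interval M v l" using interval_exists[of l v] l by auto
  have fg: "M \<in> fg_modules R" by (rule interval_in_fg[OF M])
  interpret K: comm_group "K0 R" by (rule comm_group_K0)
  have M': "interval M v ((v + l) - v)" "v \<le> v + l" using M by simp_all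
  obtain K :: "'a lmod" where K: "interval K (v + l) (f v - (v + l))" "K0_L R (K0_class R M) = K0_class R K"
    using K0_L_interval[OF M'] by blast
  have "(v + l) mod N = v mod N" using l(2) by (metis add.right_neutral mod_add_right_eq)
  then have fix1: "K0_L R (K0_class R M) = K0_class R M"
    using K0_class_interval[of K "v + l" l M v] K M l(3) by (simp add: f_def)
  have "(K0_L R ^^ n) (K0_class R M) = K0_class R M" for n by (induction n) (simp_all add: fix1)
  moreover have "K0_class R M \<noteq> \<one>\<^bsub>K0 R\<^esub>"
    using K0_class_infinite_order[OF M l(1), of 1] l K0_class_closed[OF fg] by auto
  ultimately have "\<not> pd_le R n M" for n using pd_le_class[OF _ fg] by metis
  then have "proj_dim R M = \<infinity>" unfolding proj_dim_def by (simp add: Inf_enat_def)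
  then show ?thesis unfolding gl_dim_def using SUP_upper[OF fg, of "proj_dim R"] by simp
qed

section \<open>Indecomposability and the phi-value of an interval\<close>

text \<open>The last nonzero multiple \<open>s\<close> of the generator by a power of
  \<open>A\<close> is reached from every nonzero element. With two nonzero summands it would lie in
  both of them.\<close>

lemma interval_indecomposable:
  fixes M :: "'a lmod"
  assumes M: "interval M u l" and l: "0 < l"
  shows "indecomposable R M"
  unfolding indecomposable_def
proof (intro conjI allI impI; (elim conjE)?)
  show lm: "left_module R M" using M by (simp add: interval_def)
  interpret M: left_module R M by fact
  obtain x where x: "x \<in> carrier M" "e u \<odot>\<^bsub>M\<^esub> x = x" "carrier M = {a \<odot>\<^bsub>M\<^esub> x | a. a \<in> carrier R}"
    "\<And>n. A [^] n \<odot>\<^bsub>M\<^esub> x = \<zero>\<^bsub>M\<^esub> \<longleftrightarrow> l \<le> n"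
    using M unfolding interval_def interval_gen_def by blast
  obtain k where k: "l = Suc k" using l gr0_implies_Suc by blast
  define s where "s = A [^] k \<odot>\<^bsub>M\<^esub> x"
  have s: "s \<in> carrier M" "s \<noteq> \<zero>\<^bsub>M\<^esub>" using x(1) x(4)[of k] k M.smult_closed by (auto simp: s_def)
  show "carrier M \<noteq> {\<zero>\<^bsub>M\<^esub>}" using s by blast
  have socle: "\<exists>b\<in>carrier R. b \<odot>\<^bsub>M\<^esub> y = s" if y: "y \<in> carrier M" "y \<noteq> \<zero>\<^bsub>M\<^esub>" for y
  proof -
    obtain a where a: "a \<in> carrier R" "y = a \<odot>\<^bsub>M\<^esub> x" using y(1) x(3) by auto
    \<comment> \<open>Extract powers of \<open>A\<close> from \<open>y\<close> until a nonzero
      scalar part shows. If none ever did, \<open>y\<close> would be a multiple of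
      \<open>A [^] l\<close> and hence zero.\<close>
    have "\<exists>j. j < l \<and> (\<exists>t\<in>T. \<exists>d\<in>carrier R. t \<noteq> \<zero> \<and> y = A [^] j \<odot>\<^bsub>M\<^esub> (t \<odot>\<^bsub>M\<^esub> x \<oplus>\<^bsub>M\<^esub> A \<odot>\<^bsub>M\<^esub> (d \<odot>\<^bsub>M\<^esub> x)))"
    proof (rule ccontr)
      assume none: "\<not> ?thesis"
      have "j \<le> l \<Longrightarrow> \<exists>b\<in>carrier R. y = A [^] j \<odot>\<^bsub>M\<^esub> (b \<odot>\<^bsub>M\<^esub> x)" for j
      proof (induction j)
        case 0
        then show ?case using a y(1) by (auto simp: M.smult_one intro!: bexI[of _ a])
      next
        case (Suc j)
        then obtain b where b: "b \<in> carrier R" "y = A [^] j \<odot>\<^bsub>M\<^esub> (b \<odot>\<^bsub>M\<^esub> x)" by auto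
        obtain t d where t: "t \<in> T" and d: "d \<in> carrier R"
          and bx: "b \<odot>\<^bsub>M\<^esub> x = t \<odot>\<^bsub>M\<^esub> x \<oplus>\<^bsub>M\<^esub> A \<odot>\<^bsub>M\<^esub> (d \<odot>\<^bsub>M\<^esub> x)"
          by (rule e_split_smult[OF lm x(1,2) b(1)])
        have "y = A [^] j \<odot>\<^bsub>M\<^esub> (t \<odot>\<^bsub>M\<^esub> x \<oplus>\<^bsub>M\<^esub> A \<odot>\<^bsub>M\<^esub> (d \<odot>\<^bsub>M\<^esub> x))" "j < l"
          using b(2) bx Suc.prems by simp_all
        then have "t = \<zero>" using none t d by blast
        then have "y = A [^] Suc j \<odot>\<^bsub>M\<^esub> (d \<odot>\<^bsub>M\<^esub> x)"
          using b(2) bx x(1) d by (simp add: M.smult_assoc1 M.smult_closed)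
        then show ?case using d by blast
      qed
      then obtain b where b: "b \<in> carrier R" "y = A [^] l \<odot>\<^bsub>M\<^esub> (b \<odot>\<^bsub>M\<^esub> x)" by blast
      then show False using pow_smult_zero[OF lm x(1) _ b(1), of l] x(4)[of l] y(2) by simp
    qed
    then obtain j t d where j: "j < l" and t: "t \<in> T" "t \<noteq> \<zero>" and d: "d \<in> carrier R"
      and yj: "y = A [^] j \<odot>\<^bsub>M\<^esub> (t \<odot>\<^bsub>M\<^esub> x \<oplus>\<^bsub>M\<^esub> A \<odot>\<^bsub>M\<^esub> (d \<odot>\<^bsub>M\<^esub> x))" by blast
    obtain t' where t': "t' \<in> T" "t' \<otimes> t = \<one>" using T_inv[OF t] by blast
    note tc = T_closed[OF t(1)] T_closed[OF t'(1)]
    \<comment> \<open>The exponent \<open>k - j\<close> raises the leading term of \<open>y\<close>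
      to the last layer and all later terms beyond it.\<close>
    have kj: "A [^] k = A [^] (k - j) \<otimes> A [^] j" using A_pow_add[of "k - j" j] j k by simp
    have "A [^] (k - j) \<odot>\<^bsub>M\<^esub> y = A [^] k \<odot>\<^bsub>M\<^esub> (t \<odot>\<^bsub>M\<^esub> x \<oplus>\<^bsub>M\<^esub> A \<odot>\<^bsub>M\<^esub> (d \<odot>\<^bsub>M\<^esub> x))"
      unfolding kj yj using tc x(1) d by (simp add: M.smult_assoc1 M.smult_closed)
    also have "\<dots> = A [^] k \<odot>\<^bsub>M\<^esub> (t \<odot>\<^bsub>M\<^esub> x) \<oplus>\<^bsub>M\<^esub> A [^] Suc k \<odot>\<^bsub>M\<^esub> (d \<odot>\<^bsub>M\<^esub> x)"
      using tc x(1) d by (simp add: M.smult_assoc1 M.smult_closed M.smult_r_distr)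
    also have "A [^] Suc k \<odot>\<^bsub>M\<^esub> (d \<odot>\<^bsub>M\<^esub> x) = \<zero>\<^bsub>M\<^esub>"
      using pow_smult_zero[OF lm x(1) _ d, of "Suc k"] x(4)[of "Suc k"] k by blast
    also have "A [^] k \<odot>\<^bsub>M\<^esub> (t \<odot>\<^bsub>M\<^esub> x) = t \<odot>\<^bsub>M\<^esub> s"
      using T_comm[OF t(1), of "A [^] k"] tc x(1) by (simp add: s_def flip: M.smult_assoc1)
    finally have "A [^] (k - j) \<odot>\<^bsub>M\<^esub> y = t \<odot>\<^bsub>M\<^esub> s" using tc s(1) M.smult_closed by simp
    then have "(t' \<otimes> A [^] (k - j)) \<odot>\<^bsub>M\<^esub> y = (t' \<otimes> t) \<odot>\<^bsub>M\<^esub> s" using tc y(1) s(1) by (simp add: M.smult_assoc1)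
    then show ?thesis using t'(2) s(1) tc M.smult_one by (metis A_closed m_closed nat_pow_closed)
  qed
  fix B C :: "'a lmod"
  assume B: "left_module R B" and C: "left_module R C" and iso: "lmod_iso R M (lmod_sum B C)"
  interpret B: left_module R B by fact
  interpret C: left_module R C by fact
  obtain h where h: "h \<in> lmod_hom R M (lmod_sum B C)" "bij_betw h (carrier M) (carrier (lmod_sum B C))"
    using iso by (auto simp: lmod_iso_def)
  have h0: "h s \<noteq> \<zero>\<^bsub>lmod_sum B C\<^esub>"
    using lmod_hom_inj_iff[OF lm lmod_sum_left_module[OF B C] h(1)] h(2) s by (auto simp: bij_betw_def simp del: lmod_sum_simps)
  show "carrier B = {\<zero>\<^bsub>B\<^esub>} \<or> carrier C = {\<zero>\<^bsub>C\<^esub>}"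
  proof (rule ccontr)
    assume "\<not> ?thesis"
    then obtain b d where bd: "b \<in> carrier B" "b \<noteq> \<zero>\<^bsub>B\<^esub>" "d \<in> carrier C" "d \<noteq> \<zero>\<^bsub>C\<^esub>"
      using B.M.zero_closed C.M.zero_closed by blast
    have "\<exists>y\<in>carrier M. h y = z" if "z \<in> carrier (lmod_sum B C)" for z
      using h(2) that unfolding bij_betw_def by (metis imageE)
    then obtain y1 y2 where y: "y1 \<in> carrier M" "h y1 = (b, \<zero>\<^bsub>C\<^esub>)" "y2 \<in> carrier M" "h y2 = (\<zero>\<^bsub>B\<^esub>, d)"
      using bd by (metis B.M.zero_closed C.M.zero_closed SigmaI lmod_sum_simps(1))
    have "h \<zero>\<^bsub>M\<^esub> = (\<zero>\<^bsub>B\<^esub>, \<zero>\<^bsub>C\<^esub>)" using lmod_hom_zero[OF lm lmod_sum_left_module[OF B C] h(1)] by simp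
    then have "y1 \<noteq> \<zero>\<^bsub>M\<^esub>" "y2 \<noteq> \<zero>\<^bsub>M\<^esub>" using y bd by auto
    then obtain a1 a2 where a: "a1 \<in> carrier R" "a1 \<odot>\<^bsub>M\<^esub> y1 = s" "a2 \<in> carrier R" "a2 \<odot>\<^bsub>M\<^esub> y2 = s"
      using socle y by meson
    have "h s = (a1 \<odot>\<^bsub>B\<^esub> b, \<zero>\<^bsub>C\<^esub>)" using lmod_hom_smult[OF h(1) a(1) y(1)] a y by simp
    moreover have "h s = (\<zero>\<^bsub>B\<^esub>, a2 \<odot>\<^bsub>C\<^esub> d)" using lmod_hom_smult[OF h(1) a(3) y(3)] a y by simp
    ultimately show False using h0 by simp
  qed
qed

text \<open>\<open>odd\<close> says that after \<open>2 * s + 1\<close> syzygies an interval remains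
  that is neither zero nor projective, \<open>even\<close> that the next one is projective. Since
  \<open>X\<close> is indecomposable, its span is generated by one class, whose images have infinite
  order up to step \<open>2 * s + 1\<close> and vanish afterwards; so the rank drops exactly at
  \<open>2 * Suc s\<close>.\<close>

lemma phi_interval:
  fixes X :: "'a lmod"
  assumes X: "interval X i (j - i)" and ij: "i < j"
    and odd: "(f ^^ s) j < (f ^^ Suc s) i" "(f ^^ Suc s) i \<noteq> f ((f ^^ s) j)"
    and even: "(f ^^ Suc s) j = f ((f ^^ Suc s) i)"
  shows "phi R X = 2 * Suc s"
proof -
  let ?L = "K0_L R"
  interpret K: comm_group "K0 R" by (rule comm_group_K0)
  have fg: "X \<in> fg_modules R" and lm: "left_module R X" using X interval_in_fg by (auto simp: interval_def)
  have hom: "group_hom (K0 R) (K0 R) (?L ^^ n)" for n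
    using K0_L_pow_hom by (simp add: group_hom_def group_hom_axioms_def K.group_axioms)
  obtain Y :: "'a lmod" where Y: "interval Y ((f ^^ s) i) ((f ^^ s) j - (f ^^ s) i)"
    "(?L ^^ (2 * s)) (K0_class R X) = K0_class R Y" "(f ^^ s) i \<le> (f ^^ s) j"
    using K0_L_pow_interval[OF X] ij by (metis less_imp_le)
  obtain Z :: "'a lmod" where Z: "interval Z ((f ^^ s) j) (f ((f ^^ s) i) - (f ^^ s) j)"
    "?L (K0_class R Y) = K0_class R Z" "(f ^^ s) j \<le> f ((f ^^ s) i)"
    using K0_L_interval[OF Y(1,3)] by blast
  obtain P :: "'a lmod" where P: "interval P (f ((f ^^ s) i)) (f ((f ^^ s) j) - f ((f ^^ s) i))"
    "?L (K0_class R Z) = K0_class R P" "f ((f ^^ s) i) \<le> f ((f ^^ s) j)"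
    using K0_L_interval[OF Z(1,3)] by blast
  have LZ: "(?L ^^ Suc (2 * s)) (K0_class R X) = K0_class R Z" using Y(2) Z(2) by simp
  have "interval P (f ((f ^^ s) i)) (c (f ((f ^^ s) i)))" using P(1) even by (simp add: f_def)
  then have P1: "K0_class R P = \<one>\<^bsub>K0 R\<^esub>" using K0_class_projective interval_in_fg interval_projective by blast
  have L_even: "(?L ^^ (2 * Suc s)) (K0_class R X) = \<one>\<^bsub>K0 R\<^esub>" using LZ P(2) P1 by simp
  \<comment> \<open>\<open>Z\<close> has positive length by the first part of \<open>odd\<close>;
    its end differs from the end of the projective at its start by the second.\<close>
  have Z_inf: "n = 0" if "K0_class R Z [^]\<^bsub>K0 R\<^esub> (n::int) = \<one>\<^bsub>K0 R\<^esub>" for n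
    by (rule K0_class_infinite_order[OF Z(1) _ _ that]) (use odd in \<open>auto simp: f_def\<close>)
  define G where "G = {K0_class R X' | X'. X' \<in> fg_modules R \<and> indecomposable R X' \<and>
      (\<exists>Y \<in> fg_modules R. lmod_iso R X (lmod_sum X' Y))}"
  have span: "add_span R X = generate (K0 R) G" by (simp add: add_span_def G_def)
  have ind: "indecomposable R X" by (rule interval_indecomposable[OF X]) (use ij in simp)
  define O0 where "O0 = X\<lparr>carrier := {\<zero>\<^bsub>X\<^esub>}\<rparr>"
  note O0 = zero_submodule_fg[OF lm O0_def]
  have "lmod_iso R X (lmod_sum X O0)"
    by (rule lmod_iso_sym[OF lmod_sum_left_module[OF lm O0(1)] lmod_iso_sum_zero[OF lm O0(1,3)]])
  moreover have "O0 \<in> fg_modules R" using O0 by (simp add: fg_modules_def)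
  ultimately have XG: "K0_class R X \<in> G" using fg ind unfolding G_def by blast
  \<comment> \<open>An indecomposable summand of the indecomposable \<open>X\<close> has a zero
    complement, so its class is that of \<open>X\<close>.\<close>
  have G: "x = K0_class R X" if x: "x \<in> G" for x
  proof -
    obtain X' Y where X': "x = K0_class R X'" "X' \<in> fg_modules R" "indecomposable R X'" "Y \<in> fg_modules R"
      "lmod_iso R X (lmod_sum X' Y)" using x by (auto simp: G_def)
    have lm': "left_module R X'" "left_module R Y" using X' by (auto simp: fg_modules_def)
    have "carrier Y = {\<zero>\<^bsub>Y\<^esub>}" using ind X'(3,5) lm' unfolding indecomposable_def by blast
    then have "lmod_iso R X X'" using lmod_iso_trans[OF X'(5) lmod_iso_sum_zero[OF lm']] by blast
    then show ?thesis using K0_class_iso[OF fg X'(2)] X'(1) by simp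
  qed
  have X_span: "K0_class R X \<in> add_span R X" unfolding span by (rule generate.incl[OF XG])
  have rank_zero: "ab_rank (K0 R) ((?L ^^ (2 * Suc s + n)) ` add_span R X) = 0" for n
  proof -
    interpret h: group_hom "K0 R" "K0 R" "?L ^^ (2 * Suc s + n)" by (rule hom)
    interpret hn: group_hom "K0 R" "K0 R" "?L ^^ n" by (rule hom)
    have "(?L ^^ (2 * Suc s + n)) (K0_class R X) = (?L ^^ n) ((?L ^^ (2 * Suc s)) (K0_class R X))"
      by (simp only: add.commute[of "2 * Suc s"] funpow_add comp_apply)
    also have "\<dots> = \<one>\<^bsub>K0 R\<^esub>" unfolding L_even by (rule hn.hom_one)
    finally have "G \<subseteq> kernel (K0 R) (K0 R) (?L ^^ (2 * Suc s + n))"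
      using G K0_class_closed[OF fg] by (auto simp: kernel_def simp del: funpow.simps mult_Suc_right)
    then have "add_span R X \<subseteq> kernel (K0 R) (K0 R) (?L ^^ (2 * Suc s + n))"
      unfolding span by (rule K.generate_subgroup_incl[OF _ h.subgroup_kernel])
    then have "(?L ^^ (2 * Suc s + n)) ` add_span R X = {\<one>\<^bsub>K0 R\<^esub>}"
      using X_span unfolding kernel_def by blast
    then show ?thesis using ab_rank_one[OF comm_group_K0] by simp
  qed
  have rank_pos: "ab_rank (K0 R) ((?L ^^ t) ` add_span R X) > 0" if t: "t < 2 * Suc s" for t
  proof (rule ab_rank_pos[OF comm_group_K0])
    show "(?L ^^ t) (K0_class R X) \<in> (?L ^^ t) ` add_span R X" using X_span by blast
    show "(?L ^^ t) (K0_class R X) \<in> carrier (K0 R)" using hom_in_carrier[OF K0_L_pow_hom K0_class_closed[OF fg]] .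
    fix n :: int assume n: "(?L ^^ t) (K0_class R X) [^]\<^bsub>K0 R\<^esub> n = \<one>\<^bsub>K0 R\<^esub>"
    interpret h: group_hom "K0 R" "K0 R" "?L ^^ (Suc (2 * s) - t)" by (rule hom)
    interpret ht: group_hom "K0 R" "K0 R" "?L ^^ t" by (rule hom)
    \<comment> \<open>A relation for an earlier image is pushed forward to the class of
      \<open>Z\<close>, which admits none.\<close>
    have "Suc (2 * s) = (Suc (2 * s) - t) + t" using t by simp
    then have "K0_class R Z = (?L ^^ (Suc (2 * s) - t)) ((?L ^^ t) (K0_class R X))"
      unfolding LZ[symmetric] by (metis comp_apply funpow_add)
    then have "K0_class R Z [^]\<^bsub>K0 R\<^esub> n = \<one>\<^bsub>K0 R\<^esub>"
      using h.hom_int_pow[OF ht.hom_closed[OF K0_class_closed[OF fg]], of n] n h.hom_one by simp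
    then show "n = 0" by (rule Z_inf)
  qed
  show ?thesis
    unfolding phi_def
  proof (rule Least_equality)
    show "\<forall>j\<ge>1. ab_rank (K0 R) ((?L ^^ (2 * Suc s)) ` add_span R X) = ab_rank (K0 R) ((?L ^^ (2 * Suc s + j)) ` add_span R X)"
      using rank_zero[of 0] rank_zero by simp
    fix t assume t: "\<forall>j\<ge>1. ab_rank (K0 R) ((?L ^^ t) ` add_span R X) = ab_rank (K0 R) ((?L ^^ (t + j)) ` add_span R X)"
    show "2 * Suc s \<le> t"
    proof (rule ccontr)
      assume "\<not> 2 * Suc s \<le> t"
      then have *: "t < 2 * Suc s" "1 \<le> 2 * Suc s - t" "t + (2 * Suc s - t) = 2 * Suc s" by auto
      have "ab_rank (K0 R) ((?L ^^ t) ` add_span R X) = 0"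
        using t[rule_format, OF *(2)] rank_zero[of 0] unfolding *(3) by simp
      then show False using rank_pos[OF *(1)] by simp
    qed
  qed
qed

end

subsection \<open>The path algebra of the cyclic quiver\<close>

text \<open>Reduces statements stable under addition to multiples of single paths. The set
  \<open>S\<close> records where paths may start, so that supports stay controlled along the
  induction.\<close>

lemma poly_mapping_single_induct [consumes 1, case_names zero single add]:
  fixes x :: "'a \<Rightarrow>\<^sub>0 'b::comm_monoid_add"
  assumes "Poly_Mapping.keys x \<subseteq> S"
    and "P 0" and "\<And>k v. k \<in> S \<Longrightarrow> P (Poly_Mapping.single k v)"
    and "\<And>x y. \<lbrakk>Poly_Mapping.keys x \<subseteq> S; Poly_Mapping.keys y \<subseteq> S; P x; P y\<rbrakk> \<Longrightarrow> P (x + y)"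
  shows "P x"
proof -
  have "Poly_Mapping.keys (\<Sum>k\<in>B. Poly_Mapping.single k (Poly_Mapping.lookup x k)) \<subseteq> S
      \<and> P (\<Sum>k\<in>B. Poly_Mapping.single k (Poly_Mapping.lookup x k))"
    if "finite B" "B \<subseteq> S" for B
    using that
  proof (induction B)
    case (insert k B)
    let ?s = "Poly_Mapping.single k (Poly_Mapping.lookup x k)"
      and ?r = "\<Sum>k\<in>B. Poly_Mapping.single k (Poly_Mapping.lookup x k)"
    have "Poly_Mapping.keys ?s \<subseteq> S" using insert.prems by simp
    moreover have "Poly_Mapping.keys ?r \<subseteq> S" "P ?r" "P ?s" using insert assms(3) by auto
    ultimately have "P (?s + ?r)" "Poly_Mapping.keys (?s + ?r) \<subseteq> S"
      using assms(4) Poly_Mapping.keys_add[of ?s ?r] by blast+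
    then show ?case using insert.hyps by simp
  qed (use assms(2) in simp)
  moreover have "(\<Sum>k\<in>Poly_Mapping.keys x. Poly_Mapping.single k (Poly_Mapping.lookup x k)) = x"
    by (rule poly_mapping_eqI) (simp add: lookup_sum lookup_single when_def in_keys_iff)
  ultimately show ?thesis using assms(1) by (metis finite_keys)
qed

context
  fixes K :: "'k::field itself" and N :: nat
  assumes N_pos: "0 < N"
begin

abbreviation "PA \<equiv> cyclic_path_algebra K N"
abbreviation "V \<equiv> {1..N} \<times> (UNIV :: nat set)"
abbreviation sgl :: "nat \<times> nat \<Rightarrow> 'k \<Rightarrow> (nat \<times> nat \<Rightarrow>\<^sub>0 'k)" where "sgl \<equiv> Poly_Mapping.single"

lemma PA_simps:
  "x \<in> carrier PA \<longleftrightarrow> Poly_Mapping.keys x \<subseteq> V" "x \<oplus>\<^bsub>PA\<^esub> y = x + y" "\<zero>\<^bsub>PA\<^esub> = 0"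
  "\<one>\<^bsub>PA\<^esub> = (\<Sum>i\<in>{1..N}. sgl (i, 0) 1)"
  by (simp_all add: cyclic_path_algebra_def)

lemma PA_mult: "y \<otimes>\<^bsub>PA\<^esub> x = (\<Sum>q\<in>Poly_Mapping.keys y. \<Sum>p\<in>Poly_Mapping.keys x.
    if path_target N p = fst q
    then sgl (fst p, snd p + snd q) (Poly_Mapping.lookup y q * Poly_Mapping.lookup x p) else 0)"
  by (simp add: cyclic_path_algebra_def)

lemma PA_mult_single: "sgl q b \<otimes>\<^bsub>PA\<^esub> sgl p a
    = (if path_target N p = fst q then sgl (fst p, snd p + snd q) (b * a) else 0)"
  unfolding PA_mult by (cases "a = 0"; cases "b = 0") auto

lemma PA_mult_add_left: "(y + y') \<otimes>\<^bsub>PA\<^esub> x = y \<otimes>\<^bsub>PA\<^esub> x + y' \<otimes>\<^bsub>PA\<^esub> x"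
  unfolding PA_mult
  by (rule setsum_keys_plus_distrib[where f = "\<lambda>q b. \<Sum>p\<in>Poly_Mapping.keys x. if path_target N p = fst q
      then sgl (fst p, snd p + snd q) (b * Poly_Mapping.lookup x p) else 0"])
     (auto simp: distrib_right single_add sum.distrib[symmetric] intro!: sum.cong sum.neutral)

lemma PA_mult_add_right: "y \<otimes>\<^bsub>PA\<^esub> (x + x') = y \<otimes>\<^bsub>PA\<^esub> x + y \<otimes>\<^bsub>PA\<^esub> x'"
  unfolding PA_mult sum.distrib[symmetric]
  by (rule sum.cong[OF refl], rule setsum_keys_plus_distrib[where f = "\<lambda>p a. if path_target N p = fst q
      then sgl (fst p, snd p + snd q) (Poly_Mapping.lookup y q * a) else 0" for q])
     (auto simp: distrib_left single_add)

lemma PA_mult_zero: "0 \<otimes>\<^bsub>PA\<^esub> x = 0" "x \<otimes>\<^bsub>PA\<^esub> 0 = 0"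
  by (simp_all add: PA_mult)

lemma PA_mult_sum_left: "(\<Sum>i\<in>B. g i) \<otimes>\<^bsub>PA\<^esub> x = (\<Sum>i\<in>B. g i \<otimes>\<^bsub>PA\<^esub> x)"
  by (induction B rule: infinite_finite_induct) (simp_all add: PA_mult_zero PA_mult_add_left)

lemma PA_mult_sum_right: "x \<otimes>\<^bsub>PA\<^esub> (\<Sum>i\<in>B. g i) = (\<Sum>i\<in>B. x \<otimes>\<^bsub>PA\<^esub> g i)"
  by (induction B rule: infinite_finite_induct) (simp_all add: PA_mult_zero PA_mult_add_right)

lemma PA_mult_keys:
  assumes S: "\<And>p q. \<lbrakk>p \<in> P; q \<in> Q; path_target N p = fst q\<rbrakk> \<Longrightarrow> (fst p, snd p + snd q) \<in> S"
    and y: "Poly_Mapping.keys y \<subseteq> Q" and x: "Poly_Mapping.keys x \<subseteq> P"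
  shows "Poly_Mapping.keys (y \<otimes>\<^bsub>PA\<^esub> x) \<subseteq> S"
  using y
proof (induction y rule: poly_mapping_single_induct)
  case (single q b)
  note q = single
  show ?case
    using x
  proof (induction x rule: poly_mapping_single_induct)
    case (single p a)
    then show ?case using S[OF single q] by (auto simp: PA_mult_single)
  next
    case (add x x')
    show ?case unfolding PA_mult_add_right by (rule subset_trans[OF Poly_Mapping.keys_add Un_least[OF add.IH]])
  qed (simp add: PA_mult_zero)
next
  case (add y y')
  show ?case unfolding PA_mult_add_left by (rule subset_trans[OF Poly_Mapping.keys_add Un_least[OF add.IH]])
qed (simp add: PA_mult_zero)

lemma path_target_append:
  assumes "path_target N p = fst q"
  shows "path_target N (fst p, snd p + m) = path_target N (fst q, m)"
  unfolding path_target_def assms[symmetric] by (simp add: path_target_def add.assoc mod_add_left_eq)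

lemma PA_m_assoc: "(z \<otimes>\<^bsub>PA\<^esub> y) \<otimes>\<^bsub>PA\<^esub> x = z \<otimes>\<^bsub>PA\<^esub> (y \<otimes>\<^bsub>PA\<^esub> x)"
  using subset_UNIV[of "Poly_Mapping.keys z"]
proof (induction z rule: poly_mapping_single_induct)
  case (single r c)
  show ?case
    using subset_UNIV[of "Poly_Mapping.keys y"]
  proof (induction y rule: poly_mapping_single_induct)
    case (single q b)
    show ?case
      using subset_UNIV[of "Poly_Mapping.keys x"]
    proof (induction x rule: poly_mapping_single_induct)
      case (single p a)
      show ?case
        using path_target_append[of p q "snd q"]
        by (simp add: PA_mult_single PA_mult_zero add.assoc mult.assoc)
    qed (simp_all add: PA_mult_zero PA_mult_add_right)
  qed (simp_all add: PA_mult_zero PA_mult_add_right PA_mult_add_left)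
qed (simp_all add: PA_mult_zero PA_mult_add_left)

lemma path_target_trivial: "i \<in> {1..N} \<Longrightarrow> path_target N (i, 0) = i"
  by (auto simp: path_target_def)

lemma path_target_in: "path_target N p \<in> {1..N}"
  using N_pos by (simp add: path_target_def Suc_leI)

text \<open>The ground field inside the path algebra, as multiples of the unit.\<close>

definition scal :: "'k \<Rightarrow> (nat \<times> nat \<Rightarrow>\<^sub>0 'k)"
  where "scal a = (\<Sum>i\<in>{1..N}. sgl (i, 0) a)"

lemma scal_mult_single: "scal a \<otimes>\<^bsub>PA\<^esub> sgl p b = sgl p (a * b)"
proof -
  have "scal a \<otimes>\<^bsub>PA\<^esub> sgl p b = (\<Sum>i\<in>{1..N}. if path_target N p = i then sgl p (a * b) else 0)"
    by (simp add: scal_def PA_mult_sum_left PA_mult_single cong: if_cong)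
  then show ?thesis using path_target_in[of p] by simp
qed

lemma single_mult_scal:
  assumes "p \<in> V" shows "sgl p b \<otimes>\<^bsub>PA\<^esub> scal a = sgl p (a * b)"
proof -
  have "sgl p b \<otimes>\<^bsub>PA\<^esub> scal a = (\<Sum>i\<in>{1..N}. if i = fst p then sgl p (a * b) else 0)"
    unfolding scal_def PA_mult_sum_right
    by (intro sum.cong refl) (auto simp: PA_mult_single path_target_trivial mult.commute)
  then show ?thesis using assms by auto
qed

lemma sum_sgl_carrier: "(\<Sum>i\<in>{1..N}. sgl (i, l) a) \<in> carrier PA"
proof -
  have "Poly_Mapping.keys (\<Sum>i\<in>{1..N}. sgl (i, l) a) \<subseteq> (\<Union>i\<in>{1..N}. Poly_Mapping.keys (sgl (i, l) a))"
    by (rule Poly_Mapping.keys_sum)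
  then show ?thesis by (auto simp: PA_simps split: if_splits)
qed

lemma scal_carrier: "scal a \<in> carrier PA"
  unfolding scal_def by (rule sum_sgl_carrier)

lemma scal_one: "scal 1 = \<one>\<^bsub>PA\<^esub>"
  by (simp add: scal_def PA_simps)

lemma scal_mult:
  assumes "x \<in> carrier PA" shows "scal a \<otimes>\<^bsub>PA\<^esub> x = x \<otimes>\<^bsub>PA\<^esub> scal a"
  using assms unfolding PA_simps
  by (induction x rule: poly_mapping_single_induct)
     (simp_all add: PA_mult_zero scal_mult_single single_mult_scal PA_mult_add_left PA_mult_add_right)

lemma scal_add: "scal (a + b) = scal a + scal b"
  by (simp add: scal_def single_add sum.distrib)

lemma scal_scal: "scal a \<otimes>\<^bsub>PA\<^esub> scal b = scal (a * b)"
  unfolding scal_def[of b] by (simp add: PA_mult_sum_right scal_mult_single) (simp add: scal_def)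

lemma PA_l_one:
  assumes "x \<in> carrier PA" shows "\<one>\<^bsub>PA\<^esub> \<otimes>\<^bsub>PA\<^esub> x = x"
  using assms unfolding PA_simps(1) scal_one[symmetric]
  by (induction x rule: poly_mapping_single_induct)
     (simp_all add: PA_mult_zero scal_mult_single PA_mult_add_right)

lemma ring_PA: "ring PA"
proof (rule ringI)
  show "abelian_group PA"
  proof (rule abelian_groupI)
    show "\<exists>y\<in>carrier PA. y \<oplus>\<^bsub>PA\<^esub> x = \<zero>\<^bsub>PA\<^esub>" if "x \<in> carrier PA" for x
      using that by (intro bexI[of _ "- x"]) (simp_all add: PA_simps)
  qed (auto simp: PA_simps dest: subsetD[OF Poly_Mapping.keys_add])
  show "monoid PA"
  proof (rule monoidI)
    show "x \<otimes>\<^bsub>PA\<^esub> y \<in> carrier PA" if "x \<in> carrier PA" "y \<in> carrier PA" for x y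
      unfolding PA_simps(1) by (rule PA_mult_keys[of V V]) (use that in \<open>auto simp: PA_simps\<close>)
    show "\<one>\<^bsub>PA\<^esub> \<in> carrier PA" using scal_carrier[of 1] by (simp add: scal_one)
    show "x \<otimes>\<^bsub>PA\<^esub> \<one>\<^bsub>PA\<^esub> = x" if "x \<in> carrier PA" for x
      using scal_mult[OF that, of 1] PA_l_one[OF that] by (simp add: scal_one)
  qed (simp_all add: PA_l_one PA_m_assoc)
qed (simp_all add: PA_mult_add_left PA_mult_add_right PA_simps(2))

subsection \<open>The ideal of relations\<close>

text \<open>The path contains a relation as a subpath, where \<open>d\<close> is the number of
  arrows travelled before it begins.\<close>

definition has_relation :: "(nat \<times> nat) set \<Rightarrow> nat \<times> nat \<Rightarrow> bool"
  where "has_relation S p \<longleftrightarrow> (\<exists>\<rho>\<in>S. \<exists>d. path_target N (fst p, d) = fst \<rho> \<and> d + snd \<rho> \<le> snd p)"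

lemma has_relation_mono: "\<lbrakk>has_relation S (u, l); l \<le> l'\<rbrakk> \<Longrightarrow> has_relation S (u, l')"
  unfolding has_relation_def by (auto intro: order_trans)

lemma has_relation_prepend:
  assumes "path_target N p = fst q" "has_relation S q"
  shows "has_relation S (fst p, snd p + snd q)"
proof -
  obtain \<rho> d where \<rho>: "\<rho> \<in> S" "path_target N (fst q, d) = fst \<rho>" "d + snd \<rho> \<le> snd q"
    using assms(2) by (auto simp: has_relation_def)
  have "path_target N (fst p, snd p + d) = path_target N (fst q, d)"
    by (rule path_target_append[OF assms(1)])
  then show ?thesis using \<rho> unfolding has_relation_def by (intro bexI[of _ \<rho>] exI[of _ "snd p + d"]) auto
qed

text \<open>The ideal is monomial: combinations of paths containing a relation already form an
  ideal, since prolonging a path at either end preserves the property. This turns irredundance and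
  vanishing in the quotient into combinatorics.\<close>

lemma single_in_path_ideal_iff:
  assumes S: "S \<subseteq> V" and p: "p \<in> V"
  shows "sgl p 1 \<in> path_ideal K N S \<longleftrightarrow> has_relation S p"
proof -
  interpret ring PA by (rule ring_PA)
  define C where "C = {p \<in> V. has_relation S p}"
  define J where "J = {x :: (nat \<times> nat \<Rightarrow>\<^sub>0 'k). Poly_Mapping.keys x \<subseteq> C}"
  have gens: "(\<lambda>p. sgl p 1) ` S \<subseteq> carrier PA" using S by (auto simp: PA_simps)
  have J: "ideal J PA"
  proof (rule idealI[OF ring_PA])
    show "subgroup J (add_monoid PA)"
    proof (rule add.subgroupI)
      show "J \<subseteq> carrier PA" by (auto simp: J_def C_def PA_simps)
      show "J \<noteq> {}" by (auto simp: J_def intro!: exI[of _ 0])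
      show "\<ominus>\<^bsub>PA\<^esub> x \<in> J" if "x \<in> J" for x
      proof -
        have "\<ominus>\<^bsub>PA\<^esub> x = - x"
          by (rule minus_equality) (use that in \<open>auto simp: PA_simps J_def C_def\<close>)
        then show ?thesis using that by (simp add: J_def)
      qed
      show "x \<oplus>\<^bsub>PA\<^esub> y \<in> J" if "x \<in> J" "y \<in> J" for x y
        using that Poly_Mapping.keys_add[of x y] by (auto simp: J_def PA_simps)
    qed
    show "x \<otimes>\<^bsub>PA\<^esub> a \<in> J" if "a \<in> J" "x \<in> carrier PA" for a x
      unfolding J_def mem_Collect_eq
    proof (rule PA_mult_keys[of C V])
      show "Poly_Mapping.keys x \<subseteq> V" "Poly_Mapping.keys a \<subseteq> C" using that by (auto simp: PA_simps J_def)
      show "(fst p, snd p + snd q) \<in> C" if "p \<in> C" "q \<in> V" for p q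
        using that has_relation_mono[of S "fst p" "snd p"] by (auto simp: C_def)
    qed
    show "a \<otimes>\<^bsub>PA\<^esub> x \<in> J" if "a \<in> J" "x \<in> carrier PA" for a x
      unfolding J_def mem_Collect_eq
    proof (rule PA_mult_keys[of V C])
      show "Poly_Mapping.keys a \<subseteq> C" "Poly_Mapping.keys x \<subseteq> V" using that by (auto simp: PA_simps J_def)
      show "(fst p, snd p + snd q) \<in> C" if "p \<in> V" "q \<in> C" "path_target N p = fst q" for p q
        using that has_relation_prepend[of p q] by (auto simp: C_def)
    qed
  qed
  have rel: "has_relation S \<rho>" if "\<rho> \<in> S" for \<rho>
    unfolding has_relation_def using that S path_target_trivial
    by (intro bexI[of _ \<rho>] exI[of _ 0]) auto
  show ?thesis
  proof
    assume "sgl p 1 \<in> path_ideal K N S"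
    moreover have "path_ideal K N S \<subseteq> J"
      unfolding path_ideal_def by (rule genideal_minimal[OF J]) (use S rel in \<open>auto simp: J_def C_def\<close>)
    ultimately show "has_relation S p" by (auto simp: J_def C_def)
  next
    assume "has_relation S p"
    then obtain \<rho> d where \<rho>: "\<rho> \<in> S" "path_target N (fst p, d) = fst \<rho>" "d + snd \<rho> \<le> snd p"
      by (auto simp: has_relation_def)
    have I: "ideal (path_ideal K N S) PA" unfolding path_ideal_def by (rule genideal_ideal[OF gens])
    have "sgl \<rho> 1 \<in> path_ideal K N S"
      unfolding path_ideal_def using genideal_self[OF gens] \<rho>(1) by auto
    \<comment> \<open>The path is assembled around the relation: first the \<open>d\<close> arrows
      before it, then the arrows left over after it.\<close>
    then have "sgl \<rho> 1 \<otimes>\<^bsub>PA\<^esub> sgl (fst p, d) 1 \<in> path_ideal K N S"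
      by (rule ideal.I_r_closed[OF I]) (use p in \<open>auto simp: PA_simps\<close>)
    then have "sgl (path_target N (fst p, d + snd \<rho>), snd p - d - snd \<rho>) 1 \<otimes>\<^bsub>PA\<^esub> (sgl \<rho> 1 \<otimes>\<^bsub>PA\<^esub> sgl (fst p, d) 1) \<in> path_ideal K N S"
      by (rule ideal.I_l_closed[OF I]) (use path_target_in in \<open>auto simp: PA_simps simp del: atLeastAtMost_iff\<close>)
    then show "sgl p 1 \<in> path_ideal K N S" using \<rho> by (simp add: PA_mult_single)
  qed
qed

subsection \<open>Nakayama algebras as rings with a cyclic shift\<close>

context
  fixes S :: "(nat \<times> nat) set"
  assumes S: "S \<subseteq> {1..N} \<times> {2..}" and S_nonempty: "S \<noteq> {}"
begin

abbreviation "quot_class x \<equiv> path_ideal K N S +>\<^bsub>PA\<^esub> x"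

text \<open>Indices of the locale are residues starting from 0, vertices start from 1; hence the
  shift by one.\<close>

definition nak_e :: "nat \<Rightarrow> (nat \<times> nat \<Rightarrow>\<^sub>0 'k) set"
  where "nak_e i = quot_class (sgl (i mod N + 1, 0) 1)"

definition nak_A :: "(nat \<times> nat \<Rightarrow>\<^sub>0 'k) set"
  where "nak_A = quot_class (\<Sum>i\<in>{1..N}. sgl (i, 1) 1)"

definition nak_T :: "(nat \<times> nat \<Rightarrow>\<^sub>0 'k) set set"
  where "nak_T = range (\<lambda>a. quot_class (scal a))"

text \<open>The Kupisch series: the length of the shortest path from the vertex that
  vanishes.\<close>

definition nak_c :: "nat \<Rightarrow> nat"
  where "nak_c i = (LEAST m. has_relation S (i mod N + 1, m))"

lemma nak_c_iff: "has_relation S (i mod N + 1, m) \<longleftrightarrow> nak_c i \<le> m"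
proof -
  obtain s l where sl: "(s, l) \<in> S" using S_nonempty by auto
  then have s: "1 \<le> s" "s \<le> N" using S by auto
  \<comment> \<open>Number of arrows from the vertex of index \<open>i\<close> to the source
    \<open>s\<close> of a relation, with one extra turn that keeps the difference
    nonnegative.\<close>
  define d where "d = N + (s - 1) - i mod N"
  have "i mod N < N" using N_pos by simp
  then have "i mod N + d = N + (s - 1)" by (simp add: d_def)
  then have "path_target N (i mod N + 1, d) = (N + (s - 1)) mod N + 1" by (simp add: path_target_def)
  also have "\<dots> = s" using s by (simp only: mod_add_self1) simp
  finally have "path_target N (i mod N + 1, d) = s" .
  then have "has_relation S (i mod N + 1, d + l)"
    using sl unfolding has_relation_def by (intro bexI[of _ "(s, l)"] exI[of _ d]) auto
  then have "has_relation S (i mod N + 1, nak_c i)" unfolding nak_c_def by (rule LeastI)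
  then show ?thesis using has_relation_mono[of S "i mod N + 1" "nak_c i" m] Least_le[of "\<lambda>m. has_relation S (i mod N + 1, m)" m]
    by (auto simp: nak_c_def)
qed

lemma path_ideal_ideal: "ideal (path_ideal K N S) PA"
proof -
  interpret ring PA by (rule ring_PA)
  show ?thesis unfolding path_ideal_def by (rule genideal_ideal) (use S in \<open>auto simp: PA_simps\<close>)
qed

lemma quot_class_mult:
  assumes "x \<in> carrier PA" "y \<in> carrier PA"
  shows "quot_class (x \<otimes>\<^bsub>PA\<^esub> y) = quot_class x \<otimes>\<^bsub>PA Quot path_ideal K N S\<^esub> quot_class y"
  using ring_hom_mult[OF ideal.rcos_ring_hom[OF path_ideal_ideal] assms] .

lemma quot_class_add:
  assumes "x \<in> carrier PA" "y \<in> carrier PA"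
  shows "quot_class (x + y) = quot_class x \<oplus>\<^bsub>PA Quot path_ideal K N S\<^esub> quot_class y"
  using ring_hom_add[OF ideal.rcos_ring_hom[OF path_ideal_ideal] assms] by (simp add: PA_simps)

lemma quot_class_one: "quot_class \<one>\<^bsub>PA\<^esub> = \<one>\<^bsub>PA Quot path_ideal K N S\<^esub>"
  using ring_hom_one[OF ideal.rcos_ring_hom[OF path_ideal_ideal]] .

lemma quot_carrier: "carrier (PA Quot path_ideal K N S) = quot_class ` carrier PA"
  by (auto simp: FactRing_def A_RCOSETS_def')

lemma quot_class_zero_iff:
  assumes "x \<in> carrier PA"
  shows "quot_class x = \<zero>\<^bsub>PA Quot path_ideal K N S\<^esub> \<longleftrightarrow> x \<in> path_ideal K N S"
proof -
  interpret ring PA by (rule ring_PA)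
  interpret I: ideal "path_ideal K N S" PA by (rule path_ideal_ideal)
  show ?thesis using assms I.rcos_const_imp_mem I.a_rcos_const by (auto simp: FactRing_def)
qed

lemma arrows_mult_single:
  assumes "p \<in> V" shows "(\<Sum>i\<in>{1..N}. sgl (i, 1) 1) \<otimes>\<^bsub>PA\<^esub> sgl p a = sgl (fst p, Suc (snd p)) a"
proof -
  have "(\<Sum>i\<in>{1..N}. sgl (i, 1) 1) \<otimes>\<^bsub>PA\<^esub> sgl p a
      = (\<Sum>i\<in>{1..N}. if path_target N p = i then sgl (fst p, Suc (snd p)) a else 0)"
    by (simp add: PA_mult_sum_left PA_mult_single cong: if_cong)
  then show ?thesis using path_target_in[of p] by simp
qed

text \<open>Multiplying by the arrows on the right prolongs a path at its start, so the new source
  is one vertex earlier.\<close>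

definition pred_vertex :: "nat \<Rightarrow> nat"
  where "pred_vertex j = (if j = 1 then N else j - 1)"

lemma single_mult_arrows:
  assumes "q \<in> V"
  shows "sgl q b \<otimes>\<^bsub>PA\<^esub> (\<Sum>i\<in>{1..N}. sgl (i, 1) 1) = sgl (pred_vertex (fst q), Suc (snd q)) b"
proof -
  have *: "path_target N (i, 1) = fst q \<longleftrightarrow> i = pred_vertex (fst q)" if "i \<in> {1..N}" for i
    using that assms by (cases "i = N") (auto simp: path_target_def pred_vertex_def)
  have "sgl q b \<otimes>\<^bsub>PA\<^esub> (\<Sum>i\<in>{1..N}. sgl (i, 1) 1)
      = (\<Sum>i\<in>{1..N}. if i = pred_vertex (fst q) then sgl (pred_vertex (fst q), Suc (snd q)) b else 0)"
    unfolding PA_mult_sum_right by (intro sum.cong refl) (use * in \<open>auto simp: PA_mult_single\<close>)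
  moreover have "pred_vertex (fst q) \<in> {1..N}" using assms N_pos by (auto simp: pred_vertex_def)
  ultimately show ?thesis by simp
qed

text \<open>Prolonging a path at its end equals rotating it by one vertex and prolonging the result
  at its start.\<close>

lemma arrows_left:
  assumes "x \<in> carrier PA"
  shows "\<exists>y\<in>carrier PA. (\<Sum>i\<in>{1..N}. sgl (i, 1) 1) \<otimes>\<^bsub>PA\<^esub> x = y \<otimes>\<^bsub>PA\<^esub> (\<Sum>i\<in>{1..N}. sgl (i, 1) 1)"
  using assms unfolding PA_simps(1)
proof (induction x rule: poly_mapping_single_induct)
  case zero
  then show ?case by (intro bexI[of _ 0]) (simp_all add: PA_simps PA_mult_zero)
next
  case (single p a)
  let ?q = "(fst p mod N + 1, snd p)"
  have q: "?q \<in> V" using N_pos by (simp add: Suc_leI)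
  have "pred_vertex (fst p mod N + 1) = fst p" using single by (cases "fst p = N") (auto simp: pred_vertex_def)
  then show ?case
    using arrows_mult_single[OF single, of a] single_mult_arrows[OF q, of a] q
    by (intro bexI[of _ "sgl ?q a"]) (simp_all add: PA_simps)
next
  case (add x y)
  then obtain x' y' where *: "x' \<in> carrier PA" "y' \<in> carrier PA"
    "(\<Sum>i\<in>{1..N}. sgl (i, 1) 1) \<otimes>\<^bsub>PA\<^esub> x = x' \<otimes>\<^bsub>PA\<^esub> (\<Sum>i\<in>{1..N}. sgl (i, 1) 1)"
    "(\<Sum>i\<in>{1..N}. sgl (i, 1) 1) \<otimes>\<^bsub>PA\<^esub> y = y' \<otimes>\<^bsub>PA\<^esub> (\<Sum>i\<in>{1..N}. sgl (i, 1) 1)" by blast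
  interpret ring PA by (rule ring_PA)
  have "x' + y' \<in> carrier PA" using a_closed[OF *(1,2)] by (simp add: PA_simps(2))
  then show ?case using *(3,4) by (intro bexI[of _ "x' + y'"]) (simp_all add: PA_mult_add_left PA_mult_add_right)
qed

lemma arrows_right:
  assumes "x \<in> carrier PA"
  shows "\<exists>y\<in>carrier PA. x \<otimes>\<^bsub>PA\<^esub> (\<Sum>i\<in>{1..N}. sgl (i, 1) 1) = (\<Sum>i\<in>{1..N}. sgl (i, 1) 1) \<otimes>\<^bsub>PA\<^esub> y"
  using assms unfolding PA_simps(1)
proof (induction x rule: poly_mapping_single_induct)
  case zero
  then show ?case by (intro bexI[of _ 0]) (simp_all add: PA_simps PA_mult_zero)
next
  case (single p a)
  let ?q = "(pred_vertex (fst p), snd p)"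
  have q: "?q \<in> V" using single N_pos by (auto simp: pred_vertex_def)
  then show ?case
    using arrows_mult_single[OF q, of a] single_mult_arrows[OF single, of a]
    by (intro bexI[of _ "sgl ?q a"]) (simp_all add: PA_simps)
next
  case (add x y)
  then obtain x' y' where *: "x' \<in> carrier PA" "y' \<in> carrier PA"
    "x \<otimes>\<^bsub>PA\<^esub> (\<Sum>i\<in>{1..N}. sgl (i, 1) 1) = (\<Sum>i\<in>{1..N}. sgl (i, 1) 1) \<otimes>\<^bsub>PA\<^esub> x'"
    "y \<otimes>\<^bsub>PA\<^esub> (\<Sum>i\<in>{1..N}. sgl (i, 1) 1) = (\<Sum>i\<in>{1..N}. sgl (i, 1) 1) \<otimes>\<^bsub>PA\<^esub> y'" by blast
  interpret ring PA by (rule ring_PA)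
  have "x' + y' \<in> carrier PA" using a_closed[OF *(1,2)] by (simp add: PA_simps(2))
  then show ?case using *(3,4) by (intro bexI[of _ "x' + y'"]) (simp_all add: PA_mult_add_left PA_mult_add_right)
qed

text \<open>A path starting at \<open>u\<close> is either trivial, giving the scalar part, or ends
  with an arrow that can be factored out on the left.\<close>

lemma vertex_split:
  assumes "x \<in> carrier PA" and u: "u \<in> {1..N}"
  shows "\<exists>a. \<exists>y\<in>carrier PA. x \<otimes>\<^bsub>PA\<^esub> sgl (u, 0) 1
    = scal a \<otimes>\<^bsub>PA\<^esub> sgl (u, 0) 1 + (\<Sum>i\<in>{1..N}. sgl (i, 1) 1) \<otimes>\<^bsub>PA\<^esub> y \<otimes>\<^bsub>PA\<^esub> sgl (u, 0) 1"
  using assms(1) unfolding PA_simps(1)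
proof (induction x rule: poly_mapping_single_induct)
  case zero
  then show ?case by (intro exI[of _ 0] bexI[of _ 0]) (simp_all add: PA_simps PA_mult_zero scal_mult_single)
next
  case (single p a)
  consider "u \<noteq> fst p" | "u = fst p" "snd p = 0" | l where "u = fst p" "snd p = Suc l"
    by (cases "snd p") auto
  then show ?case
  proof cases
    case 1
    then show ?thesis using path_target_trivial[OF u]
      by (intro exI[of _ 0] bexI[of _ 0]) (simp_all add: PA_simps PA_mult_zero scal_mult_single PA_mult_single)
  next
    case 2
    then have "p = (u, 0)" by (cases p) auto
    then show ?thesis using path_target_trivial[OF u]
      by (intro exI[of _ a] bexI[of _ 0]) (simp_all add: PA_simps PA_mult_zero scal_mult_single PA_mult_single)
  next
    case 3
    then have p: "p = (u, Suc l)" by (cases p) auto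
    have "(u, l) \<in> V" using u by simp
    then have "(\<Sum>i\<in>{1..N}. sgl (i, 1) 1) \<otimes>\<^bsub>PA\<^esub> sgl (u, l) a = sgl p a"
      using arrows_mult_single[of "(u, l)" a] p by simp
    then show ?thesis using \<open>(u, l) \<in> V\<close>
      by (intro exI[of _ 0] bexI[of _ "sgl (u, l) a"]) (simp_all add: PA_simps scal_mult_single)
  qed
next
  case (add x y)
  then obtain a b x' y' where *: "x' \<in> carrier PA" "y' \<in> carrier PA"
    "x \<otimes>\<^bsub>PA\<^esub> sgl (u, 0) 1 = scal a \<otimes>\<^bsub>PA\<^esub> sgl (u, 0) 1 + (\<Sum>i\<in>{1..N}. sgl (i, 1) 1) \<otimes>\<^bsub>PA\<^esub> x' \<otimes>\<^bsub>PA\<^esub> sgl (u, 0) 1"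
    "y \<otimes>\<^bsub>PA\<^esub> sgl (u, 0) 1 = scal b \<otimes>\<^bsub>PA\<^esub> sgl (u, 0) 1 + (\<Sum>i\<in>{1..N}. sgl (i, 1) 1) \<otimes>\<^bsub>PA\<^esub> y' \<otimes>\<^bsub>PA\<^esub> sgl (u, 0) 1" by blast
  interpret ring PA by (rule ring_PA)
  have "x' + y' \<in> carrier PA" using a_closed[OF *(1,2)] by (simp add: PA_simps(2))
  then show ?case using *(3,4)
    by (intro exI[of _ "a + b"] bexI[of _ "x' + y'"]) (simp_all add: PA_mult_add_left PA_mult_add_right scal_add)
qed

lemma single_carrier: "p \<in> V \<Longrightarrow> sgl p a \<in> carrier PA"
  by (simp add: PA_simps)

lemma vertex_in: "(i mod N + 1, l) \<in> V"
  using N_pos by (simp add: Suc_leI)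

lemma nak_A_pow: "nak_A [^]\<^bsub>PA Quot path_ideal K N S\<^esub> (m::nat) \<otimes>\<^bsub>PA Quot path_ideal K N S\<^esub> nak_e i
    = quot_class (sgl (i mod N + 1, m) 1)"
proof -
  interpret Q: ring "PA Quot path_ideal K N S" by (rule ideal.quotient_is_ring[OF path_ideal_ideal])
  have A: "nak_A \<in> carrier (PA Quot path_ideal K N S)" unfolding nak_A_def quot_carrier using sum_sgl_carrier by blast
  have e: "nak_e i \<in> carrier (PA Quot path_ideal K N S)"
    unfolding nak_e_def quot_carrier using single_carrier[OF vertex_in] by blast
  show ?thesis
  proof (induction m)
    case 0
    show ?case using e by (simp add: nak_e_def)
  next
    case (Suc m)
    have "nak_A [^]\<^bsub>PA Quot path_ideal K N S\<^esub> Suc m \<otimes>\<^bsub>PA Quot path_ideal K N S\<^esub> nak_e i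
        = nak_A \<otimes>\<^bsub>PA Quot path_ideal K N S\<^esub> quot_class (sgl (i mod N + 1, m) 1)"
      unfolding Q.nat_pow_Suc2[OF A] Suc[symmetric] using A e by (simp add: Q.m_assoc)
    also have "\<dots> = quot_class (sgl (i mod N + 1, Suc m) 1)"
      unfolding nak_A_def using quot_class_mult[OF sum_sgl_carrier single_carrier[OF vertex_in], of 1 1 i m 1]
        arrows_mult_single[OF vertex_in, of i m 1] by simp
    finally show ?case .
  qed
qed

theorem cyclic_shift_ring_quotient:
  "cyclic_shift_ring (PA Quot path_ideal K N S) nak_T nak_e nak_A N nak_c"
proof -
  let ?Q = "PA Quot path_ideal K N S"
  interpret PA: ring PA by (rule ring_PA)
  interpret Q: ring ?Q by (rule ideal.quotient_is_ring[OF path_ideal_ideal])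
  have arrows: "(\<Sum>i\<in>{1..N}. sgl (i, 1) 1) \<in> carrier PA" by (rule sum_sgl_carrier)
  have e: "sgl (i mod N + 1, 0) 1 \<in> carrier PA" for i by (rule single_carrier[OF vertex_in])
  have in_Q: "quot_class x \<in> carrier ?Q" if "x \<in> carrier PA" for x unfolding quot_carrier using that by blast
  have c: "nak_A [^]\<^bsub>?Q\<^esub> m \<otimes>\<^bsub>?Q\<^esub> nak_e i = \<zero>\<^bsub>?Q\<^esub> \<longleftrightarrow> nak_c i \<le> m" for m :: nat and i
  proof -
    have "S \<subseteq> V" using S by auto
    then show ?thesis
      unfolding nak_A_pow quot_class_zero_iff[OF single_carrier[OF vertex_in]]
      using single_in_path_ideal_iff[of S] vertex_in nak_c_iff by simp
  qed
  show ?thesis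
  proof
    show "\<zero>\<^bsub>?Q\<^esub> \<noteq> \<one>\<^bsub>?Q\<^esub>"
    proof
      assume z: "\<zero>\<^bsub>?Q\<^esub> = \<one>\<^bsub>?Q\<^esub>"
      have "nak_e 0 \<in> carrier ?Q" unfolding nak_e_def by (rule in_Q[OF e])
      then have "nak_A [^]\<^bsub>?Q\<^esub> (0::nat) \<otimes>\<^bsub>?Q\<^esub> nak_e 0 = \<zero>\<^bsub>?Q\<^esub>" using z by (simp add: z[symmetric])
      then have "nak_c 0 \<le> 0" using c by blast
      \<comment> \<open>In the zero ring even a trivial path would contain a relation, but relations
        have length at least 2.\<close>
      then have "has_relation S (0 mod N + 1, 0)" using nak_c_iff by blast
      then show False using S by (auto simp: has_relation_def)
    qed
    show "t \<in> carrier ?Q" if "t \<in> nak_T" for t using that in_Q scal_carrier by (auto simp: nak_T_def)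
    show "t \<otimes>\<^bsub>?Q\<^esub> a = a \<otimes>\<^bsub>?Q\<^esub> t" if "t \<in> nak_T" "a \<in> carrier ?Q" for t a
      using that scal_mult scal_carrier
      by (auto simp: nak_T_def quot_carrier quot_class_mult[symmetric])
    show "\<exists>t'\<in>nak_T. t' \<otimes>\<^bsub>?Q\<^esub> t = \<one>\<^bsub>?Q\<^esub>" if t: "t \<in> nak_T" "t \<noteq> \<zero>\<^bsub>?Q\<^esub>" for t
    proof -
      obtain a where a: "t = quot_class (scal a)" using t by (auto simp: nak_T_def)
      have "a \<noteq> 0"
      proof
        assume "a = 0"
        then have "scal a = 0" by (simp add: scal_def)
        then have "t = quot_class \<zero>\<^bsub>PA\<^esub>" using a by (simp add: PA_simps)
        then show False using t(2) quot_class_zero_iff[OF PA.zero_closed]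
          additive_subgroup.zero_closed[OF ideal.axioms(1)[OF path_ideal_ideal]] by simp
      qed
      then have "quot_class (scal (inverse a)) \<otimes>\<^bsub>?Q\<^esub> t = \<one>\<^bsub>?Q\<^esub>"
        unfolding a by (simp add: quot_class_mult[OF scal_carrier scal_carrier, symmetric] scal_scal scal_one quot_class_one)
      then show ?thesis by (auto simp: nak_T_def)
    qed
    show "\<ominus>\<^bsub>?Q\<^esub> \<one>\<^bsub>?Q\<^esub> \<in> nak_T"
    proof -
      have "quot_class (scal (- 1)) \<oplus>\<^bsub>?Q\<^esub> \<one>\<^bsub>?Q\<^esub> = quot_class (scal (- 1) + scal 1)"
        unfolding quot_class_add[OF scal_carrier scal_carrier] by (simp only: scal_one quot_class_one)
      also have "scal (- 1) + scal 1 = \<zero>\<^bsub>PA\<^esub>" using scal_add[of "- 1" 1] by (simp add: scal_def PA_simps)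
      also have "quot_class \<zero>\<^bsub>PA\<^esub> = \<zero>\<^bsub>?Q\<^esub>" using quot_class_zero_iff[OF PA.zero_closed]
          additive_subgroup.zero_closed[OF ideal.axioms(1)[OF path_ideal_ideal]] by simp
      finally have "quot_class (scal (- 1)) = \<ominus>\<^bsub>?Q\<^esub> \<one>\<^bsub>?Q\<^esub>"
        using Q.minus_equality in_Q[OF scal_carrier] by simp
      then show ?thesis by (metis nak_T_def rangeI)
    qed
    show "0 < N" by (rule N_pos)
    show "nak_e i \<in> carrier ?Q" for i unfolding nak_e_def by (rule in_Q[OF e])
    show "nak_e i \<otimes>\<^bsub>?Q\<^esub> nak_e i = nak_e i" for i
      unfolding nak_e_def quot_class_mult[OF e e, symmetric] by (simp add: PA_mult_single path_target_def)
    show "nak_e i \<otimes>\<^bsub>?Q\<^esub> nak_e j = \<zero>\<^bsub>?Q\<^esub>" if "i mod N \<noteq> j mod N" for i j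
    proof -
      have "sgl (i mod N + 1, 0) 1 \<otimes>\<^bsub>PA\<^esub> sgl (j mod N + 1, 0) 1 = \<zero>\<^bsub>PA\<^esub>"
        using that by (simp add: PA_mult_single path_target_def PA_simps)
      then show ?thesis
        unfolding nak_e_def quot_class_mult[OF e e, symmetric] using quot_class_zero_iff[OF PA.zero_closed]
          additive_subgroup.zero_closed[OF ideal.axioms(1)[OF path_ideal_ideal]] by simp
    qed
    show "nak_e i = nak_e j" if "i mod N = j mod N" for i j using that by (simp add: nak_e_def)
    show "(\<Oplus>\<^bsub>?Q\<^esub>i\<in>{..<N}. nak_e i) = \<one>\<^bsub>?Q\<^esub>"
    proof -
      have "(\<Oplus>\<^bsub>?Q\<^esub>i\<in>{..<n}. nak_e i) = quot_class (\<Sum>i<n. sgl (i mod N + 1, 0) 1)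
          \<and> (\<Sum>i<n. sgl (i mod N + 1, 0) 1) \<in> carrier PA" for n
      proof (induction n)
        case 0
        show ?case using quot_class_zero_iff[OF PA.zero_closed] PA.zero_closed
          additive_subgroup.zero_closed[OF ideal.axioms(1)[OF path_ideal_ideal]] by (simp add: PA_simps)
      next
        case (Suc n)
        have en: "nak_e i \<in> carrier ?Q" for i unfolding nak_e_def by (rule in_Q[OF e])
        have sum: "sgl (n mod N + 1, 0) 1 + (\<Sum>i<n. sgl (i mod N + 1, 0) 1) \<in> carrier PA"
          using PA.a_closed[OF e[of n]] Suc by (simp add: PA_simps(2))
        have "(\<Oplus>\<^bsub>?Q\<^esub>i\<in>{..<Suc n}. nak_e i) = nak_e n \<oplus>\<^bsub>?Q\<^esub> (\<Oplus>\<^bsub>?Q\<^esub>i\<in>{..<n}. nak_e i)"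
          using en by (simp add: lessThan_Suc)
        also have "\<dots> = quot_class (sgl (n mod N + 1, 0) 1 + (\<Sum>i<n. sgl (i mod N + 1, 0) 1))"
          using Suc quot_class_add[OF e[of n]] by (simp add: nak_e_def)
        finally show ?case using sum by (simp add: add.commute)
      qed
      moreover have "(\<Sum>i<N. sgl (i mod N + 1, 0) 1) = \<one>\<^bsub>PA\<^esub>"
        by (simp add: PA_simps(4) sum.atLeast1_atMost_eq)
      ultimately show ?thesis using quot_class_one by metis
    qed
    show "nak_A \<in> carrier ?Q" unfolding nak_A_def by (rule in_Q[OF arrows])
    show "nak_A \<otimes>\<^bsub>?Q\<^esub> nak_e i = nak_e (Suc i) \<otimes>\<^bsub>?Q\<^esub> nak_A" for i
    proof -
      have "pred_vertex (Suc i mod N + 1) = i mod N + 1"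
        using N_pos by (cases "Suc (i mod N) = N") (auto simp: pred_vertex_def mod_Suc)
      then have "(\<Sum>i\<in>{1..N}. sgl (i, 1) 1) \<otimes>\<^bsub>PA\<^esub> sgl (i mod N + 1, 0) 1
          = sgl (Suc i mod N + 1, 0) 1 \<otimes>\<^bsub>PA\<^esub> (\<Sum>i\<in>{1..N}. sgl (i, 1) 1)"
        using arrows_mult_single[OF vertex_in, of i 0 1] single_mult_arrows[OF vertex_in, of "Suc i" 0 1] by simp
      then show ?thesis
        unfolding nak_A_def nak_e_def
        using quot_class_mult[OF arrows e, of i] quot_class_mult[OF e arrows, of "Suc i"] by simp
    qed
    show "\<exists>b\<in>carrier ?Q. nak_A \<otimes>\<^bsub>?Q\<^esub> a = b \<otimes>\<^bsub>?Q\<^esub> nak_A" if a: "a \<in> carrier ?Q" for a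
    proof -
      obtain x where x: "x \<in> carrier PA" "a = quot_class x" using a unfolding quot_carrier by blast
      then obtain y where y: "y \<in> carrier PA"
        "(\<Sum>i\<in>{1..N}. sgl (i, 1) 1) \<otimes>\<^bsub>PA\<^esub> x = y \<otimes>\<^bsub>PA\<^esub> (\<Sum>i\<in>{1..N}. sgl (i, 1) 1)"
        using arrows_left by blast
      then show ?thesis unfolding nak_A_def x(2)
        using quot_class_mult[OF arrows x(1)] quot_class_mult[OF y(1) arrows] in_Q by (intro bexI[of _ "quot_class y"]) simp_all
    qed
    show "\<exists>b\<in>carrier ?Q. a \<otimes>\<^bsub>?Q\<^esub> nak_A = nak_A \<otimes>\<^bsub>?Q\<^esub> b" if a: "a \<in> carrier ?Q" for a
    proof -
      obtain x where x: "x \<in> carrier PA" "a = quot_class x" using a unfolding quot_carrier by blast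
      then obtain y where y: "y \<in> carrier PA"
        "x \<otimes>\<^bsub>PA\<^esub> (\<Sum>i\<in>{1..N}. sgl (i, 1) 1) = (\<Sum>i\<in>{1..N}. sgl (i, 1) 1) \<otimes>\<^bsub>PA\<^esub> y"
        using arrows_right by blast
      then show ?thesis unfolding nak_A_def x(2)
        using quot_class_mult[OF x(1) arrows] quot_class_mult[OF arrows y(1)] in_Q by (intro bexI[of _ "quot_class y"]) simp_all
    qed
    show "\<exists>t\<in>nak_T. \<exists>b\<in>carrier ?Q. a \<otimes>\<^bsub>?Q\<^esub> nak_e i = t \<otimes>\<^bsub>?Q\<^esub> nak_e i \<oplus>\<^bsub>?Q\<^esub> nak_A \<otimes>\<^bsub>?Q\<^esub> b \<otimes>\<^bsub>?Q\<^esub> nak_e i"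
      if a: "a \<in> carrier ?Q" for a i
    proof -
      obtain x where x: "x \<in> carrier PA" "a = quot_class x" using a unfolding quot_carrier by blast
      have "i mod N + 1 \<in> {1..N}" using vertex_in[of i 0] by simp
      from vertex_split[OF x(1) this] obtain b y where y: "y \<in> carrier PA"
        "x \<otimes>\<^bsub>PA\<^esub> sgl (i mod N + 1, 0) 1 = scal b \<otimes>\<^bsub>PA\<^esub> sgl (i mod N + 1, 0) 1
          + (\<Sum>i\<in>{1..N}. sgl (i, 1) 1) \<otimes>\<^bsub>PA\<^esub> y \<otimes>\<^bsub>PA\<^esub> sgl (i mod N + 1, 0) 1" by blast
      have "a \<otimes>\<^bsub>?Q\<^esub> nak_e i = quot_class (scal b) \<otimes>\<^bsub>?Q\<^esub> nak_e i \<oplus>\<^bsub>?Q\<^esub> nak_A \<otimes>\<^bsub>?Q\<^esub> quot_class y \<otimes>\<^bsub>?Q\<^esub> nak_e i"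
        unfolding x(2) nak_e_def nak_A_def quot_class_mult[OF x(1) e, symmetric] y(2)
        by (simp only: quot_class_add[OF PA.m_closed[OF scal_carrier e] PA.m_closed[OF PA.m_closed[OF arrows y(1)] e]]
          quot_class_mult[OF scal_carrier e] quot_class_mult[OF PA.m_closed[OF arrows y(1)] e] quot_class_mult[OF arrows y(1)])
      then show ?thesis using in_Q[OF y(1)] by (auto simp: nak_T_def)
    qed
    show "nak_A [^]\<^bsub>?Q\<^esub> m \<otimes>\<^bsub>?Q\<^esub> nak_e i = \<zero>\<^bsub>?Q\<^esub> \<longleftrightarrow> nak_c i \<le> m" for m :: nat and i by (rule c)
  qed
qed

section \<open>Ends of relations\<close>

text \<open>A shortest vanishing path ends exactly where the relation inside it ends, for otherwise
  it could be cut shorter. So the values of the shift modulo \<open>N\<close> are among the ends of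
  relations.\<close>

lemma nak_c_target:
  obtains \<rho> where "\<rho> \<in> S" "(u + nak_c u) mod N = (fst \<rho> - 1 + snd \<rho>) mod N"
proof -
  have "has_relation S (u mod N + 1, nak_c u)" using nak_c_iff by blast
  then obtain \<rho> d where \<rho>: "\<rho> \<in> S" "path_target N (u mod N + 1, d) = fst \<rho>" "d + snd \<rho> \<le> nak_c u"
    by (auto simp: has_relation_def)
  then have "has_relation S (u mod N + 1, d + snd \<rho>)" unfolding has_relation_def by auto
  then have "nak_c u = d + snd \<rho>" using nak_c_iff \<rho>(3) by (simp add: le_antisym)
  moreover have "fst \<rho> - 1 = (u + d) mod N" using \<rho>(2) by (auto simp: path_target_def mod_add_left_eq)
  ultimately have "(u + nak_c u) mod N = (fst \<rho> - 1 + snd \<rho>) mod N" by (simp add: mod_add_left_eq add.assoc)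
  then show ?thesis using that \<rho>(1) by blast
qed

theorem phi_dim_quotient_le:
  assumes fin: "finite S"
  shows "phi_dim (PA Quot path_ideal K N S) \<le> enat (2 * card S)"
proof -
  interpret C: cyclic_shift_ring "PA Quot path_ideal K N S" nak_T nak_e nak_A N nak_c
    by (rule cyclic_shift_ring_quotient)
  have "(\<lambda>u. C.f u mod N) ` UNIV \<subseteq> (\<lambda>\<rho>. (fst \<rho> - 1 + snd \<rho>) mod N) ` S"
  proof
    fix y assume "y \<in> (\<lambda>u. C.f u mod N) ` UNIV"
    then obtain u where "y = (u + nak_c u) mod N" by (auto simp: C.f_def)
    moreover obtain \<rho> where "\<rho> \<in> S" "(u + nak_c u) mod N = (fst \<rho> - 1 + snd \<rho>) mod N"
      by (rule nak_c_target)
    ultimately show "y \<in> (\<lambda>\<rho>. (fst \<rho> - 1 + snd \<rho>) mod N) ` S" by (intro image_eqI[of _ _ \<rho>]) simp_all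
  qed
  then have "card ((\<lambda>u. C.f u mod N) ` UNIV) \<le> card S"
    by (rule surj_card_le[OF fin])
  then show ?thesis by (rule C.phi_dim_le)
qed

end

end

subsection \<open>Algebras attaining the bound\<close>

text \<open>On vertex indices modulo \<open>N = r + 2\<close>, the shift \<open>u \<mapsto> u + c u\<close> of this algebra moves every vertex one
  step towards the fixed vertex \<open>N - 1\<close>, except that it maps \<open>0\<close> to \<open>2\<close>; starting at \<open>1\<close> it takes
  exactly \<open>r\<close> iterations to reach the fixed vertex.\<close>

definition extremal_relations :: "nat \<Rightarrow> (nat \<times> nat) list"
  where "extremal_relations r = map (\<lambda>k. (k + 1, 2 * (r + 2) + 1)) [1..<r] @ [(r + 2, 2 * (r + 2))]"

lemma extremal_relations_props:
  assumes "1 \<le> r"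
  shows "length (extremal_relations r) = r" "sorted_wrt (<) (map fst (extremal_relations r))"
    "set (extremal_relations r) \<subseteq> {1..r + 2} \<times> {2..}" "extremal_relations r \<noteq> []"
  using assms by (auto simp: extremal_relations_def sorted_wrt_append sorted_wrt_map comp_def)

lemma set_extremal_relations:
  "set (extremal_relations r) = {(k + 1, 2 * (r + 2) + 1) | k. 1 \<le> k \<and> k < r} \<union> {(r + 2, 2 * (r + 2))}"
  by (auto simp: extremal_relations_def)

text \<open>All lengths are \<open>2 * N\<close> or one more, with \<open>N = r + 2\<close>. One
  relation can therefore sit inside another only with offset at most 1, and the sources leave no
  room for that.\<close>

lemma nakayama_relations_extremal:
  assumes r: "1 \<le> r"
  shows "nakayama_relations TYPE('k::field) (r + 2) (extremal_relations r)"
proof -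
  let ?S = "set (extremal_relations r)"
  have N: "0 < r + 2" by simp
  have "Poly_Mapping.single \<rho> 1 \<notin> path_ideal TYPE('k) (r + 2) (?S - {\<rho>})" if \<rho>: "\<rho> \<in> ?S" for \<rho>
  proof -
    have V: "?S - {\<rho>} \<subseteq> {1..r + 2} \<times> UNIV" "\<rho> \<in> {1..r + 2} \<times> UNIV"
      using extremal_relations_props(3)[OF r] \<rho> by auto
    have "\<not> has_relation (r + 2) (?S - {\<rho>}) \<rho>"
    proof
      assume "has_relation (r + 2) (?S - {\<rho>}) \<rho>"
      then obtain \<sigma> d where \<sigma>: "\<sigma> \<in> ?S" "\<sigma> \<noteq> \<rho>" "path_target (r + 2) (fst \<rho>, d) = fst \<sigma>" "d + snd \<sigma> \<le> snd \<rho>"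
        unfolding has_relation_def[OF N] by blast
      consider k where "\<rho> = (k + 1, 2 * (r + 2) + 1)" "1 \<le> k" "k < r" | "\<rho> = (r + 2, 2 * (r + 2))"
        using \<rho> unfolding set_extremal_relations by blast
      then show False
      proof cases
        case 1
        consider j where "\<sigma> = (j + 1, 2 * (r + 2) + 1)" | "\<sigma> = (r + 2, 2 * (r + 2))"
          using \<sigma>(1) unfolding set_extremal_relations by blast
        then show ?thesis
        proof cases
          case 1
          then have "d = 0" using \<sigma>(4) \<open>\<rho> = _\<close> by simp
          then show ?thesis using \<sigma>(2,3) \<open>\<rho> = _\<close> 1 \<open>k < r\<close> by (simp add: path_target_def)
        next
          case 2
          \<comment> \<open>The shorter relation starts at index \<open>r + 1\<close>, which is out
            of reach by one arrow from an index \<open>k < r\<close>.\<close>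
          then have "d \<le> 1" using \<sigma>(4) \<open>\<rho> = _\<close> by simp
          then have "(k + d) mod (r + 2) = k + d" "k + d \<noteq> r + 1" using \<open>k < r\<close> by auto
          then show ?thesis using \<sigma>(3) \<open>\<rho> = _\<close> 2 by (simp add: path_target_def)
        qed
      next
        case 2
        then show ?thesis using \<sigma> unfolding set_extremal_relations by auto
      qed
    qed
    then show ?thesis using single_in_path_ideal_iff[OF N V] by simp
  qed
  then show ?thesis
    using extremal_relations_props[OF r] unfolding nakayama_relations_def by blast
qed

text \<open>The fixed index \<open>N - 1\<close> serves twice: its projective of length
  \<open>2 * N\<close> provides a module that is its own syzygy, and the interval from
  \<open>N - 1\<close> to \<open>1 + 2 * N\<close> resolves in exactly \<open>2 * r\<close>
  steps.\<close>

lemma extremal_invariants: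
  assumes r: "1 \<le> r"
  shows "gl_dim (nakayama_algebra TYPE('k::field) (r + 2) (extremal_relations r)) = \<infinity>"
    "enat (2 * r) \<le> phi_dim (nakayama_algebra TYPE('k) (r + 2) (extremal_relations r))"
proof -
  define N where "N = r + 2"
  have N: "0 < N" by (simp add: N_def)
  define S where "S = set (extremal_relations r)"
  have S: "S \<subseteq> {1..N} \<times> {2..}" "S \<noteq> {}"
    using extremal_relations_props(3,4)[OF r] by (auto simp: S_def N_def)
  let ?R = "nakayama_algebra TYPE('k) N (extremal_relations r)"
  have R: "?R = cyclic_path_algebra TYPE('k) N Quot path_ideal TYPE('k) N S"
    by (simp add: nakayama_algebra_def S_def)
  let ?c = "nak_c N S"
  interpret C: cyclic_shift_ring ?R "nak_T TYPE('k) N S" "nak_e TYPE('k) N S" "nak_A TYPE('k) N S" N ?c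
    unfolding R by (rule cyclic_shift_ring_quotient[OF N S])
  note c_iff = nak_c_iff[OF N S]
  have c_eq: "?c i = Suc m" if "has_relation N S (i mod N + 1, Suc m)" "\<not> has_relation N S (i mod N + 1, m)" for i m
    using that unfolding c_iff by simp
  have S_eq: "S = {(k + 1, 2 * N + 1) | k. 1 \<le> k \<and> k < r} \<union> {(N, 2 * N)}"
    unfolding S_def set_extremal_relations N_def ..
  have long: "2 * N \<le> snd \<rho>" if "\<rho> \<in> S" for \<rho> using that unfolding S_eq by auto
  have c_last: "?c (N - 1) = 2 * N"
  proof -
    have "has_relation N S ((N - 1) mod N + 1, 2 * N)"
      unfolding has_relation_def[OF N] by (rule bexI[of _ "(N, 2 * N)"]) (auto simp: S_eq path_target_def N_def intro!: exI[of _ 0])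
    moreover have "\<not> has_relation N S ((N - 1) mod N + 1, 2 * N - 1)"
      using long N unfolding has_relation_def[OF N] by fastforce
    ultimately show ?thesis using c_eq[of "N - 1" "2 * N - 1"] N by simp
  qed
  have c_mid: "?c k = 2 * N + 1" if k: "1 \<le> k" "k \<le> r" for k
  proof -
    have km: "k mod N = k" using k by (simp add: N_def)
    have "has_relation N S (k mod N + 1, Suc (2 * N))"
    proof (cases "k < r")
      case True
      then have "(k + 1, 2 * N + 1) \<in> S" using k unfolding S_eq by blast
      then show ?thesis unfolding has_relation_def[OF N] km
        by (rule bexI[rotated]) (use k in \<open>auto simp: path_target_def N_def intro!: exI[of _ 0]\<close>)
    next
      \<comment> \<open>Index \<open>r\<close> has no relation of its own: one arrow leads to the
        last relation, of length \<open>2 * N\<close>, so the total is again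
        \<open>2 * N + 1\<close>.\<close>
      case False
      then have "k = r" using k by simp
      have "(N, 2 * N) \<in> S" unfolding S_eq by blast
      then show ?thesis unfolding has_relation_def[OF N] km
        by (rule bexI[rotated]) (use \<open>k = r\<close> in \<open>auto simp: path_target_def N_def intro!: exI[of _ 1]\<close>)
    qed
    moreover have "\<not> has_relation N S (k mod N + 1, 2 * N)"
    proof
      assume "has_relation N S (k mod N + 1, 2 * N)"
      then obtain \<rho> d where \<rho>: "\<rho> \<in> S" "path_target N (k + 1, d) = fst \<rho>" "d + snd \<rho> \<le> 2 * N"
        unfolding has_relation_def[OF N] km by auto
      \<comment> \<open>A path of length \<open>2 * N\<close> has room only for the shortest
        relation, without offset, but that one starts at another vertex.\<close>
      then have "d = 0" "snd \<rho> = 2 * N" using long[OF \<rho>(1)] by auto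
      then have "fst \<rho> = N" using \<rho>(1) unfolding S_eq by auto
      then show False using \<rho>(2) \<open>d = 0\<close> km k by (simp add: path_target_def N_def)
    qed
    ultimately show ?thesis using c_eq[of k "2 * N"] by simp
  qed
  have f_shift: "C.f (u + q * N) = C.f u + q * N" for u q
    using funpow_shift[of C.f N 1 u q] C.f_shift by simp
  have f_last: "(C.f ^^ t) (N - 1) = N - 1 + 2 * t * N" for t
  proof (induction t)
    case (Suc t)
    have "(C.f ^^ Suc t) (N - 1) = C.f (N - 1 + 2 * t * N)" using Suc by simp
    also have "\<dots> = C.f (N - 1) + 2 * t * N" by (rule f_shift)
    also have "C.f (N - 1) = N - 1 + 2 * N" using c_last by (simp add: C.f_def)
    finally show ?case by (simp add: algebra_simps)
  qed simp
  have f_one: "t < r \<Longrightarrow> (C.f ^^ t) 1 = 1 + t + 2 * t * N" for t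
  proof (induction t)
    case (Suc t)
    have "(C.f ^^ Suc t) 1 = C.f (1 + t + 2 * t * N)" using Suc by simp
    also have "\<dots> = C.f (1 + t) + 2 * t * N" by (rule f_shift)
    also have "C.f (1 + t) = 1 + t + (2 * N + 1)" using c_mid[of "1 + t"] Suc.prems by (simp add: C.f_def)
    finally show ?case by (simp add: algebra_simps)
  qed simp
  obtain s where s: "r = Suc s" using r by (cases r) auto
  \<comment> \<open>The right end starts two turns ahead, which compensates for the one iteration by
    which it lags: \<open>f ^^ s\<close> sends it to one position before the image of the left end
    under \<open>f ^^ Suc s\<close>. The odd syzygy there is a simple module.\<close>
  have f_j: "(C.f ^^ s) (1 + 2 * N) = r + 2 * r * N"
    using funpow_shift[of C.f N s 1 2, OF C.f_shift] f_one[of s] s by (simp add: algebra_simps)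
  have f_r: "C.f (r + 2 * r * N) = r + 1 + 2 * N + 2 * r * N"
    unfolding f_shift using c_mid[of r] r by (simp add: C.f_def)
  show "gl_dim (nakayama_algebra TYPE('k) (r + 2) (extremal_relations r)) = \<infinity>"
    using C.gl_dim_infinite[of N "N - 1"] c_last N by (simp add: N_def)
  \<comment> \<open>The interval has length \<open>N + 2\<close>, which fits into the projective of
    length \<open>2 * N\<close>.\<close>
  have "1 + 2 * N - (N - 1) \<le> ?c (N - 1)" using c_last by (simp add: N_def)
  then obtain X :: "(nat \<times> nat \<Rightarrow>\<^sub>0 'k) set lmod" where X: "C.interval X (N - 1) (1 + 2 * N - (N - 1))"
    by (rule C.interval_exists)
  have "phi ?R X = 2 * Suc s"
  proof (rule C.phi_interval[OF X])
    show "N - 1 < 1 + 2 * N" by simp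
    show "(C.f ^^ s) (1 + 2 * N) < (C.f ^^ Suc s) (N - 1)"
      unfolding f_j f_last using s by (simp add: N_def)
    show "(C.f ^^ Suc s) (N - 1) \<noteq> C.f ((C.f ^^ s) (1 + 2 * N))"
      unfolding f_j f_last f_r using s by (simp add: N_def)
    have "C.f ((C.f ^^ Suc s) (N - 1)) = (C.f ^^ Suc (Suc s)) (N - 1)" by simp
    also have "\<dots> = N - 1 + 2 * Suc (Suc s) * N" by (rule f_last)
    finally show "(C.f ^^ Suc s) (1 + 2 * N) = C.f ((C.f ^^ Suc s) (N - 1))"
      using f_j f_r s by (simp add: N_def)
  qed
  then have "enat (2 * r) = enat (phi ?R X)" using s by simp
  also have "\<dots> \<le> phi_dim ?R"
    unfolding phi_dim_def by (rule SUP_upper[OF C.interval_in_fg[OF X]])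
  finally show "enat (2 * r) \<le> phi_dim (nakayama_algebra TYPE('k) (r + 2) (extremal_relations r))"
    by (simp add: N_def)
qed

section \<open>The bound for Nakayama algebras and its sharpness\<close>

lemma phi_dim_nakayama_le:
  assumes "3 \<le> N" "nakayama_relations TYPE('k::field) N rels"
  shows "phi_dim (nakayama_algebra TYPE('k) N rels) \<le> enat (2 * length rels)"
proof -
  have "0 < N" "set rels \<subseteq> {1..N} \<times> {2..}" "set rels \<noteq> {}"
    using assms by (auto simp: nakayama_relations_def)
  then have "phi_dim (nakayama_algebra TYPE('k) N rels) \<le> enat (2 * card (set rels))"
    unfolding nakayama_algebra_def by (rule phi_dim_quotient_le) simp
  also have "\<dots> \<le> enat (2 * length rels)" using card_length[of rels] by simp
  finally show ?thesis .
qed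

theorem mainTheorem2:
  shows "(\<forall>N rels. 3 \<le> N \<and> nakayama_relations TYPE('k::field) N rels \<and>
            gl_dim (nakayama_algebra TYPE('k) N rels) = \<infinity>
            \<longrightarrow> phi_dim (nakayama_algebra TYPE('k) N rels) \<le> enat (2 * length rels))
       \<and> (\<forall>r\<ge>1. \<exists>N rels. 3 \<le> N \<and> nakayama_relations TYPE('k) N rels \<and> length rels = r \<and>
            gl_dim (nakayama_algebra TYPE('k) N rels) = \<infinity> \<and>
            phi_dim (nakayama_algebra TYPE('k) N rels) = enat (2 * r))"
proof (intro conjI allI impI)
  fix N rels
  assume "3 \<le> N \<and> nakayama_relations TYPE('k) N rels \<and> gl_dim (nakayama_algebra TYPE('k) N rels) = \<infinity>"
  then show "phi_dim (nakayama_algebra TYPE('k) N rels) \<le> enat (2 * length rels)"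
    using phi_dim_nakayama_le by blast
next
  fix r :: nat
  assume r: "1 \<le> r"
  let ?R = "nakayama_algebra TYPE('k) (r + 2) (extremal_relations r)"
  have "3 \<le> r + 2" "nakayama_relations TYPE('k) (r + 2) (extremal_relations r)"
    "length (extremal_relations r) = r"
    using r nakayama_relations_extremal[OF r] extremal_relations_props(1)[OF r] by simp_all
  moreover from this have "phi_dim ?R \<le> enat (2 * r)" using phi_dim_nakayama_le by metis
  then have "phi_dim ?R = enat (2 * r)" using extremal_invariants(2)[OF r] by (rule order_antisym)
  ultimately show "\<exists>N rels. 3 \<le> N \<and> nakayama_relations TYPE('k) N rels \<and> length rels = r \<and>
      gl_dim (nakayama_algebra TYPE('k) N rels) = \<infinity> \<and> phi_dim (nakayama_algebra TYPE('k) N rels) = enat (2 * r)"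
    using extremal_invariants(1)[OF r] by blast
qed

end
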